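(* There exists an algorithm that, given as input natural numbers $m,d$ and a (rational) $\varepsilon>0$, outputs a number $c'(m,d)$ satisfying $|c'(m,d)-c(m,d)|<\varepsilon$.
   Context: A family of finite sets $X_1,\dots,X_m\subseteq\mathbb{R}^d$ is in general position if the sets are pairwise disjoint and their union is a set of points in general position. Sets $Y_1,\dots,Y_{d+1}\subseteq\mathbb{R}^d$ have the same-type property if for every choice $y_1\in Y_1,\dots,y_{d+1}\in Y_{d+1}$ the orientation of $(y_1,\dots,y_{d+1})$ is the same; sets $Y_1,\dots,Y_m$ have the same-type property if every $d+1$ of them do. For a family $X_1,\dots,X_m$ of nonempty finite sets in general position, $c(X_1,\dots,X_m)$ is the largest $c$ such that there exist $Y_i\subseteq X_i$ with the same-type property and $|Y_i|\ge c|X_i|$ for all $i$. The constant $c(m,d)$ is the infimum of $c(X_1,\dots,X_m)$ over all such families of $m$ finite sets in $\mathbb{R}^d$. *)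

theory Defs
  imports Complex_Main "HOL-Combinatorics.Permutations"
begin

datatype recf = Z | S | Id nat | Cn recf "recf list" | Pr recf recf | Mn recf

inductive recf_eval :: "recf \<Rightarrow> nat list \<Rightarrow> nat \<Rightarrow> bool" where
  zero: "recf_eval Z xs 0"
| succ: "recf_eval S (x # xs) (Suc x)"
| proj: "i < length xs \<Longrightarrow> recf_eval (Id i) xs (xs ! i)"
| comp: "length ys = length gs \<Longrightarrow> (\<forall>i<length gs. recf_eval (gs ! i) xs (ys ! i))
         \<Longrightarrow> recf_eval f ys z \<Longrightarrow> recf_eval (Cn f gs) xs z"
| pr0: "recf_eval f xs z \<Longrightarrow> recf_eval (Pr f g) (0 # xs) z"
| prS: "recf_eval (Pr f g) (n # xs) y \<Longrightarrow> recf_eval g (n # y # xs) z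
         \<Longrightarrow> recf_eval (Pr f g) (Suc n # xs) z"
| mn: "recf_eval f (n # xs) 0 \<Longrightarrow> (\<forall>k<n. \<exists>y. recf_eval f (k # xs) (Suc y))
         \<Longrightarrow> recf_eval (Mn f) xs n"

text \<open>A point of R^d is a function nat => real vanishing at coordinates >= d.\<close>
type_synonym point = "nat \<Rightarrow> real"

definition in_Rd :: "nat \<Rightarrow> point \<Rightarrow> bool" where
  "in_Rd d p \<longleftrightarrow> (\<forall>k\<ge>d. p k = 0)"

definition det_n :: "nat \<Rightarrow> (nat \<Rightarrow> nat \<Rightarrow> real) \<Rightarrow> real" where
  "det_n n A = (\<Sum>\<sigma> | \<sigma> permutes {..<n}. of_int (sign \<sigma>) * (\<Prod>i<n. A i (\<sigma> i)))"

definition orientation :: "nat \<Rightarrow> (nat \<Rightarrow> point) \<Rightarrow> real" where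
  "orientation d ys = sgn (det_n (Suc d) (\<lambda>i j. if j = 0 then 1 else ys i (j - 1)))"

definition gen_pos_points :: "nat \<Rightarrow> point set \<Rightarrow> bool" where
  "gen_pos_points d P \<longleftrightarrow> (\<forall>ys. (\<forall>i\<le>d. ys i \<in> P) \<longrightarrow> inj_on ys {..d} \<longrightarrow> orientation d ys \<noteq> 0)"

definition gen_pos_family :: "nat \<Rightarrow> nat \<Rightarrow> (nat \<Rightarrow> point set) \<Rightarrow> bool" where
  "gen_pos_family d m X \<longleftrightarrow>
     (\<forall>i<m. \<forall>p\<in>X i. in_Rd d p) \<and>
     (\<forall>i<m. \<forall>j<m. i \<noteq> j \<longrightarrow> X i \<inter> X j = {}) \<and>
     gen_pos_points d (\<Union>i<m. X i)"

definition same_type :: "nat \<Rightarrow> nat \<Rightarrow> (nat \<Rightarrow> point set) \<Rightarrow> bool" where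
  "same_type d m Y \<longleftrightarrow>
     (\<forall>idx. strict_mono_on {..d} idx \<longrightarrow> idx d < m \<longrightarrow>
        (\<exists>s. \<forall>ys. (\<forall>i\<le>d. ys i \<in> Y (idx i)) \<longrightarrow> orientation d ys = s))"

definition c_fam :: "nat \<Rightarrow> nat \<Rightarrow> (nat \<Rightarrow> point set) \<Rightarrow> real" where
  "c_fam d m X = Sup {c. \<exists>Y. same_type d m Y \<and>
       (\<forall>i<m. Y i \<subseteq> X i \<and> c * real (card (X i)) \<le> real (card (Y i)))}"

definition c_const :: "nat \<Rightarrow> nat \<Rightarrow> real" where
  "c_const m d = Inf {c_fam d m X | X. gen_pos_family d m X \<and> (\<forall>i<m. finite (X i) \<and> X i \<noteq> {})}"

end

theory Submission
  imports Defs "HOL-Library.FuncSet" "HOL-Computational_Algebra.Polynomial" "Jordan_Normal_Form.Determinant"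
begin

text \<open>
  The constant c(m,d) is approximated by the minimum of c(X) over families X of bounded size with
  coordinates on a bounded grid, which can be found by exhaustive search.  Two facts make this work.

  \<^item> Sampling.  Being of the same type is witnessed by hyperplanes separating, for each of the sign patterns
    on d+1 of the sets, the sets with sign + from those with sign -.  Intersections of a bounded number of half-spaces
    cut out only polynomially many subsets, so repeated halving guided by an exponential potential
    replaces each set by a subset of bounded size on which all their densities change little.
    A same-type choice in the samples then spreads to one of almost the same density in the original family.

  \<^item> Realisation.  The coordinates are chosen one after the other by a back-and-forth argument: if two tuples
    agree on the signs of all polynomials up to some complexity, then each extension of one by a further coordinate
    is matched by an extension of the other, at a computable loss of complexity (Cohen and Hoermander's
    elimination, read semantically).  Start with a single parameter h that bounds the
    coordinates and the inverses of the determinants of the given configuration.  Beyond an explicit bound all values of h have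
    the same signs, hence h may be taken to be that bound, and rounding gives a configuration on a grid of computable size.
\<close>

subsection \<open>Determinants and orientations\<close>

text \<open>For a given number of points and a given dimension there are only finitely many order
  types, so some grid realises all of them; the difficulty is that its size must be a recursive
  function of \<open>T\<close> and \<open>d\<close>, because it bounds the search. Hence every lemma
  on signs carries an explicit cost in depth k and degree D, up to the recurrences
  \<open>lvl0\<close>, \<open>qe_level\<close> and \<open>back_level\<close>. Likewise the sample
  size must not depend on the family. The errors are one-sided. A family on the grid is a genuine
  family, so a failed test bounds c(m,d) from above without loss; only the passage from an arbitrary
  family to its sample loses 1/(2b), and only in the lower bound. Densities are tested in steps of
  1/(2b) as well, so the least p for which the test of p + 1 fails satisfies (p-1)/(2b) <= c(m,d) <=
  (p+1)/(2b). Separation enters because the same-type property is a condition on tuples of points,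
  whereas sampling needs, for each single set, a fixed family of subsets of bounded
  complexity.\<close>

definition hdet :: "nat \<Rightarrow> (nat \<Rightarrow> point) \<Rightarrow> real" where
  "hdet d ys = det_n (Suc d) (\<lambda>i j. if j = 0 then 1 else ys i (j - 1))"

lemma orientation_eq: "orientation d ys = sgn (hdet d ys)"
  by (simp add: orientation_def hdet_def)

lemma det_n_cong:
  assumes "\<And>i j. i < n \<Longrightarrow> j < n \<Longrightarrow> A i j = B i j"
  shows "det_n n A = det_n n B"
  unfolding det_n_def
proof (rule sum.cong[OF refl])
  fix \<sigma> assume "\<sigma> \<in> {\<sigma>. \<sigma> permutes {..<n}}"
  then have "\<sigma> i < n" if "i < n" for i using that permutes_in_image by fastforce
  then have "(\<Prod>i<n. A i (\<sigma> i)) = (\<Prod>i<n. B i (\<sigma> i))" using assms by (intro prod.cong) auto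
  then show "of_int (sign \<sigma>) * (\<Prod>i<n. A i (\<sigma> i)) = of_int (sign \<sigma>) * (\<Prod>i<n. B i (\<sigma> i))" by simp
qed

lemma hdet_cong:
  assumes "\<And>i k. i \<le> d \<Longrightarrow> k < d \<Longrightarrow> ys i k = zs i k"
  shows "hdet d ys = hdet d zs"
  unfolding hdet_def by (rule det_n_cong) (use assms in auto)

subsection \<open>Matching sign patterns of univariate polynomials\<close>

text \<open>The pairs in \<open>pair_cl G k\<close> are the values at two points of one and the same polynomial expression of depth at
  most k, the pairs in G being the values of the variables.  So \<open>sgn_ok G k\<close> says that no expression of
  depth k tells the two points apart by its sign; no syntax of expressions is needed.\<close>

primrec pair_cl :: "(real \<times> real) set \<Rightarrow> nat \<Rightarrow> (real \<times> real) set" where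
  "pair_cl G 0 = G \<union> {(0,0), (1,1), (-1,-1)}"
| "pair_cl G (Suc k) = pair_cl G k \<union> (\<lambda>((a,b),(c,d)). (a + c, b + d)) ` (pair_cl G k \<times> pair_cl G k)
     \<union> (\<lambda>((a,b),(c,d)). (a * c, b * d)) ` (pair_cl G k \<times> pair_cl G k)"

definition sgn_ok :: "(real \<times> real) set \<Rightarrow> nat \<Rightarrow> bool" where
  "sgn_ok G k \<longleftrightarrow> (\<forall>(a,b)\<in>pair_cl G k. sgn a = sgn b)"

text \<open>One formal polynomial in a new variable, its coefficients evaluated at the two points. D
  only bounds the degree; the actual degrees agree once \<open>sgn_ok\<close> holds.\<close>

definition pair_polys :: "(real \<times> real) set \<Rightarrow> nat \<Rightarrow> nat \<Rightarrow> (real poly \<times> real poly) set" where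
  "pair_polys G k D = {(p,q). degree p \<le> D \<and> degree q \<le> D \<and> (\<forall>i. (coeff p i, coeff q i) \<in> pair_cl G k)}"

definition sgn_match :: "(real \<times> real) set \<Rightarrow> nat \<Rightarrow> nat \<Rightarrow> real \<Rightarrow> real \<Rightarrow> bool" where
  "sgn_match G k D y y' \<longleftrightarrow> (\<forall>(p,q)\<in>pair_polys G k D. sgn (poly p y) = sgn (poly q y'))"

lemma finite_pair_cl: "finite G \<Longrightarrow> finite (pair_cl G k)"
  by (induction k) auto

lemma pair_cl_mono: "k \<le> l \<Longrightarrow> pair_cl G k \<subseteq> pair_cl G l"
  by (induction rule: dec_induct) auto

lemma gen_in_pair_cl: "g \<in> G \<Longrightarrow> g \<in> pair_cl G k"
  using pair_cl_mono[of 0 k G] by auto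

lemma consts_in_pair_cl: "(0,0) \<in> pair_cl G k" "(1,1) \<in> pair_cl G k" "(-1,-1) \<in> pair_cl G k"
  using pair_cl_mono[of 0 k G] by auto

lemma pair_cl_add: "(a,b) \<in> pair_cl G k \<Longrightarrow> (c,d) \<in> pair_cl G k \<Longrightarrow> (a + c, b + d) \<in> pair_cl G (Suc k)"
  by force

lemma pair_cl_mult: "(a,b) \<in> pair_cl G k \<Longrightarrow> (c,d) \<in> pair_cl G k \<Longrightarrow> (a * c, b * d) \<in> pair_cl G (Suc k)"
  by force

declare pair_cl.simps [simp del]

lemma pair_cl_uminus: "(a,b) \<in> pair_cl G k \<Longrightarrow> (-a, -b) \<in> pair_cl G (Suc k)"
  using pair_cl_mult[of a b G k "-1" "-1"] consts_in_pair_cl(3) by simp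

lemma pair_cl_diff_mult:
  assumes "(a,b) \<in> pair_cl G k" "(c,d) \<in> pair_cl G k" "(e,f) \<in> pair_cl G k" "(g,h) \<in> pair_cl G k"
  shows "(a * c - e * g, b * d - f * h) \<in> pair_cl G (k + 3)"
proof -
  have "(a * c, b * d) \<in> pair_cl G (Suc (Suc k))" "(- (e * g), - (f * h)) \<in> pair_cl G (Suc (Suc k))"
    using pair_cl_mult[OF assms(1,2)] pair_cl_uminus[OF pair_cl_mult[OF assms(3,4)]] pair_cl_mono[of "Suc k" "Suc (Suc k)" G]
    by auto
  from pair_cl_add[OF this] show ?thesis by (simp add: numeral_3_eq_3)
qed

lemma pair_cl_sum:
  assumes "finite I" "\<And>i. i \<in> I \<Longrightarrow> (f i, g i) \<in> pair_cl G k"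
  shows "(sum f I, sum g I) \<in> pair_cl G (k + card I)"
  using assms
proof (induction I rule: finite_induct)
  case empty
  then show ?case by (simp add: consts_in_pair_cl)
next
  case (insert x F)
  have "(f x, g x) \<in> pair_cl G (k + card F)" "(sum f F, sum g F) \<in> pair_cl G (k + card F)"
    using insert pair_cl_mono[of k "k + card F" G] by auto
  from pair_cl_add[OF this] insert show ?case by simp
qed

lemma pair_cl_prod:
  assumes "finite I" "\<And>i. i \<in> I \<Longrightarrow> (f i, g i) \<in> pair_cl G k"
  shows "(prod f I, prod g I) \<in> pair_cl G (k + card I)"
  using assms
proof (induction I rule: finite_induct)
  case empty
  then show ?case by (simp add: consts_in_pair_cl)
next
  case (insert x F)
  have "(f x, g x) \<in> pair_cl G (k + card F)" "(prod f F, prod g F) \<in> pair_cl G (k + card F)"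
    using insert pair_cl_mono[of k "k + card F" G] by auto
  from pair_cl_mult[OF this] insert show ?case by simp
qed

lemma pair_cl_of_nat_mult:
  assumes "(a,b) \<in> pair_cl G k"
  shows "(of_nat n * a, of_nat n * b) \<in> pair_cl G (k + n)"
  using pair_cl_sum[of "{..<n}" "\<lambda>_. a" "\<lambda>_. b" G k] assms by simp

text \<open>Interchanging the two sides turns a statement about answering y by y' into the converse
  one, so only one direction has to be proved.\<close>

lemma pair_cl_swap: "pair_cl (prod.swap ` G) k = prod.swap ` pair_cl G k"
proof (induction k)
  case (Suc k)
  have *: "prod.swap ` ((\<lambda>((a,b),(c,d)). (h a c, h b d)) ` (A \<times> A))
     = (\<lambda>((a,b),(c,d)). (h a c, h b d)) ` (prod.swap ` A \<times> prod.swap ` A)"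
    for A and h :: "real \<Rightarrow> real \<Rightarrow> real"
  proof -
    have "prod.swap ` A \<times> prod.swap ` A = map_prod prod.swap prod.swap ` (A \<times> A)"
      by (force simp: image_iff)
    then show ?thesis by (simp add: image_image) (rule image_cong, auto)
  qed
  show ?case using Suc *[of "(+)" "pair_cl G k"] *[of "(*)" "pair_cl G k"] by (simp add: pair_cl.simps image_Un)
qed (auto simp: pair_cl.simps)

lemma sgn_ok_swap: "sgn_ok (prod.swap ` G) k \<longleftrightarrow> sgn_ok G k"
  unfolding sgn_ok_def pair_cl_swap by auto

lemma sgn_ok_mono: "sgn_ok G l \<Longrightarrow> k \<le> l \<Longrightarrow> sgn_ok G k"
  unfolding sgn_ok_def using pair_cl_mono by blast

lemma pair_polys_swap: "pair_polys (prod.swap ` G) k D = prod.swap ` pair_polys G k D"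
  unfolding pair_polys_def pair_cl_swap by (force simp: image_iff)

lemma sgn_match_swap: "sgn_match (prod.swap ` G) k D y y' \<longleftrightarrow> sgn_match G k D y' y"
  unfolding sgn_match_def pair_polys_swap by (auto simp: eq_commute)

lemma pair_polys_mono: "k \<le> l \<Longrightarrow> D \<le> E \<Longrightarrow> pair_polys G k D \<subseteq> pair_polys G l E"
  unfolding pair_polys_def using pair_cl_mono[of k l G] by auto

lemma sgn_match_mono: "sgn_match G l E y y' \<Longrightarrow> k \<le> l \<Longrightarrow> D \<le> E \<Longrightarrow> sgn_match G k D y y'"
  unfolding sgn_match_def using pair_polys_mono[of k l D E G] by blast

lemma sgn_matchD: "sgn_match G k D y y' \<Longrightarrow> (p,q) \<in> pair_polys G k D \<Longrightarrow> sgn (poly p y) = sgn (poly q y')"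
  unfolding sgn_match_def by blast

text \<open>Finiteness yields finitely many roots to sort, and one bound beyond which all leading
  terms dominate.\<close>

lemma finite_pair_polys:
  assumes "finite G" shows "finite (pair_polys G k D)"
proof -
  let ?C = "pair_cl G k"
  let ?L = "{xs. set xs \<subseteq> ?C \<and> length xs = Suc D}"
  have "pair_polys G k D \<subseteq> (\<lambda>xs. (Poly (map fst xs), Poly (map snd xs))) ` ?L"
  proof
    fix pq assume "pq \<in> pair_polys G k D"
    then obtain p q where pq: "pq = (p,q)" "degree p \<le> D" "degree q \<le> D"
      "\<And>i. (coeff p i, coeff q i) \<in> ?C"
      unfolding pair_polys_def by auto
    let ?xs = "map (\<lambda>i. (coeff p i, coeff q i)) [0..<Suc D]"
    have "Poly (map fst ?xs) = p" "Poly (map snd ?xs) = q"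
      using pq by (auto intro!: poly_eqI simp: nth_default_def coeff_eq_0 simp del: upt_Suc)
    moreover have "?xs \<in> ?L" using pq by (auto simp del: upt_Suc)
    ultimately show "pq \<in> (\<lambda>xs. (Poly (map fst xs), Poly (map snd xs))) ` ?L"
      using pq(1) by (metis (no_types, lifting) image_eqI)
  qed
  moreover have "finite ?L" using finite_lists_length_eq[OF finite_pair_cl[OF assms]] by simp
  ultimately show ?thesis by (meson finite_imageI finite_subset)
qed

text \<open>Equal signs of the coefficients mean equal supports, hence equal degrees.\<close>

lemma pair_polys_lead:
  assumes "sgn_ok G k" "(p,q) \<in> pair_polys G k D"
  shows "degree p = degree q" "sgn (coeff p i) = sgn (coeff q i)" "p = 0 \<longleftrightarrow> q = 0"
proof -
  show s: "sgn (coeff p i) = sgn (coeff q i)" for i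
    using assms unfolding sgn_ok_def pair_polys_def by auto
  then have c: "coeff p i = 0 \<longleftrightarrow> coeff q i = 0" for i by (metis sgn_0_0)
  show "p = 0 \<longleftrightarrow> q = 0" using c by (metis coeff_0 poly_eq_iff)
  show "degree p = degree q"
  proof (rule antisym)
    show "degree p \<le> degree q" by (rule degree_le) (use c coeff_eq_0 in blast)
    show "degree q \<le> degree p" by (rule degree_le) (use c coeff_eq_0 in blast)
  qed
qed

text \<open>The integer factor in a coefficient of the derivative is produced by repeated addition,
  at most D times.\<close>

lemma pair_polys_pderiv:
  assumes "(p,q) \<in> pair_polys G k D"
  shows "(pderiv p, pderiv q) \<in> pair_polys G (k + D) (D - 1)"
proof -
  have "(coeff (pderiv p) i, coeff (pderiv q) i) \<in> pair_cl G (k + D)" for i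
  proof (cases "i < D")
    case True
    have "(coeff p (Suc i), coeff q (Suc i)) \<in> pair_cl G k" using assms unfolding pair_polys_def by auto
    from pair_cl_of_nat_mult[OF this, of "Suc i"] have "(coeff (pderiv p) i, coeff (pderiv q) i) \<in> pair_cl G (k + Suc i)"
      by (simp add: coeff_pderiv)
    then show ?thesis using True pair_cl_mono[of "k + Suc i" "k + D" G] by auto
  next
    case False
    then have "coeff p (Suc i) = 0" "coeff q (Suc i) = 0" using assms unfolding pair_polys_def
      by (auto intro!: coeff_eq_0)
    then show ?thesis by (simp add: coeff_pderiv consts_in_pair_cl)
  qed
  moreover have "degree (pderiv p) \<le> D - 1" "degree (pderiv q) \<le> D - 1"
    using assms unfolding pair_polys_def by (auto simp: degree_pderiv)
  ultimately show ?thesis unfolding pair_polys_def by auto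
qed

text \<open>Each derivative costs at most D levels and at most D of them matter; all later ones
  vanish, so one level serves every j.\<close>

lemma pair_polys_pderiv_iter:
  assumes "(p,q) \<in> pair_polys G k D" "l \<ge> k + D * D"
  shows "((pderiv ^^ j) p, (pderiv ^^ j) q) \<in> pair_polys G l (D - j)"
proof -
  have step: "((pderiv ^^ j) p, (pderiv ^^ j) q) \<in> pair_polys G (k + j * D) (D - j)" for j
  proof (induction j)
    case (Suc j)
    from pair_polys_pderiv[OF Suc] have "((pderiv ^^ Suc j) p, (pderiv ^^ Suc j) q)
       \<in> pair_polys G (k + j * D + (D - j)) (D - j - 1)" by simp
    moreover have "k + j * D + (D - j) \<le> k + Suc j * D" by simp
    ultimately show ?case using pair_polys_mono[OF \<open>k + j * D + (D - j) \<le> k + Suc j * D\<close>, of "D - j - 1" "D - Suc j" G]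
      by auto
  qed (use assms in simp)
  show ?thesis
  proof (cases "j \<le> D")
    case True
    then have "j * D \<le> D * D" by simp
    then have "k + j * D \<le> l" using assms(2) by linarith
    from pair_polys_mono[OF this, of "D - j" "D - j" G] step[of j] show ?thesis by auto
  next
    case False
    have "degree ((pderiv ^^ D) r) = 0" if "degree r \<le> D" for r :: "real poly"
    proof -
      have "degree ((pderiv ^^ i) r) \<le> D - i" for i
        by (induction i) (use that in \<open>auto simp: degree_pderiv\<close>)
      from this[of D] show ?thesis by simp
    qed
    then have z: "(pderiv ^^ Suc D) r = 0" if "degree r \<le> D" for r :: "real poly"
      using that by (simp add: pderiv_eq_0_iff)
    have "(pderiv ^^ j) r = 0" if "degree r \<le> D" for r :: "real poly"
    proof -
      have "(pderiv ^^ (i + Suc D)) r = 0" for i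
        by (induction i) (use z[OF that] in auto)
      from this[of "j - Suc D"] False show ?thesis by (simp del: funpow.simps)
    qed
    then have "(pderiv ^^ j) p = 0" "(pderiv ^^ j) q = 0" using assms unfolding pair_polys_def by auto
    then show ?thesis unfolding pair_polys_def by (simp add: consts_in_pair_cl)
  qed
qed

lemma sgn_match_pderiv_iter:
  assumes "sgn_match G l D y y'" "(p,q) \<in> pair_polys G k D" "l \<ge> k + D * D"
  shows "sgn (poly ((pderiv ^^ j) p) y) = sgn (poly ((pderiv ^^ j) q) y')"
  using pair_polys_pderiv_iter[OF assms(2,3), of j] assms(1) pair_polys_mono[of l l "D - j" D G]
  by (auto intro: sgn_matchD)

section \<open>Thom's lemma\<close>

lemma sgn_le_mono: "(x::real) \<le> y \<Longrightarrow> sgn x \<le> sgn y"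
  by (auto simp: sgn_real_def)

text \<open>Thom's lemma. By induction on the degree the derivative has constant sign on the
  interval, so p is monotone there and squeezed between end values of equal sign; this covers the
  sign 0 too.\<close>

lemma thom_sgn_const:
  fixes p :: "real poly"
  assumes "\<And>j. sgn (poly ((pderiv ^^ j) p) a) = sgn (poly ((pderiv ^^ j) p) b)" "a \<le> x" "x \<le> b"
  shows "sgn (poly p x) = sgn (poly p a)"
  using assms
proof (induction "degree p" arbitrary: p x rule: less_induct)
  case less
  show ?case
  proof (cases "degree p = 0")
    case True
    then obtain c where "p = [:c:]" by (rule degree_eq_zeroE)
    then show ?thesis by simp
  next
    case False
    then have d: "degree (pderiv p) < degree p" by (simp add: degree_pderiv)
    have "sgn (poly ((pderiv ^^ j) (pderiv p)) a) = sgn (poly ((pderiv ^^ j) (pderiv p)) b)" for j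
      using less.prems(1)[of "Suc j"] by (simp add: funpow_Suc_right del: funpow.simps)
    from less.hyps[OF d this] have c: "sgn (poly (pderiv p) z) = sgn (poly (pderiv p) a)"
      if "a \<le> z" "z \<le> b" for z using that by blast
    have e: "sgn (poly p a) = sgn (poly p b)" using less.prems(1)[of 0] by simp
    consider "poly (pderiv p) a \<ge> 0" | "poly (pderiv p) a \<le> 0" by linarith
    then show ?thesis
    proof cases
      case 1
      then have pos: "poly (pderiv p) z \<ge> 0" if "a \<le> z" "z \<le> b" for z
        using c[OF that] by (metis sgn_less linorder_not_le)
      have "poly p u \<le> poly p v" if "a \<le> u" "u \<le> v" "v \<le> b" for u v
        by (rule DERIV_nonneg_imp_nondecreasing[OF that(2)])
           (use that pos poly_DERIV in \<open>meson order_trans\<close>)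
      then have "poly p a \<le> poly p x" "poly p x \<le> poly p b" using less.prems by auto
      then show ?thesis using e sgn_le_mono[of "poly p a" "poly p x"] sgn_le_mono[of "poly p x" "poly p b"]
        sgn_le_mono[of "poly p x" "poly p a"] sgn_le_mono[of "poly p b" "poly p x"] by linarith
    next
      case 2
      then have neg: "poly (pderiv p) z \<le> 0" if "a \<le> z" "z \<le> b" for z
        using c[OF that] by (metis sgn_greater linorder_not_le)
      have "poly p v \<le> poly p u" if "a \<le> u" "u \<le> v" "v \<le> b" for u v
        by (rule DERIV_nonpos_imp_nonincreasing[OF that(2)])
           (use that neg poly_DERIV in \<open>meson order_trans\<close>)
      then have "poly p x \<le> poly p a" "poly p b \<le> poly p x" using less.prems by auto
      then show ?thesis using e sgn_le_mono[of "poly p a" "poly p x"] sgn_le_mono[of "poly p x" "poly p b"]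
        sgn_le_mono[of "poly p x" "poly p a"] sgn_le_mono[of "poly p b" "poly p x"] by linarith
    qed
  qed
qed

text \<open>By Thom's lemma the signs of all derivatives of q determine the position of a point relative to a root of q, so a match of signs
  preserves this order.\<close>

lemma pderiv_signs_order:
  fixes q q' :: "real poly"
  assumes m1: "\<And>j. sgn (poly ((pderiv ^^ j) q) y1) = sgn (poly ((pderiv ^^ j) q') z1)"
    and m2: "\<And>j. sgn (poly ((pderiv ^^ j) q) y2) = sgn (poly ((pderiv ^^ j) q') z2)"
    and "y1 < y2" and "q \<noteq> 0" and "poly q y1 = 0 \<or> poly q y2 = 0"
  shows "z1 < z2"
proof -
  let ?d = "\<lambda>j. (pderiv ^^ j) q"
  let ?J = "{j. sgn (poly (?d j) y1) \<noteq> sgn (poly (?d j) y2)}"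
  have ne: "?J \<noteq> {}"
  proof
    assume "?J = {}"
    then have all: "sgn (poly (?d j) y1) = sgn (poly (?d j) y2)" for j by blast
    have "sgn (poly q x) = 0" if "y1 \<le> x" "x \<le> y2" for x
      using thom_sgn_const[OF all that] all[of 0] assms(5) by auto
    then have "{y1..y2} \<subseteq> {x. poly q x = 0}" by (auto simp: sgn_0_0)
    moreover have "infinite {y1..y2}" using \<open>y1 < y2\<close> by (simp add: infinite_Icc)
    ultimately show False using poly_roots_finite[OF \<open>q \<noteq> 0\<close>] finite_subset by blast
  qed
  have dz: "?d j = 0" if "j > degree q" for j
  proof -
    have "degree (?d i) \<le> degree q - i" for i by (induction i) (auto simp: degree_pderiv)
    from this[of "degree q"] have "?d (Suc (degree q)) = 0" by (simp add: pderiv_eq_0_iff)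
    then have "?d (i + Suc (degree q)) = 0" for i by (induction i) auto
    from this[of "j - Suc (degree q)"] that show ?thesis by (simp del: funpow.simps)
  qed
  have "?J \<subseteq> {..degree q}" using dz by (auto simp: not_less[symmetric])
  then have fin: "finite ?J" using finite_subset by blast
  \<comment> \<open>Take the highest derivative whose signs at y1 and y2 differ; all higher ones
    agree. By Thom's lemma the next derivative has constant sign s both between y1 and y2 and, were
    the order reversed, between z2 and z1.\<close>
  define j where "j = Max ?J"
  have j: "sgn (poly (?d j) y1) \<noteq> sgn (poly (?d j) y2)" using Max_in[OF fin ne] unfolding j_def by blast
  have hi: "sgn (poly (?d i) y1) = sgn (poly (?d i) y2)" if "i > j" for i
    using Max_ge[OF fin, of i] that unfolding j_def by (meson mem_Collect_eq not_le)
  define r r' where "r = ?d j" and "r' = (pderiv ^^ j) q'"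
  have it: "(pderiv ^^ i) (pderiv r) = ?d (i + Suc j)" "(pderiv ^^ i) (pderiv r') = (pderiv ^^ (i + Suc j)) q'" for i
    unfolding r_def r'_def by (simp_all add: funpow_add funpow_swap1)
  have rr: "sgn (poly ((pderiv ^^ i) (pderiv r)) y1) = sgn (poly ((pderiv ^^ i) (pderiv r)) y2)" for i
    unfolding it by (rule hi) simp
  have rr': "sgn (poly ((pderiv ^^ i) (pderiv r')) z2) = sgn (poly ((pderiv ^^ i) (pderiv r')) z1)" for i
    unfolding it m1[symmetric] m2[symmetric] by (rule hi[symmetric]) simp
  define s where "s = sgn (poly (pderiv r) y1)"
  have s': "sgn (poly (pderiv r') z2) = s"
    using rr'[of 0] m1[of "Suc j"] unfolding s_def r_def r'_def by simp
  obtain x where x: "y1 < x" "x < y2" "poly r y2 - poly r y1 = (y2 - y1) * poly (pderiv r) x"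
    using poly_MVT[OF \<open>y1 < y2\<close>] by blast
  have sx: "sgn (poly (pderiv r) x) = s" unfolding s_def using thom_sgn_const[OF rr, of x] x by simp
  have ne': "sgn (poly r y1) \<noteq> sgn (poly r y2)" using j unfolding r_def .
  have d1: "sgn (poly r y2 - poly r y1) = s" unfolding x(3) using sx \<open>y1 < y2\<close> by (simp add: sgn_mult)
  have e1: "sgn (poly r y1) = sgn (poly r' z1)" "sgn (poly r y2) = sgn (poly r' z2)"
    unfolding r_def r'_def using m1 m2 by auto
  show ?thesis
  proof (rule ccontr)
    assume "\<not> z1 < z2"
    then have "z2 < z1" using ne' e1 by (metis linorder_neqE)
    then obtain w where w: "z2 < w" "w < z1" "poly r' z1 - poly r' z2 = (z1 - z2) * poly (pderiv r') w"
      using poly_MVT by blast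
    have sw: "sgn (poly (pderiv r') w) = s" using thom_sgn_const[OF rr', of w] w s' by simp
    have d2: "sgn (poly r' z1 - poly r' z2) = s" unfolding w(3) using sw \<open>z2 < z1\<close> by (simp add: sgn_mult)
    \<comment> \<open>The value of r changes with sign s from y1 to y2, while r' changes with the
      same sign s from z2 to z1. As the signs at y1, z1 and at y2, z2 agree but those at y1 and y2
      differ, the two changes are incompatible.\<close>
    consider "s = 1" | "s = -1" | "s = 0" unfolding s_def
      by (metis linorder_neqE_linordered_idom sgn_0_0 sgn_neg sgn_pos)
    then show False
    proof cases
      case 1
      then have "poly r y1 \<le> poly r y2" "poly r' z2 \<le> poly r' z1" using d1 d2 by (auto simp: sgn_1_pos)
      then have "sgn (poly r y1) = sgn (poly r y2)"
        using sgn_le_mono[of "poly r y1" "poly r y2"] sgn_le_mono[of "poly r y2" "poly r y1"]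
          sgn_le_mono[of "poly r' z1" "poly r' z2"] sgn_le_mono[of "poly r' z2" "poly r' z1"] e1 by linarith
      then show False using ne' by simp
    next
      case 2
      then have "poly r y2 \<le> poly r y1" "poly r' z1 \<le> poly r' z2" using d1 d2 by (auto simp: sgn_1_neg)
      then have "sgn (poly r y1) = sgn (poly r y2)"
        using sgn_le_mono[of "poly r y1" "poly r y2"] sgn_le_mono[of "poly r y2" "poly r y1"]
          sgn_le_mono[of "poly r' z1" "poly r' z2"] sgn_le_mono[of "poly r' z2" "poly r' z1"] e1 by linarith
      then show False using ne' by simp
    next
      case 3
      then show False using d1 ne' by (simp add: sgn_0_0)
    qed
  qed
qed

section \<open>Pseudo-division\<close>

lemma pair_polys_elim:
  assumes "(p,p') \<in> pair_polys G k (Suc (e + j))" "(q,q') \<in> pair_polys G k e" "i = Suc (e + j) - e" 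
  shows "(smult (coeff q e) p - monom (coeff p (Suc (e + j))) i * q,
          smult (coeff q' e) p' - monom (coeff p' (Suc (e + j))) i * q') \<in> pair_polys G (k + 3) (e + j)"
    (is "(?r, ?r') \<in> _")
proof -
  have i: "i = Suc j" using assms by simp
  have c: "coeff (smult a u - monom b (Suc j) * v) n = a * coeff u n - b * (if n < Suc j then 0 else coeff v (n - Suc j))"
    for a b n and u v :: "real poly" by (simp add: coeff_monom_mult not_less)
  have "(coeff ?r n, coeff ?r' n) \<in> pair_cl G (k + 3)" for n
    unfolding i c
  proof (rule pair_cl_diff_mult)
    show "((if n < Suc j then 0 else coeff q (n - Suc j)), (if n < Suc j then 0 else coeff q' (n - Suc j))) \<in> pair_cl G k"
      using assms(2) unfolding pair_polys_def by (auto simp: consts_in_pair_cl)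
  qed (use assms in \<open>auto simp: pair_polys_def\<close>)
  moreover have "degree (smult (coeff v e) u - monom (coeff u (Suc (e+j))) i * v) \<le> e + j"
    if "degree u \<le> Suc (e + j)" "degree v \<le> e" for u v :: "real poly"
  proof (rule degree_le, intro allI impI)
    fix n assume n: "e + j < n"
    show "coeff (smult (coeff v e) u - monom (coeff u (Suc (e+j))) i * v) n = 0"
    proof (cases "n = Suc (e + j)")
      case True
      then show ?thesis unfolding i c by simp
    next
      case False
      then have "coeff u n = 0" "coeff v (n - Suc j) = 0" using n that by (auto intro!: coeff_eq_0)
      then show ?thesis unfolding i c by simp
    qed
  qed
  ultimately show ?thesis using assms unfolding pair_polys_def by auto
qed

text \<open>The elimination step for equal degree bounds, where no power of the variable is needed.
  It also reduces the comparison of two polynomials of top degree, at a root of one of them, to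
  degree D.\<close>

lemma pair_polys_elim_top:
  assumes "(p,p') \<in> pair_polys G k (Suc D)" "(q,q') \<in> pair_polys G k (Suc D)"
  shows "(smult (coeff q (Suc D)) p - smult (coeff p (Suc D)) q,
          smult (coeff q' (Suc D)) p' - smult (coeff p' (Suc D)) q') \<in> pair_polys G (k + 3) D"
    (is "(?r, ?r') \<in> _")
proof -
  have "(coeff ?r n, coeff ?r' n) \<in> pair_cl G (k + 3)" for n
    unfolding coeff_diff coeff_smult
    by (rule pair_cl_diff_mult) (use assms in \<open>auto simp: pair_polys_def\<close>)
  moreover have "degree (smult (coeff v (Suc D)) u - smult (coeff u (Suc D)) v) \<le> D"
    if "degree u \<le> Suc D" "degree v \<le> Suc D" for u v :: "real poly"
  proof (rule degree_le, intro allI impI)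
    fix n assume n: "D < n"
    show "coeff (smult (coeff v (Suc D)) u - smult (coeff u (Suc D)) v) n = 0"
    proof (cases "n = Suc D")
      case False
      then have "coeff u n = 0" "coeff v n = 0" using n that by (auto intro!: coeff_eq_0)
      then show ?thesis by simp
    qed simp
  qed
  ultimately show ?thesis using assms unfolding pair_polys_def by auto
qed

text \<open>Pseudo-division by q: at a root of q each elimination step multiplies p by the leading coefficient of q.\<close>

lemma rem_match:
  assumes "(p,p') \<in> pair_polys G k (e + j)" "(q,q') \<in> pair_polys G k (Suc e)" "coeff q (Suc e) \<noteq> 0"
    "sgn (coeff q (Suc e)) = sgn (coeff q' (Suc e))"
    "poly q y = 0" "poly q' y' = 0" "sgn_match G (k + 3 * j) e y y'"
  shows "sgn (poly p y) = sgn (poly p' y')"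
  using assms
proof (induction j arbitrary: k p p')
  case 0
  then show ?case by (auto intro: sgn_matchD)
next
  case (Suc j)
  have c0: "coeff q' (Suc e) \<noteq> 0" using Suc.prems(3,4) by (metis sgn_0_0)
  show ?case
  proof (cases j)
    case 0
    let ?r = "smult (coeff q (Suc e)) p - smult (coeff p (Suc e)) q"
    let ?r' = "smult (coeff q' (Suc e)) p' - smult (coeff p' (Suc e)) q'"
    have "(?r, ?r') \<in> pair_polys G (k + 3) e"
      using pair_polys_elim_top[of p p' G k e q q'] Suc.prems(1,2) 0 by simp
    then have "sgn (poly ?r y) = sgn (poly ?r' y')" using Suc.prems(7) 0 by (intro sgn_matchD[of G "k + 3" e]) auto
    then show ?thesis using Suc.prems c0 by (simp add: sgn_mult sgn_0_0)
  next
    case (Suc i)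
    let ?r = "smult (coeff q (Suc e)) p - monom (coeff p (Suc (Suc e + i))) (Suc i) * q"
    let ?r' = "smult (coeff q' (Suc e)) p' - monom (coeff p' (Suc (Suc e + i))) (Suc i) * q'"
    have "(?r, ?r') \<in> pair_polys G (k + 3) (Suc e + i)"
      by (rule pair_polys_elim) (use Suc.prems Suc in auto)
    then have r: "(?r, ?r') \<in> pair_polys G (k + 3) (e + j)" using Suc by simp
    have "sgn (poly ?r y) = sgn (poly ?r' y')"
      by (rule Suc.IH[OF r _ Suc.prems(3-6)])
         (use Suc.prems(2,7) pair_polys_mono[of k "k + 3" "Suc e" "Suc e" G] in \<open>auto simp: algebra_simps\<close>)
    then show ?thesis using Suc.prems c0 by (simp add: sgn_mult sgn_0_0 poly_monom)
  qed
qed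

section \<open>Signs between roots and near infinity\<close>

lemma sgn_eq_if_no_root_aux:
  fixes p :: "real poly"
  assumes "\<And>x. a \<le> x \<Longrightarrow> x \<le> b \<Longrightarrow> poly p x \<noteq> 0" "a \<le> b"
  shows "sgn (poly p a) = sgn (poly p b)"
proof (rule ccontr)
  assume ne: "sgn (poly p a) \<noteq> sgn (poly p b)"
  have "poly p a \<noteq> 0" "poly p b \<noteq> 0" "a < b" using assms ne by (auto simp: less_le)
  then have "poly p a * poly p b < 0" using ne
    by (metis linorder_neqE_linordered_idom mult_neg_pos mult_pos_neg sgn_neg sgn_pos)
  then obtain x where "a < x" "x < b" "poly p x = 0" using poly_IVT[OF \<open>a < b\<close>] by blast
  then show False using assms(1)[of x] by simp
qed

lemma sgn_eq_if_no_root: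
  fixes p :: "real poly"
  assumes "\<And>x. min a b \<le> x \<Longrightarrow> x \<le> max a b \<Longrightarrow> poly p x \<noteq> 0"
  shows "sgn (poly p a) = sgn (poly p b)"
proof (cases "a \<le> b")
  case True
  show ?thesis by (rule sgn_eq_if_no_root_aux) (use True in \<open>simp_all add: assms\<close>)
next
  case False
  have "sgn (poly p b) = sgn (poly p a)" by (rule sgn_eq_if_no_root_aux) (use False in \<open>simp_all add: assms\<close>)
  then show ?thesis by simp
qed

lemma sgn_poly_at_top:
  fixes p :: "real poly"
  assumes "p \<noteq> 0"
  shows "eventually (\<lambda>x. sgn (poly p x) = sgn (lead_coeff p)) at_top"
proof (cases "lead_coeff p > 0")
  case True
  then obtain n where n: "\<forall>x\<ge>n. poly p x \<ge> lead_coeff p" using poly_pinfty_gt_lc by blast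
  show ?thesis using eventually_ge_at_top[of n]
    by eventually_elim (use n True in \<open>force simp: sgn_real_def\<close>)
next
  case False
  then have neg: "lead_coeff p < 0" using assms by (metis leading_coeff_0_iff linorder_neqE)
  then obtain n where n: "\<forall>x\<ge>n. poly (-p) x \<ge> lead_coeff (-p)" using poly_pinfty_gt_lc[of "-p"] by auto
  show ?thesis using eventually_ge_at_top[of n]
    by eventually_elim (use n neg in \<open>force simp: sgn_real_def\<close>)
qed

lemma sgn_poly_at_bot:
  fixes p :: "real poly"
  assumes "p \<noteq> 0"
  shows "eventually (\<lambda>x. sgn (poly p (-x)) = sgn (lead_coeff p) * (-1) ^ degree p) at_top"
proof -
  let ?q = "pcompose p [:0, -1:]"
  have "lead_coeff ?q = lead_coeff p * (-1) ^ degree p" by (subst lead_coeff_comp) auto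
  moreover have "?q \<noteq> 0" using assms pcompose_eq_0 by fastforce
  ultimately show ?thesis using sgn_poly_at_top[of ?q]
    by (simp add: poly_pcompose sgn_mult power_sgn[symmetric])
qed

text \<open>Far out the leading term decides, and degrees and signs of leading coefficients agree on
  both sides; so a large y is answered by itself. The points -M and M later serve as outer
  boundaries of the cells between roots.\<close>

lemma sgn_match_ends:
  assumes "finite G" "sgn_ok G k"
  obtains M where "M > 0" "\<And>y. \<bar>y\<bar> \<ge> M \<Longrightarrow> sgn_match G k D y y"
    "\<And>y p q. \<bar>y\<bar> \<ge> M \<Longrightarrow> (p,q) \<in> pair_polys G k D \<Longrightarrow> p \<noteq> 0 \<Longrightarrow> poly p y \<noteq> 0 \<and> poly q y \<noteq> 0"
proof -
  define P where "P x pq \<longleftrightarrow> (case pq of (p,q) \<Rightarrow> sgn (poly p x) = sgn (poly q x) \<and>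
     sgn (poly p (-x)) = sgn (poly q (-x)) \<and>
     (p \<noteq> 0 \<longrightarrow> poly p x \<noteq> 0 \<and> poly q x \<noteq> 0 \<and> poly p (-x) \<noteq> 0 \<and> poly q (-x) \<noteq> 0))"
    for x :: real and pq :: "real poly \<times> real poly"
  have "eventually (\<lambda>x. P x (p,q)) at_top" if "(p,q) \<in> pair_polys G k D" for p q
  proof (cases "p = 0")
    case True
    then have "q = 0" using pair_polys_lead(3)[OF assms(2) that] by simp
    then show ?thesis using True by (simp add: P_def)
  next
    case False
    then have q: "q \<noteq> 0" using pair_polys_lead(3)[OF assms(2) that] by simp
    have deg: "degree p = degree q" and lc: "sgn (lead_coeff p) = sgn (lead_coeff q)"
      using pair_polys_lead(1,2)[OF assms(2) that] by auto
    have nz: "sgn (lead_coeff p) \<noteq> 0" "sgn (lead_coeff q) \<noteq> 0" using False q by (auto simp: sgn_0_0)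
    show ?thesis using sgn_poly_at_top[OF False] sgn_poly_at_top[OF q] sgn_poly_at_bot[OF False] sgn_poly_at_bot[OF q]
    proof eventually_elim
      case (elim x)
      have "sgn (poly p x) \<noteq> 0" "sgn (poly q x) \<noteq> 0" "sgn (poly p (-x)) \<noteq> 0" "sgn (poly q (-x)) \<noteq> 0"
        using elim nz by auto
      then show ?case using elim deg lc unfolding P_def by (auto simp: sgn_0_0)
    qed
  qed
  then have "eventually (\<lambda>x. \<forall>pq\<in>pair_polys G k D. P x pq) at_top"
    by (intro eventually_ball_finite finite_pair_polys assms) auto
  then have "eventually (\<lambda>x. x > 0 \<and> (\<forall>pq\<in>pair_polys G k D. P x pq)) at_top"
    using eventually_gt_at_top[of 0] by eventually_elim auto
  then obtain M0 where M0: "\<And>x. x \<ge> M0 \<Longrightarrow> x > 0 \<and> (\<forall>pq\<in>pair_polys G k D. P x pq)"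
    unfolding eventually_at_top_linorder by blast
  have P: "P \<bar>y\<bar> pq" if "\<bar>y\<bar> \<ge> M0" "pq \<in> pair_polys G k D" for y pq using M0 that by blast
  show thesis
  proof (rule that[of M0])
    show "M0 > 0" using M0 by blast
    show "sgn_match G k D y y" if "\<bar>y\<bar> \<ge> M0" for y
      using P[OF that] unfolding sgn_match_def P_def by (cases "y \<ge> 0") fastforce+
    show "poly p y \<noteq> 0 \<and> poly q y \<noteq> 0" if "\<bar>y\<bar> \<ge> M0" "(p,q) \<in> pair_polys G k D" "p \<noteq> 0" for y p q
      using P[OF that(1,2)] that(3) unfolding P_def by (cases "y \<ge> 0") fastforce+
  qed
qed

section \<open>Matching the roots\<close>

lemma sgn_match_root_iff:
  "sgn_match G k D y y' \<Longrightarrow> (p,q) \<in> pair_polys G k D \<Longrightarrow> poly p y = 0 \<longleftrightarrow> poly q y' = 0"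
  by (metis sgn_0_0 sgn_matchD)

lemma root_order:
  assumes ok: "sgn_ok G k" and q: "(q,q') \<in> pair_polys G k D" "q \<noteq> 0" "poly q z = 0 \<or> poly q x = 0"
    and z: "\<And>j. sgn (poly ((pderiv ^^ j) q) z) = sgn (poly ((pderiv ^^ j) q') z')"
    and x: "\<And>j. sgn (poly ((pderiv ^^ j) q) x) = sgn (poly ((pderiv ^^ j) q') x')"
  shows "z < x \<longleftrightarrow> z' < x'" "x < z \<longleftrightarrow> x' < z'"
proof -
  have q': "q' \<noteq> 0" using pair_polys_lead(3)[OF ok q(1)] q(2) by simp
  have r: "poly q' z' = 0 \<or> poly q' x' = 0" using q(3) z[of 0] x[of 0] by (auto simp: sgn_0_0)
  show "z < x \<longleftrightarrow> z' < x'"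
    using pderiv_signs_order[OF z x _ q(2,3)] pderiv_signs_order[OF z[symmetric] x[symmetric] _ q' r] by blast
  have q3: "poly q x = 0 \<or> poly q z = 0" and r3: "poly q' x' = 0 \<or> poly q' z' = 0" using q r by auto
  show "x < z \<longleftrightarrow> x' < z'"
    using pderiv_signs_order[OF x z _ q(2) q3] pderiv_signs_order[OF x[symmetric] z[symmetric] _ q' r3] by blast
qed

text \<open>At a root of q every polynomial of degree \<open>Suc D\<close> may be replaced by its
  pseudo-remainder modulo q, whose degree is below that of q, so matching in degree D is
  enough.\<close>

lemma root_match_low:
  assumes ok: "sgn_ok G k1" and q: "(q,q') \<in> pair_polys G k1 D" "q \<noteq> 0" "poly q y = 0"
    and m: "sgn_match G k' D y y'" and k': "k' \<ge> k1 + 3 * (D + 2)"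
  shows "sgn_match G k1 (Suc D) y y'"
  unfolding sgn_match_def
proof clarify
  fix p p' assume p: "(p,p') \<in> pair_polys G k1 (Suc D)"
  have "degree q \<noteq> 0" using q by (metis degree_eq_zeroE pCons_0_0 poly_pCons poly_0 mult_zero_right add.right_neutral)
  then obtain e where e: "degree q = Suc e" using not0_implies_Suc by blast
  then have eD: "Suc e \<le> D" using q unfolding pair_polys_def by auto
  have dq: "degree q' = Suc e" using pair_polys_lead(1)[OF ok q(1)] e by simp
  have q1: "(q,q') \<in> pair_polys G k1 (Suc e)" using q e dq unfolding pair_polys_def by auto
  have "(q,q') \<in> pair_polys G k' D" using q(1) pair_polys_mono[of k1 k' D D G] k' by auto
  then have q'0: "poly q' y' = 0" using sgn_match_root_iff[OF m] q(3) by blast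
  have p1: "(p,p') \<in> pair_polys G k1 (e + (Suc D - e))" using p eD by simp
  show "sgn (poly p y) = sgn (poly p' y')"
  proof (rule rem_match[OF p1 q1 _ _ q(3) q'0])
    show "coeff q (Suc e) \<noteq> 0" using e q(2) by (metis leading_coeff_0_iff)
    show "sgn (coeff q (Suc e)) = sgn (coeff q' (Suc e))" using pair_polys_lead(2)[OF ok q(1)] .
    \<comment> \<open>The degree bound falls from \<open>Suc D\<close> to e in
      \<open>Suc D - e\<close> steps of three levels each.\<close>
    show "sgn_match G (k1 + 3 * (Suc D - e)) e y y'"
      by (rule sgn_match_mono[OF m]) (use k' eD in auto)
  qed
qed

lemma finite_root_set:
  fixes A :: "(real poly \<times> real poly) set"
  assumes "finite A" shows "finite {z. \<exists>(q,q')\<in>A. q \<noteq> 0 \<and> poly q z = 0}"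
proof -
  have "{z. \<exists>(q,q')\<in>A. q \<noteq> 0 \<and> poly q z = 0} = (\<Union>(q,q')\<in>{(q,q')\<in>A. q \<noteq> 0}. {z. poly q z = 0})" by auto
  moreover have "finite {(q,q')\<in>A. q \<noteq> 0}" using assms by (rule finite_subset[rotated]) auto
  ultimately show ?thesis using poly_roots_finite by (auto intro!: finite_UN_I)
qed

text \<open>The sentinels -M and M stand in when y has no root on one side.\<close>

lemma neighbours:
  fixes R :: "real set"
  assumes "finite R" "\<bar>y\<bar> < M" "y \<notin> R"
  obtains u v where "u = -M \<or> u \<in> R" "u < y" "\<And>z. z \<in> R \<Longrightarrow> z < y \<Longrightarrow> z \<le> u"
    "v = M \<or> v \<in> R" "y < v" "\<And>z. z \<in> R \<Longrightarrow> y < z \<Longrightarrow> v \<le> z" "\<And>z. u < z \<Longrightarrow> z < v \<Longrightarrow> z \<notin> R"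
proof -
  define u where "u = Max {z \<in> insert (-M) R. z < y}"
  define v where "v = Min {z \<in> insert M R. z > y}"
  have fu: "finite {z \<in> insert (-M) R. z < y}" "{z \<in> insert (-M) R. z < y} \<noteq> {}"
    and fv: "finite {z \<in> insert M R. z > y}" "{z \<in> insert M R. z > y} \<noteq> {}"
    using assms by auto
  have u: "u = -M \<or> u \<in> R" "u < y" using Max_in[OF fu] unfolding u_def by auto
  have v: "v = M \<or> v \<in> R" "v > y" using Min_in[OF fv] unfolding v_def by auto
  have uR: "z \<le> u" if "z \<in> R" "z < y" for z using Max_ge[OF fu(1), of z] that unfolding u_def by auto
  have vR: "v \<le> z" if "z \<in> R" "y < z" for z using Min_le[OF fv(1), of z] that unfolding v_def by auto
  have "z \<notin> R" if "u < z" "z < v" for z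
    using uR[of z] vR[of z] assms(3) that by (metis linorder_neqE_linordered_idom linorder_not_le)
  from that[OF u uR v vR this] show thesis .
qed

text \<open>The case of a root y of a polynomial p of top degree.  Between neighbouring roots of the polynomials of lower degree p is strictly
  monotone, so its root is matched by the intermediate value theorem; any other s of top degree is compared with p through
  the combination of s and p in which the leading terms cancel.\<close>

lemma root_match_top:
  assumes fin: "finite G" and ok: "sgn_ok G k'"
    and IH1: "\<And>y. \<exists>y'. sgn_match G k' D y y'" and IH2: "\<And>y'. \<exists>y. sgn_match G k' D y y'"
    and k1: "k1 \<ge> k + Suc D + 3" and k': "k' \<ge> k1 + 3 * (D + 2) + D * D"
    and p: "(p,p') \<in> pair_polys G k (Suc D)" "p \<noteq> 0" "poly p y = 0"
    and nr: "\<And>q q'. (q,q') \<in> pair_polys G k1 D \<Longrightarrow> q \<noteq> 0 \<Longrightarrow> poly q y \<noteq> 0"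
  shows "\<exists>y'. sgn_match G k (Suc D) y y' \<and> sgn_match G k1 D y y'"
proof -
  have ok1: "sgn_ok G k1" "sgn_ok G k" using sgn_ok_mono[OF ok] k1 k' by auto
  obtain M where M: "M > 0" "\<And>y. \<bar>y\<bar> \<ge> M \<Longrightarrow> sgn_match G k' (Suc D) y y"
    "\<And>y p q. \<bar>y\<bar> \<ge> M \<Longrightarrow> (p,q) \<in> pair_polys G k' (Suc D) \<Longrightarrow> p \<noteq> 0 \<Longrightarrow> poly p y \<noteq> 0 \<and> poly q y \<noteq> 0"
    by (rule sgn_match_ends[OF fin ok, of "Suc D"]) (rule that; assumption)
  define R where "R = {z. \<exists>(q,q')\<in>pair_polys G k1 D. q \<noteq> 0 \<and> poly q z = 0}"
  have finR: "finite R" unfolding R_def by (rule finite_root_set[OF finite_pair_polys[OF fin]])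
  have sub1: "pair_polys G k1 D \<subseteq> pair_polys G k' (Suc D)" "pair_polys G k1 D \<subseteq> pair_polys G k' D" "pair_polys G k (Suc D) \<subseteq> pair_polys G k' (Suc D)"
    by (intro pair_polys_mono; use k1 k' in simp)+
  have RM: "\<bar>z\<bar> < M" if "z \<in> R" for z
  proof (rule ccontr)
    assume "\<not> \<bar>z\<bar> < M"
    then have "\<bar>z\<bar> \<ge> M" by simp
    then show False using that M(3)[of z] sub1 unfolding R_def by blast
  qed
  have order: "z < x \<longleftrightarrow> z' < x'" "x < z \<longleftrightarrow> x' < z'"
    if zR: "z \<in> R" and zz: "sgn_match G k' D z z'" and xx: "sgn_match G k' D x x'" for z z' x x'
  proof -
    obtain q q' where q: "(q,q') \<in> pair_polys G k1 D" "q \<noteq> 0" "poly q z = 0" using zR unfolding R_def by blast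
    have "k' \<ge> k1 + D * D" using k' by simp
    note * = sgn_match_pderiv_iter[OF zz q(1) this] sgn_match_pderiv_iter[OF xx q(1) this]
    show "z < x \<longleftrightarrow> z' < x'" "x < z \<longleftrightarrow> x' < z'"
      using root_order[OF ok1(1) q(1,2) _ *] q(3) by blast+
  qed
  have yM: "\<bar>y\<bar> < M" using M(3)[of y] p sub1 by (cases "\<bar>y\<bar> < M") auto
  have yR: "y \<notin> R" using nr unfolding R_def by blast
  obtain u v where u: "u = -M \<or> u \<in> R" "u < y" and uR: "\<And>z. z \<in> R \<Longrightarrow> z < y \<Longrightarrow> z \<le> u"
    and v: "v = M \<or> v \<in> R" "y < v" and vR: "\<And>z. z \<in> R \<Longrightarrow> y < z \<Longrightarrow> v \<le> z"
    and uvR: "\<And>z. u < z \<Longrightarrow> z < v \<Longrightarrow> z \<notin> R"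
    by (rule neighbours[OF finR yM yR]) (rule that; assumption)
  \<comment> \<open>Both ends of the cell of y receive answers valid even in degree
    \<open>Suc D\<close>: a root from R by pseudo-division, a sentinel by itself.\<close>
  have ex: "\<exists>z'. sgn_match G k' D z z' \<and> sgn_match G k1 (Suc D) z z' \<and> (z \<notin> R \<longrightarrow> z' = z)"
    if "z \<in> R \<or> \<bar>z\<bar> \<ge> M" for z
  proof (cases "z \<in> R")
    case True
    then obtain q q' where q: "(q,q') \<in> pair_polys G k1 D" "q \<noteq> 0" "poly q z = 0" unfolding R_def by blast
    obtain z' where z': "sgn_match G k' D z z'" using IH1 by blast
    with root_match_low[OF ok1(1) q z'] k' True show ?thesis by auto
  next
    case False
    then have "\<bar>z\<bar> \<ge> M" using that by blast
    from M(2)[OF this] show ?thesis using sgn_match_mono k' by (intro exI[of _ z]) auto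
  qed
  obtain u' where u': "sgn_match G k' D u u'" "sgn_match G k1 (Suc D) u u'" "u \<notin> R \<longrightarrow> u' = u"
    using ex[of u] u M(1) by auto
  obtain v' where v': "sgn_match G k' D v v'" "sgn_match G k1 (Suc D) v v'" "v \<notin> R \<longrightarrow> v' = v"
    using ex[of v] v M(1) by auto
  obtain y0 where y0: "sgn_match G k' D y y0" using IH1 by blast
  have uv': "u' < v'"
  proof (cases "u \<in> R \<or> v \<in> R")
    case True
    then show ?thesis using order[of u u' v v'] order[of v v' u u'] u v u'(1) v'(1) by auto
  next
    case False
    then show ?thesis using u u'(3) v v'(3) M(1) by auto
  qed
  \<comment> \<open>Every point of the matched cell answers y in degree D: a root t' of q' between
    y0 and x' would by \<open>IH2\<close> come from a root t of q, which lies at or beyond u or v;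
    by \<open>order\<close> t' then lies on the corresponding side of both y0 and x'.\<close>
  have cell: "sgn_match G k1 D y x'" if x': "u' < x'" "x' < v'" for x'
    unfolding sgn_match_def
  proof clarify
    fix q q' assume q: "(q,q') \<in> pair_polys G k1 D"
    show "sgn (poly q y) = sgn (poly q' x')"
    proof (cases "q = 0")
      case True
      then show ?thesis using pair_polys_lead(3)[OF ok1(1) q] by simp
    next
      case False
      have "poly q' t' \<noteq> 0" if t': "min y0 x' \<le> t'" "t' \<le> max y0 x'" for t'
      proof
        assume r: "poly q' t' = 0"
        obtain t where t: "sgn_match G k' D t t'" using IH2 by blast
        then have "poly q t = 0" using sgn_match_root_iff[OF t, of q q'] q sub1 r by blast
        then have tR: "t \<in> R" using q False unfolding R_def by blast
        then have "t \<noteq> y" using yR by blast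
        then consider "t < y" | "t > y" by linarith
        then show False
        proof cases
          case 1
          then have "t' < y0" using order[OF tR t y0] by simp
          moreover have "t' \<le> u'"
          proof -
            have "t \<le> u" using uR[OF tR 1] .
            then have "u \<in> R" using RM[OF tR] u by auto
            then show ?thesis using order[OF _ u'(1) t] \<open>t \<le> u\<close> by (meson linorder_not_le)
          qed
          ultimately show False using t' x' by auto
        next
          case 2
          then have "t' > y0" using order[OF tR t y0] by simp
          moreover have "t' \<ge> v'"
          proof -
            have "t \<ge> v" using vR[OF tR 2] .
            then have "v \<in> R" using RM[OF tR] v by auto
            then show ?thesis using order[OF _ v'(1) t] \<open>t \<ge> v\<close> by (meson linorder_not_le)
          qed
          ultimately show False using t' x' by auto
        qed
      qed
      then have "sgn (poly q' y0) = sgn (poly q' x')" by (rule sgn_eq_if_no_root)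
      moreover have "sgn (poly q y) = sgn (poly q' y0)" using sgn_matchD[OF y0] q sub1 by blast
      ultimately show ?thesis by simp
    qed
  qed
  \<comment> \<open>Otherwise p would have degree at most D, and y would be one of the roots
    excluded by \<open>nr\<close>.\<close>
  have pc: "coeff p (Suc D) \<noteq> 0"
  proof
    assume z: "coeff p (Suc D) = 0"
    have z': "coeff p' (Suc D) = 0" using pair_polys_lead(2)[OF ok1(2) p(1), of "Suc D"] z by (simp add: sgn_0_0)
    have d: "degree p \<le> D" "degree p' \<le> D"
      using p z z' unfolding pair_polys_def by (metis (no_types, lifting) case_prodD mem_Collect_eq le_Suc_eq
          leading_coeff_0_iff degree_0 le0)+
    then have "(p,p') \<in> pair_polys G k D" using p unfolding pair_polys_def by auto
    then have "(p,p') \<in> pair_polys G k1 D" using pair_polys_mono[of k k1 D D G] k1 by auto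
    then show False using nr p by blast
  qed
  have dp: "(pderiv p, pderiv p') \<in> pair_polys G k1 D"
    using pair_polys_pderiv[OF p(1)] pair_polys_mono[of "k + Suc D" k1 D D G] k1 by auto
  have dp0: "pderiv p \<noteq> 0"
  proof
    assume "pderiv p = 0"
    then have "degree p = 0" by (simp add: pderiv_eq_0_iff)
    then show False using pc by (simp add: coeff_eq_0)
  qed
  have dpn: "poly (pderiv p) z \<noteq> 0" if "u < z" "z < v" for z
    using uvR[OF that] dp dp0 unfolding R_def by blast
  obtain x1 where x1: "u < x1" "x1 < y" "poly p y - poly p u = (y - u) * poly (pderiv p) x1"
    using poly_MVT[OF u(2)] by blast
  obtain x2 where x2: "y < x2" "x2 < v" "poly p v - poly p y = (v - y) * poly (pderiv p) x2"
    using poly_MVT[OF v(2)] by blast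
  have "sgn (poly (pderiv p) x1) = sgn (poly (pderiv p) x2)"
    by (rule sgn_eq_if_no_root) (use dpn x1 x2 in auto)
  moreover have "poly (pderiv p) x1 \<noteq> 0" "poly (pderiv p) x2 \<noteq> 0" using dpn x1 x2 by auto
  moreover have "sgn (poly p u) = - sgn (poly (pderiv p) x1)"
  proof -
    have "poly p u = - ((y - u) * poly (pderiv p) x1)" using x1(3) p(3) by simp
    then show ?thesis using u(2) by (simp add: sgn_mult)
  qed
  moreover have "sgn (poly p v) = sgn (poly (pderiv p) x2)"
    using x2 p(3) by (simp add: sgn_mult)
  ultimately have sg: "sgn (poly p u) * sgn (poly p v) < 0"
    by (simp add: sgn_real_def split: if_splits)
  have "(p,p') \<in> pair_polys G k1 (Suc D)" using p pair_polys_mono[of k k1 "Suc D" "Suc D" G] k1 by auto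
  then have "sgn (poly p u) = sgn (poly p' u')" "sgn (poly p v) = sgn (poly p' v')"
    using sgn_matchD u'(2) v'(2) by blast+
  then have "poly p' u' * poly p' v' < 0" using sg by (metis sgn_mult sgn_less)
  then obtain y' where y': "u' < y'" "y' < v'" "poly p' y' = 0" using poly_IVT[OF uv'] by blast
  have c: "sgn_match G k1 D y y'" using cell y' by blast
  have "sgn_match G k (Suc D) y y'"
    unfolding sgn_match_def
  proof clarify
    fix s s' assume s: "(s,s') \<in> pair_polys G k (Suc D)"
    from pair_polys_elim_top[OF s p(1)] have "(smult (coeff p (Suc D)) s - smult (coeff s (Suc D)) p,
        smult (coeff p' (Suc D)) s' - smult (coeff s' (Suc D)) p') \<in> pair_polys G k1 D"
      using pair_polys_mono[of "k + 3" k1 D D G] k1 by auto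
    from sgn_matchD[OF c this] have "sgn (coeff p (Suc D)) * sgn (poly s y) = sgn (coeff p' (Suc D)) * sgn (poly s' y')"
      using p(3) y'(3) by (simp add: sgn_mult)
    moreover have "sgn (coeff p (Suc D)) = sgn (coeff p' (Suc D))" by (rule pair_polys_lead(2)[OF ok1(2) p(1)])
    moreover have "sgn (coeff p (Suc D)) \<noteq> 0" using pc by (simp add: sgn_0_0)
    ultimately show "sgn (poly s y) = sgn (poly s' y')" by simp
  qed
  then show ?thesis using c by blast
qed

subsection \<open>Elimination of one variable\<close>

text \<open>The levels are spent from the outside in. \<open>lvl2\<close> admits all derivatives of
  the polynomials of degree \<open>Suc D\<close> at level k; \<open>lvl1\<close> admits in addition
  the derivatives of those of degree D at \<open>lvl2\<close> and one elimination step of cost 3;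
  \<open>lvl0\<close> pays for a pseudo-division and once more for derivatives.\<close>

definition lvl2 :: "nat \<Rightarrow> nat \<Rightarrow> nat" where "lvl2 k D = k + Suc D * Suc D"
definition lvl1 :: "nat \<Rightarrow> nat \<Rightarrow> nat" where "lvl1 k D = lvl2 k D + D * D + 3"
definition lvl0 :: "nat \<Rightarrow> nat \<Rightarrow> nat" where "lvl0 k D = lvl1 k D + 3 * (D + 2) + D * D"

text \<open>A root of some polynomial of degree at most D is settled by pseudo-division; otherwise p
  has exact degree \<open>Suc D\<close>. The second conclusion controls the derivatives, which
  decide the order of roots in the next step.\<close>

lemma root_match:
  assumes fin: "finite G" and ok: "sgn_ok G (lvl0 k D)"
    and IH1: "\<And>y. \<exists>y'. sgn_match G (lvl0 k D) D y y'" and IH2: "\<And>y'. \<exists>y. sgn_match G (lvl0 k D) D y y'"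
    and p: "(p,p') \<in> pair_polys G k (Suc D) \<or> (p,p') \<in> pair_polys G (lvl2 k D) D" "p \<noteq> 0" "poly p y = 0"
  shows "\<exists>y'. sgn_match G k (Suc D) y y' \<and> sgn_match G (lvl1 k D) D y y'"
proof (cases "\<exists>q q'. (q,q') \<in> pair_polys G (lvl1 k D) D \<and> q \<noteq> 0 \<and> poly q y = 0")
  case True
  then obtain q q' where q: "(q,q') \<in> pair_polys G (lvl1 k D) D" "q \<noteq> 0" "poly q y = 0" by blast
  obtain y' where y': "sgn_match G (lvl0 k D) D y y'" using IH1 by blast
  have ok1: "sgn_ok G (lvl1 k D)" using sgn_ok_mono[OF ok] by (simp add: lvl0_def)
  have "sgn_match G (lvl1 k D) (Suc D) y y'"
    by (rule root_match_low[OF ok1 q y']) (simp add: lvl0_def)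
  then have "sgn_match G k (Suc D) y y'" "sgn_match G (lvl1 k D) D y y'"
    by (auto elim: sgn_match_mono simp: lvl1_def lvl2_def)
  then show ?thesis by blast
next
  case False
  have "pair_polys G (lvl2 k D) D \<subseteq> pair_polys G (lvl1 k D) D" by (rule pair_polys_mono) (auto simp: lvl1_def)
  then have "(p,p') \<in> pair_polys G k (Suc D)" using p False by blast
  with False show ?thesis
    by (intro root_match_top[OF fin ok IH1 IH2 _ _ _ p(2,3)]) (auto simp: lvl0_def lvl1_def lvl2_def)
qed

text \<open>The roots of all polynomials in question cut the line into cells. A root is answered by
  \<open>root_match\<close>, any other point by an arbitrary point of the cell between the answers
  to its neighbours.\<close>

lemma univariate_step:
  assumes fin: "finite G" and ok: "sgn_ok G (lvl0 k D)"
    and IH1: "\<And>y. \<exists>y'. sgn_match G (lvl0 k D) D y y'" and IH2: "\<And>y'. \<exists>y. sgn_match G (lvl0 k D) D y y'"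
  shows "\<exists>y'. sgn_match G k (Suc D) y y'"
proof -
  let ?k1 = "lvl1 k D" and ?k2 = "lvl2 k D"
  have ok1: "sgn_ok G ?k1" and okk: "sgn_ok G k" and ok2: "sgn_ok G ?k2"
    using sgn_ok_mono[OF ok] by (simp_all add: lvl0_def lvl1_def lvl2_def)
  define mt where "mt z z' \<longleftrightarrow> sgn_match G k (Suc D) z z' \<and> sgn_match G ?k1 D z z'" for z z'
  \<comment> \<open>The part of degree D is included so that R contains the roots of the derivatives
    of the polynomials of degree \<open>Suc D\<close>, which Rolle's theorem will need.\<close>
  define A where "A = pair_polys G k (Suc D) \<union> pair_polys G ?k2 D"
  have AM: "A \<subseteq> pair_polys G ?k1 (Suc D)"
    unfolding A_def using pair_polys_mono[of k ?k1 "Suc D" "Suc D" G] pair_polys_mono[of ?k2 ?k1 D "Suc D" G]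
    by (auto simp: lvl1_def lvl2_def)
  have finA: "finite A" unfolding A_def using finite_pair_polys[OF fin] by blast
  define R where "R = {z. \<exists>(q,q')\<in>A. q \<noteq> 0 \<and> poly q z = 0}"
  have finR: "finite R" unfolding R_def by (rule finite_root_set[OF finA])
  have RM: "\<exists>z'. mt z z'" if "z \<in> R" for z
    using that root_match[OF fin ok IH1 IH2] unfolding R_def mt_def A_def by blast
  \<comment> \<open>Roots on the primed side need partners as well; this is
    \<open>root_match\<close> for the swapped pairs.\<close>
  have RMs: "\<exists>z. mt z z'" if q: "(q,q') \<in> A" "q' \<noteq> 0" "poly q' z' = 0" for q q' z'
  proof -
    let ?G = "prod.swap ` G"
    have "\<exists>y'. sgn_match ?G k (Suc D) z' y' \<and> sgn_match ?G ?k1 D z' y'"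
    proof (rule root_match[of ?G k D q' q])
      show "(q',q) \<in> pair_polys ?G k (Suc D) \<or> (q',q) \<in> pair_polys ?G ?k2 D"
        using q(1) unfolding A_def pair_polys_swap by force
    qed (use fin ok IH1 IH2 q in \<open>auto simp: sgn_ok_swap sgn_match_swap\<close>)
    then show ?thesis unfolding mt_def sgn_match_swap by blast
  qed
  have mtD: "sgn (poly q z) = sgn (poly q' z')" if "mt z z'" "(q,q') \<in> A" for z z' q q'
    using that pair_polys_mono[of ?k2 ?k1 D D G] unfolding mt_def A_def by (auto intro: sgn_matchD simp: lvl1_def)
  have mt0: "poly q z = 0 \<longleftrightarrow> poly q' z' = 0" if "mt z z'" "(q,q') \<in> A" for z z' q q'
    using mtD[OF that] by (metis sgn_0_0)
  have AL: "q = 0 \<longleftrightarrow> q' = 0" if "(q,q') \<in> A" for q q'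
    using pair_polys_lead(3)[OF ok1] that AM by blast
  have mtd: "sgn (poly ((pderiv ^^ j) q) z) = sgn (poly ((pderiv ^^ j) q') z')"
    if "mt z z'" "(q,q') \<in> A" for z z' q q' j
  proof (cases j)
    case 0
    then show ?thesis using mtD[OF that] by simp
  next
    case (Suc i)
    have "((pderiv ^^ j) q, (pderiv ^^ j) q') \<in> pair_polys G ?k1 D"
    proof (cases "(q,q') \<in> pair_polys G k (Suc D)")
      case True
      from pair_polys_pderiv_iter[OF this, of ?k2 j] have "((pderiv ^^ j) q, (pderiv ^^ j) q') \<in> pair_polys G ?k2 (Suc D - j)"
        by (simp add: lvl2_def)
      moreover have "pair_polys G ?k2 (Suc D - j) \<subseteq> pair_polys G ?k1 D" by (rule pair_polys_mono) (use Suc in \<open>auto simp: lvl1_def\<close>)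
      ultimately show ?thesis by blast
    next
      case False
      then have "(q,q') \<in> pair_polys G ?k2 D" using that(2) unfolding A_def by blast
      from pair_polys_pderiv_iter[OF this, of ?k1 j] have "((pderiv ^^ j) q, (pderiv ^^ j) q') \<in> pair_polys G ?k1 (D - j)"
        by (simp add: lvl1_def)
      moreover have "pair_polys G ?k1 (D - j) \<subseteq> pair_polys G ?k1 D" by (rule pair_polys_mono) auto
      ultimately show ?thesis by blast
    qed
    then show ?thesis using that(1) unfolding mt_def by (blast intro: sgn_matchD)
  qed
  have order: "z < x \<longleftrightarrow> z' < x'" "x < z \<longleftrightarrow> x' < z'" if zR: "z \<in> R" and zz: "mt z z'" and xx: "mt x x'" for z z' x x'
  proof -
    obtain q q' where q: "(q,q') \<in> A" "q \<noteq> 0" "poly q z = 0" using zR unfolding R_def by blast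
    have q1: "(q,q') \<in> pair_polys G ?k1 (Suc D)" using q AM by blast
    show "z < x \<longleftrightarrow> z' < x'" "x < z \<longleftrightarrow> x' < z'"
      using root_order[OF ok1 q1 q(2) _ mtd[OF zz q(1)] mtd[OF xx q(1)]] q(3) by blast+
  qed
  obtain M where M: "M > 0" "\<And>y. \<bar>y\<bar> \<ge> M \<Longrightarrow> sgn_match G ?k1 (Suc D) y y"
    "\<And>y p q. \<bar>y\<bar> \<ge> M \<Longrightarrow> (p,q) \<in> pair_polys G ?k1 (Suc D) \<Longrightarrow> p \<noteq> 0 \<Longrightarrow> poly p y \<noteq> 0 \<and> poly q y \<noteq> 0"
    by (rule sgn_match_ends[OF fin ok1, of "Suc D"]) (rule that; assumption)
  have mtM: "mt y y" if "\<bar>y\<bar> \<ge> M" for y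
    using M(2)[OF that] unfolding mt_def by (auto elim: sgn_match_mono simp: lvl1_def lvl2_def)
  have RMM: "\<bar>z\<bar> < M" if "z \<in> R" for z
  proof (rule ccontr)
    assume "\<not> \<bar>z\<bar> < M"
    then have "\<bar>z\<bar> \<ge> M" by simp
    then show False using that M(3)[of z] AM unfolding R_def by blast
  qed
  show ?thesis
  proof (cases "y \<in> R \<or> \<bar>y\<bar> \<ge> M")
    case True
    then show ?thesis using RM mtM unfolding mt_def by blast
  next
    case False
    then have yR: "y \<notin> R" and yM: "\<bar>y\<bar> < M" by auto
    obtain u v where u: "u = -M \<or> u \<in> R" "u < y" and v: "v = M \<or> v \<in> R" "y < v"
      and uvR: "\<And>z. u < z \<Longrightarrow> z < v \<Longrightarrow> z \<notin> R"
      by (rule neighbours[OF finR yM yR]) (rule that; assumption)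
    obtain u' where u': "mt u u'" "u \<notin> R \<longrightarrow> u' = u"
      using RM[of u] mtM[of u] u M(1) by (cases "u \<in> R") auto
    obtain v' where v': "mt v v'" "v \<notin> R \<longrightarrow> v' = v"
      using RM[of v] mtM[of v] v M(1) by (cases "v \<in> R") auto
    have uv': "u' < v'"
    proof (cases "u \<in> R \<or> v \<in> R")
      case True
      then show ?thesis using order[of u u' v v'] order[of v v' u u'] u v u'(1) v'(1) by auto
    next
      case False
      then show ?thesis using u u'(2) v v'(2) M(1) by auto
    qed
    define y' where "y' = (u' + v') / 2"
    have y': "u' < y'" "y' < v'" using uv' unfolding y'_def by auto
    have "sgn_match G k (Suc D) y y'"
      unfolding sgn_match_def
    proof clarify
      fix p p' assume "(p,p') \<in> pair_polys G k (Suc D)"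
      then have p: "(p,p') \<in> A" unfolding A_def by blast
      show "sgn (poly p y) = sgn (poly p' y')"
      proof (cases "p = 0")
        case True
        then show ?thesis using AL[OF p] by simp
      next
        case False
        have n1: "poly p t \<noteq> 0" if "u < t" "t < v" for t
          using uvR[OF that] p False unfolding R_def by blast
        have n2: "poly p' t' \<noteq> 0" if t': "u' < t'" "t' < v'" for t'
        proof
          assume r: "poly p' t' = 0"
          obtain t where t: "mt t t'" using RMs[OF p _ r] AL[OF p] False by blast
          have tR: "t \<in> R" using mt0[OF t p] r p False unfolding R_def by blast
          have "u < t" using order(1)[OF _ u'(1) t] t'(1) u(1) RMM[OF tR] by auto
          moreover have "t < v" using order(2)[OF _ v'(1) t] t'(2) v(1) RMM[OF tR] by auto
          ultimately show False using uvR tR by blast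
        qed
        \<comment> \<open>If p vanished at both ends, its derivative would have a root inside the
          cell, and that root would belong to R. So the sign of p on the cell can be read off at one
          end.\<close>
        have "poly p u \<noteq> 0 \<or> poly p v \<noteq> 0"
        proof (rule ccontr)
          assume c: "\<not> (poly p u \<noteq> 0 \<or> poly p v \<noteq> 0)"
          have "u < v" using u v by simp
          from poly_MVT[OF this, of p] obtain x where x: "u < x" "x < v" "poly (pderiv p) x = 0"
            using c \<open>u < v\<close> by auto
          have "(pderiv p, pderiv p') \<in> pair_polys G (k + Suc D) D"
            using pair_polys_pderiv[of p p' G k "Suc D"] \<open>(p,p') \<in> pair_polys G k (Suc D)\<close> by simp
          moreover have "pair_polys G (k + Suc D) D \<subseteq> pair_polys G ?k2 D" by (rule pair_polys_mono) (auto simp: lvl2_def)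
          ultimately have "(pderiv p, pderiv p') \<in> A" unfolding A_def by blast
          moreover have "pderiv p \<noteq> 0"
          proof
            assume "pderiv p = 0"
            then obtain a where "p = [:a:]" by (metis pderiv_eq_0_iff degree_eq_zeroE)
            then show False using c False by simp
          qed
          ultimately have "x \<in> R" using x unfolding R_def by blast
          then show False using uvR x by blast
        qed
        then show ?thesis
        proof
          assume pu: "poly p u \<noteq> 0"
          then have pu': "poly p' u' \<noteq> 0" using mt0[OF u'(1) p] by simp
          have "sgn (poly p u) = sgn (poly p y)"
          proof (rule sgn_eq_if_no_root_aux)
            show "poly p x \<noteq> 0" if "u \<le> x" "x \<le> y" for x using n1[of x] pu that v by (cases "x = u") auto
          qed (use u in auto)
          moreover have "sgn (poly p' u') = sgn (poly p' y')"
          proof (rule sgn_eq_if_no_root_aux)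
            show "poly p' x \<noteq> 0" if "u' \<le> x" "x \<le> y'" for x using n2[of x] pu' that y' by (cases "x = u'") auto
          qed (use y' in auto)
          ultimately show ?thesis using mtD[OF u'(1) p] by simp
        next
          assume pv: "poly p v \<noteq> 0"
          then have pv': "poly p' v' \<noteq> 0" using mt0[OF v'(1) p] by simp
          have "sgn (poly p y) = sgn (poly p v)"
          proof (rule sgn_eq_if_no_root_aux)
            show "poly p x \<noteq> 0" if "y \<le> x" "x \<le> v" for x using n1[of x] pv that u by (cases "x = v") auto
          qed (use v in auto)
          moreover have "sgn (poly p' y') = sgn (poly p' v')"
          proof (rule sgn_eq_if_no_root_aux)
            show "poly p' x \<noteq> 0" if "y' \<le> x" "x \<le> v'" for x using n2[of x] pv' that y' by (cases "x = v'") auto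
          qed (use y' in auto)
          ultimately show ?thesis using mtD[OF v'(1) p] by simp
        qed
      qed
    qed
    then show ?thesis by blast
  qed
qed

text \<open>\<open>lvl0 k D\<close> equals k + 3 D D + 5 D + 10; one such increment per degree below
  D, each bounded by its value at D, gives the closed form.\<close>

definition qe_level :: "nat \<Rightarrow> nat \<Rightarrow> nat" where
  "qe_level k D = k + D * (3 * D * D + 5 * D + 10)"

text \<open>Induction on the degree bound. For D = 0 only constants occur and any answer will do;
  the converse hypothesis of \<open>univariate_step\<close> is the induction hypothesis for the
  swapped pairs.\<close>

lemma univariate_match:
  assumes "finite G" "sgn_ok G (qe_level k D)"
  shows "\<exists>y'. sgn_match G k D y y'"
  using assms
proof (induction D arbitrary: k G y)
  case 0
  have "sgn_match G k 0 y y" unfolding sgn_match_def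
  proof clarify
    fix p q assume pq: "(p,q) \<in> pair_polys G k 0"
    then have "degree p = 0" "degree q = 0" by (auto simp: pair_polys_def)
    then obtain a b where "p = [:a:]" "q = [:b:]" by (metis degree_eq_zeroE)
    moreover have "sgn (coeff p 0) = sgn (coeff q 0)"
      using pair_polys_lead(2)[OF _ pq] 0 by (simp add: qe_level_def)
    ultimately show "sgn (poly p y) = sgn (poly q y)" by simp
  qed
  then show ?case by blast
next
  case (Suc D)
  have le: "qe_level (lvl0 k D) D \<le> qe_level k (Suc D)"
    by (simp add: qe_level_def lvl0_def lvl1_def lvl2_def algebra_simps)
  have ok: "sgn_ok G (qe_level (lvl0 k D) D)" using sgn_ok_mono[OF Suc.prems(2) le] .
  show ?case
  proof (rule univariate_step[OF Suc.prems(1)])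
    show "sgn_ok G (lvl0 k D)" using sgn_ok_mono[OF ok] by (simp add: qe_level_def)
    show "\<exists>y'. sgn_match G (lvl0 k D) D y y'" for y by (rule Suc.IH[OF Suc.prems(1) ok])
    show "\<exists>y. sgn_match G (lvl0 k D) D y y'" for y'
      using Suc.IH[of "prod.swap ` G" "lvl0 k D" y'] Suc.prems(1) ok by (simp add: sgn_ok_swap sgn_match_swap)
  qed
qed

text \<open>An expression of depth k is a polynomial of degree at most 2^k in the new variable. A
  coefficient of a product is a sum of at most 2^(k+1) + 1 products, whose cost fits since 2^(k+2) +
  1 + 2^(k+1) + 1 <= 2^(k+3).\<close>

lemma pair_cl_insert_poly:
  assumes "(a,b) \<in> pair_cl (insert (y,y') G) k"
  shows "\<exists>(p,q)\<in>pair_polys G (2 ^ (k + 2)) (2 ^ k). a = poly p y \<and> b = poly q y'"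
  using assms
proof (induction k arbitrary: a b)
  case 0
  have c: "\<exists>(p,q)\<in>pair_polys G 4 1. a = poly p y \<and> b = poly q y'" if "(a,b) \<in> pair_cl G 0"
  proof (rule bexI[of _ "([:a:],[:b:])"])
    have "(a,b) \<in> pair_cl G 4" using that pair_cl_mono[of 0 4 G] by blast
    then show "([:a:],[:b:]) \<in> pair_polys G 4 1"
      unfolding pair_polys_def by (auto simp: coeff_pCons consts_in_pair_cl split: nat.split)
  qed simp
  show ?case
  proof (cases "(a,b) = (y,y')")
    case True
    have "([:0,1:],[:0,1:]) \<in> pair_polys G 4 1"
      unfolding pair_polys_def by (auto simp: coeff_pCons consts_in_pair_cl split: nat.split)
    then show ?thesis using True by (auto intro!: bexI[of _ "([:0,1:],[:0,1:])"])
  next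
    case False
    then show ?thesis using c 0 by (auto simp: pair_cl.simps)
  qed
next
  case (Suc k)
  let ?c = "2 ^ (k + 2) :: nat"
  have mono: "pair_polys G ?c (2 ^ k) \<subseteq> pair_polys G (2 ^ (Suc k + 2)) (2 ^ Suc k)" by (rule pair_polys_mono) auto
  have le1: "Suc ?c \<le> 2 ^ (Suc k + 2)" by simp
  have le2: "Suc ?c + (2 ^ Suc k + 1) \<le> 2 ^ (Suc k + 2)"
  proof -
    have "(2::nat) \<le> 2 ^ Suc k" by simp
    then show ?thesis by simp
  qed
  consider "(a,b) \<in> pair_cl (insert (y,y') G) k"
    | a1 b1 a2 b2 where "(a1,b1) \<in> pair_cl (insert (y,y') G) k" "(a2,b2) \<in> pair_cl (insert (y,y') G) k" "a = a1 + a2" "b = b1 + b2"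
    | a1 b1 a2 b2 where "(a1,b1) \<in> pair_cl (insert (y,y') G) k" "(a2,b2) \<in> pair_cl (insert (y,y') G) k" "a = a1 * a2" "b = b1 * b2"
    using Suc.prems by (auto simp: pair_cl.simps)
  then show ?case
  proof cases
    case 1
    then show ?thesis using Suc.IH mono by blast
  next
    case 2
    obtain p1 q1 where 1: "(p1,q1) \<in> pair_polys G ?c (2 ^ k)" "a1 = poly p1 y" "b1 = poly q1 y'" using Suc.IH[OF 2(1)] by blast
    obtain p2 q2 where e2: "(p2,q2) \<in> pair_polys G ?c (2 ^ k)" "a2 = poly p2 y" "b2 = poly q2 y'" using Suc.IH[OF 2(2)] by blast
    have "(coeff (p1+p2) i, coeff (q1+q2) i) \<in> pair_cl G (2 ^ (Suc k + 2))" for i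
      using pair_cl_add[of "coeff p1 i" "coeff q1 i" G ?c "coeff p2 i" "coeff q2 i"] 1 e2 pair_cl_mono[OF le1, of G]
      unfolding pair_polys_def by auto
    moreover have "degree (p1+p2) \<le> 2 ^ Suc k" "degree (q1+q2) \<le> 2 ^ Suc k"
      using 1 e2 unfolding pair_polys_def by (auto intro!: degree_add_le)
    ultimately have "(p1+p2,q1+q2) \<in> pair_polys G (2 ^ (Suc k + 2)) (2 ^ Suc k)" unfolding pair_polys_def by auto
    then show ?thesis using 1 2 e2 by (auto intro!: bexI[of _ "(p1+p2,q1+q2)"])
  next
    case 3
    obtain p1 q1 where 1: "(p1,q1) \<in> pair_polys G ?c (2 ^ k)" "a1 = poly p1 y" "b1 = poly q1 y'" using Suc.IH[OF 3(1)] by blast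
    obtain p2 q2 where 2: "(p2,q2) \<in> pair_polys G ?c (2 ^ k)" "a2 = poly p2 y" "b2 = poly q2 y'" using Suc.IH[OF 3(2)] by blast
    have deg: "degree (p1*p2) \<le> 2 ^ Suc k" "degree (q1*q2) \<le> 2 ^ Suc k"
      using 1 2 degree_mult_le[of p1 p2] degree_mult_le[of q1 q2] unfolding pair_polys_def by auto
    have "(coeff (p1*p2) i, coeff (q1*q2) i) \<in> pair_cl G (2 ^ (Suc k + 2))" for i
    proof (cases "i \<le> 2 ^ Suc k")
      case True
      have "(coeff (p1*p2) i, coeff (q1*q2) i) \<in> pair_cl G (Suc ?c + card {..i})"
        unfolding coeff_mult by (rule pair_cl_sum) (use 1 2 in \<open>auto intro!: pair_cl_mult simp: pair_polys_def\<close>)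
      moreover have "Suc ?c + card {..i} \<le> 2 ^ (Suc k + 2)" proof -
        have "card {..i} \<le> 2 ^ Suc k + 1" using True by simp
        then show ?thesis using le2 by linarith
      qed
      ultimately show ?thesis using pair_cl_mono by blast
    next
      case False
      then have "coeff (p1*p2) i = 0" "coeff (q1*q2) i = 0" using deg by (auto intro!: coeff_eq_0)
      then show ?thesis by (simp add: consts_in_pair_cl)
    qed
    then have "(p1*p2,q1*q2) \<in> pair_polys G (2 ^ (Suc k + 2)) (2 ^ Suc k)" using deg unfolding pair_polys_def by auto
    then show ?thesis using 1 2 3 by (auto intro!: bexI[of _ "(p1*p2,q1*q2)"])
  qed
qed

text \<open>With t = 2^k the cost \<open>qe_level (2^(k+2)) (2^k)\<close> is 14 t + 5 t^2 + 3 t^3,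
  at most 32 t^3, a pure power of 2.\<close>

definition back_level :: "nat \<Rightarrow> nat" where "back_level k = 2 ^ (3 * k + 5)"

lemma sgn_ok_extend:
  assumes "finite G" "sgn_ok G (back_level k)"
  shows "\<exists>y'. sgn_ok (insert (y,y') G) k"
proof -
  have "qe_level (2 ^ (k + 2)) (2 ^ k) \<le> back_level k"
  proof -
    define t where "t = (2::nat) ^ k"
    have t: "t \<ge> 1" unfolding t_def by simp
    have t3: "back_level k = 32 * (t * t * t)"
      unfolding back_level_def t_def by (simp add: power_add power_mult power3_eq_cube[symmetric] power_mult_distrib flip: power_mult)
    have q: "qe_level (2 ^ (k + 2)) (2 ^ k) = 14 * t + 5 * (t * t) + 3 * (t * t * t)"
      unfolding qe_level_def t_def[symmetric] power_add by (simp add: algebra_simps t_def[symmetric])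
    have "t \<le> t * t * t" "t * t \<le> t * t * t" using t by auto
    then show ?thesis unfolding t3 q by linarith
  qed
  then have "sgn_ok G (qe_level (2 ^ (k + 2)) (2 ^ k))" using sgn_ok_mono[OF assms(2)] by blast
  from univariate_match[OF assms(1) this] obtain y' where "sgn_match G (2 ^ (k + 2)) (2 ^ k) y y'" by blast
  then have "sgn_ok (insert (y,y') G) k"
    unfolding sgn_ok_def using pair_cl_insert_poly[of _ _ y y' G k] by (fastforce dest: sgn_matchD)
  then show ?thesis by blast
qed

lemma sgn_ok_extend_many:
  assumes "finite G" "sgn_ok G ((back_level ^^ n) k)"
  shows "\<exists>x'. sgn_ok (G \<union> (\<lambda>i. (x i, x' i)) ` {..<n}) k"
  using assms(2)
proof (induction n arbitrary: k)
  case (Suc n)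
  then have "sgn_ok G ((back_level ^^ n) (back_level k))" by (simp add: funpow_swap1)
  from Suc.IH[OF this] obtain x' where x': "sgn_ok (G \<union> (\<lambda>i. (x i, x' i)) ` {..<n}) (back_level k)" by blast
  obtain y' where y': "sgn_ok (insert (x n, y') (G \<union> (\<lambda>i. (x i, x' i)) ` {..<n})) k"
    using sgn_ok_extend[OF _ x'] assms(1) by blast
  have "insert (x n, y') (G \<union> (\<lambda>i. (x i, x' i)) ` {..<n})
      = G \<union> (\<lambda>i. (x i, (x'(n := y')) i)) ` {..<Suc n}"
    by (auto simp: lessThan_Suc image_iff)
  with y' show ?case by metis
qed simp

subsection \<open>Realising order types on a bounded grid\<close>

text \<open>An expression in h alone is an integer polynomial. The majorant q, whose coefficients
  dominate those of p, makes the sum of absolute coefficients submultiplicative via evaluation at 1;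
  each level at most squares the bound.\<close>

lemma pair_cl_single_poly:
  assumes "(a,b) \<in> pair_cl {(h,h')} k"
  shows "\<exists>p q :: real poly. (\<forall>i. coeff p i \<in> \<int>) \<and> (\<forall>i. \<bar>coeff p i\<bar> \<le> coeff q i) \<and>
     poly q 1 \<le> 2 ^ (2 ^ k) \<and> a = poly p h \<and> b = poly p h'"
  using assms
proof (induction k arbitrary: a b)
  case 0
  then consider "(a,b) = (h,h')" | c where "c \<in> {0,1,-1}" "a = c" "b = c" by (auto simp: pair_cl.simps)
  then show ?case
  proof cases
    case 1
    then show ?thesis
      by (intro exI[of _ "[:0,1:]"]) (auto simp: coeff_pCons split: nat.split)
  next
    case (2 c)
    then show ?thesis
      by (intro exI[of _ "[:c:]"] exI[of _ "[:1:]"]) (auto simp: coeff_pCons split: nat.split)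
  qed
next
  case (Suc k)
  let ?c = "2 ^ (2 ^ k) :: real"
  have c2: "?c \<ge> 2" using self_le_power[of "2::real" "2 ^ k"] by simp
  have cc: "?c * ?c = 2 ^ (2 ^ Suc k)" by (simp add: power_add[symmetric] mult_2)
  have "2 * ?c \<le> ?c * ?c" using c2 by (intro mult_right_mono) auto
  then have c_add: "?c + ?c \<le> 2 ^ (2 ^ Suc k)" using cc by simp
  have nn: "poly q 1 \<ge> 0" if "\<forall>i. \<bar>coeff p i\<bar> \<le> coeff q i" for p q :: "real poly"
    unfolding poly_altdef using that by (auto intro!: sum_nonneg) (meson abs_ge_zero order_trans)
  consider "(a,b) \<in> pair_cl {(h,h')} k"
    | a1 b1 a2 b2 where "(a1,b1) \<in> pair_cl {(h,h')} k" "(a2,b2) \<in> pair_cl {(h,h')} k" "a = a1 + a2" "b = b1 + b2"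
    | a1 b1 a2 b2 where "(a1,b1) \<in> pair_cl {(h,h')} k" "(a2,b2) \<in> pair_cl {(h,h')} k" "a = a1 * a2" "b = b1 * b2"
    using Suc.prems by (auto simp: pair_cl.simps)
  then show ?case
  proof cases
    case 1
    have "?c \<le> 2 ^ (2 ^ Suc k)" using c_add c2 by linarith
    moreover obtain p q :: "real poly" where "\<forall>i. coeff p i \<in> \<int>" "\<forall>i. \<bar>coeff p i\<bar> \<le> coeff q i"
      "poly q 1 \<le> ?c" "a = poly p h" "b = poly p h'" using Suc.IH[OF 1] by blast
    ultimately show ?thesis by - (rule exI[of _ p], rule exI[of _ q], auto simp del: power_Suc intro: order_trans)
  next
    case 2
    obtain p1 q1 :: "real poly" where 1: "\<forall>i. coeff p1 i \<in> \<int>" "\<forall>i. \<bar>coeff p1 i\<bar> \<le> coeff q1 i"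
      "poly q1 1 \<le> ?c" "a1 = poly p1 h" "b1 = poly p1 h'" using Suc.IH[OF 2(1)] by blast
    obtain p2 q2 :: "real poly" where e2: "\<forall>i. coeff p2 i \<in> \<int>" "\<forall>i. \<bar>coeff p2 i\<bar> \<le> coeff q2 i"
      "poly q2 1 \<le> ?c" "a2 = poly p2 h" "b2 = poly p2 h'" using Suc.IH[OF 2(2)] by blast
    have "\<bar>coeff (p1 + p2) i\<bar> \<le> coeff (q1 + q2) i" for i
      using 1(2)[rule_format, of i] e2(2)[rule_format, of i] by simp
    then show ?thesis
      using 1 2 e2 c_add by - (rule exI[of _ "p1 + p2"], rule exI[of _ "q1 + q2"], auto)
  next
    case 3
    obtain p1 q1 :: "real poly" where 1: "\<forall>i. coeff p1 i \<in> \<int>" "\<forall>i. \<bar>coeff p1 i\<bar> \<le> coeff q1 i"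
      "poly q1 1 \<le> ?c" "a1 = poly p1 h" "b1 = poly p1 h'" using Suc.IH[OF 3(1)] by blast
    obtain p2 q2 :: "real poly" where e2: "\<forall>i. coeff p2 i \<in> \<int>" "\<forall>i. \<bar>coeff p2 i\<bar> \<le> coeff q2 i"
      "poly q2 1 \<le> ?c" "a2 = poly p2 h" "b2 = poly p2 h'" using Suc.IH[OF 3(2)] by blast
    have "\<bar>coeff (p1 * p2) i\<bar> \<le> coeff (q1 * q2) i" for i
      unfolding coeff_mult
    proof (rule order_trans[OF sum_abs sum_mono])
      fix j
      have "0 \<le> coeff q1 j" using 1(2) by (meson abs_ge_zero order_trans)
      then show "\<bar>coeff p1 j * coeff p2 (i - j)\<bar> \<le> coeff q1 j * coeff q2 (i - j)"
        unfolding abs_mult using 1(2) e2(2) by (intro mult_mono) auto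
    qed
    moreover have "poly (q1 * q2) 1 \<le> 2 ^ (2 ^ Suc k)"
      unfolding poly_mult cc[symmetric] using 1(3) e2(3) nn[OF 1(2)] nn[OF e2(2)] by (intro mult_mono) auto
    moreover have "coeff (p1 * p2) i \<in> \<int>" for i
      unfolding coeff_mult using 1(1) e2(1) by (intro Ints_sum Ints_mult) auto
    ultimately show ?thesis
      using 1 3 e2 by - (rule exI[of _ "p1 * p2"], rule exI[of _ "q1 * q2"], auto)
  qed
qed

text \<open>A nonzero integer leading coefficient has absolute value at least 1, so above the sum of
  all absolute coefficients the leading term outweighs the rest.\<close>

lemma sgn_poly_large:
  fixes p q :: "real poly"
  assumes int: "\<And>i. coeff p i \<in> \<int>" and dom: "\<And>i. \<bar>coeff p i\<bar> \<le> coeff q i"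
    and c: "poly q 1 \<le> C" and h: "h > C"
  shows "sgn (poly p h) = sgn (lead_coeff p)"
proof (cases "degree p")
  case 0
  then obtain a where "p = [:a:]" by (metis degree_eq_zeroE)
  then show ?thesis by simp
next
  case (Suc n)
  have q0: "coeff q i \<ge> 0" for i using dom[of i] by linarith
  have lc0: "lead_coeff p \<noteq> 0" using Suc by (metis degree_0 leading_coeff_0_iff nat.distinct(1))
  then have lc: "\<bar>lead_coeff p\<bar> \<ge> 1" using int by (metis Ints_nonzero_abs_ge1)
  have "coeff q (Suc n) \<noteq> 0" using dom[of "Suc n"] lc Suc by auto
  then have dq: "Suc n \<le> degree q" by (rule le_degree)
  have C: "(\<Sum>i\<le>n. coeff q i) \<le> C"
  proof -
    have "(\<Sum>i\<le>n. coeff q i) \<le> (\<Sum>i\<le>degree q. coeff q i)"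
      using dq q0 by (intro sum_mono2) auto
    also have "\<dots> = poly q 1" by (simp add: poly_altdef)
    finally show ?thesis using c by simp
  qed
  have "coeff q (Suc n) \<ge> 1" using dom[of "Suc n"] lc Suc by auto
  moreover have "coeff q (Suc n) \<le> poly q 1"
  proof -
    have "coeff q (Suc n) \<le> (\<Sum>i\<le>degree q. coeff q i)"
      using dq q0 by (intro member_le_sum) auto
    then show ?thesis by (simp add: poly_altdef)
  qed
  ultimately have h1: "h \<ge> 1" using c h by linarith
  define r where "r = (\<Sum>i\<le>n. coeff p i * h ^ i)"
  have "\<bar>r\<bar> \<le> (\<Sum>i\<le>n. coeff q i * h ^ n)"
    unfolding r_def
  proof (rule order_trans[OF sum_abs sum_mono])
    fix i assume "i \<in> {..n}"
    then have "h ^ i \<le> h ^ n" using h1 by (intro power_increasing) auto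
    then show "\<bar>coeff p i * h ^ i\<bar> \<le> coeff q i * h ^ n"
      unfolding abs_mult using dom h1 q0 by (intro mult_mono) auto
  qed
  also have "\<dots> = (\<Sum>i\<le>n. coeff q i) * h ^ n" by (simp add: sum_distrib_right)
  also have "\<dots> \<le> C * h ^ n" using C h1 by (intro mult_right_mono) auto
  also have "\<dots> < h * h ^ n" using h h1 by (intro mult_strict_right_mono) auto
  also have "\<dots> \<le> \<bar>lead_coeff p\<bar> * h ^ Suc n" using lc h1 mult_right_mono[of 1 "\<bar>lead_coeff p\<bar>" "h ^ Suc n"] by simp
  finally have r: "\<bar>r\<bar> < \<bar>lead_coeff p * h ^ Suc n\<bar>" using h1 by (simp add: abs_mult)
  have p: "poly p h = lead_coeff p * h ^ Suc n + r"
    unfolding r_def poly_altdef Suc by simp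
  have "sgn (poly p h) = sgn (lead_coeff p * h ^ Suc n)"
    unfolding p using r by (auto simp: sgn_real_def abs_if split: if_splits)
  then show ?thesis using h1 by (simp add: sgn_mult)
qed

lemma sgn_ok_single:
  assumes "h > 2 ^ (2 ^ k)" "h' > 2 ^ (2 ^ k)"
  shows "sgn_ok {(h,h')} k"
  unfolding sgn_ok_def
proof clarify
  fix a b assume "(a,b) \<in> pair_cl {(h,h')} k"
  from pair_cl_single_poly[OF this] obtain p q :: "real poly" where
    "\<And>i. coeff p i \<in> \<int>" "\<And>i. \<bar>coeff p i\<bar> \<le> coeff q i" "poly q 1 \<le> 2 ^ (2 ^ k)" "a = poly p h" "b = poly p h'"
    by blast
  then show "sgn a = sgn b" using sgn_poly_large assms by metis
qed

text \<open>n levels for the products, one for the sign, and one for each of the n!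
  summands.\<close>

lemma pair_cl_det_n:
  assumes "\<And>i j. i < n \<Longrightarrow> j < n \<Longrightarrow> (A i j, B i j) \<in> pair_cl G k"
  shows "(det_n n A, det_n n B) \<in> pair_cl G (k + n + 1 + fact n)"
proof -
  have "(of_int (sign \<sigma>) * (\<Prod>i<n. A i (\<sigma> i)), of_int (sign \<sigma>) * (\<Prod>i<n. B i (\<sigma> i))) \<in> pair_cl G (Suc (k + n))"
    if "\<sigma> permutes {..<n}" for \<sigma>
  proof (rule pair_cl_mult)
    show "(of_int (sign \<sigma>), of_int (sign \<sigma>)) \<in> pair_cl G (k + n)"
      by (cases "sign \<sigma>" rule: linorder_cases[of _ 0]) (auto simp: sign_def consts_in_pair_cl)
    have "(\<Prod>i<n. A i (\<sigma> i), \<Prod>i<n. B i (\<sigma> i)) \<in> pair_cl G (k + card {..<n})"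
      by (rule pair_cl_prod) (use assms that permutes_in_image in fastforce)+
    then show "(\<Prod>i<n. A i (\<sigma> i), \<Prod>i<n. B i (\<sigma> i)) \<in> pair_cl G (k + n)" by simp
  qed
  then have "(det_n n A, det_n n B) \<in> pair_cl G (Suc (k + n) + card {\<sigma>. \<sigma> permutes {..<n}})"
    unfolding det_n_def by (intro pair_cl_sum) (auto simp: finite_permutations)
  then show ?thesis by (simp add: card_permutations[of "{..<n}" n])
qed

text \<open>A determinant of size \<open>Suc d\<close> over the coordinates has depth d + 2 +
  (d+1)!; comparing h times the determinant with 1 and -1 takes at most three more levels.\<close>

definition det_level :: "nat \<Rightarrow> nat" where "det_level d = d + 8 + fact (Suc d)"

text \<open>Beyond 2^(2^K) all values of h give the same signs to expressions of depth K; K is what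
  \<open>T * d\<close> rounds of the back-and-forth need to end at
  \<open>det_level d\<close>.\<close>

definition real_bound :: "nat \<Rightarrow> nat \<Rightarrow> nat" where
  "real_bound T d = 2 ^ (2 ^ ((back_level ^^ (T * d)) (det_level d))) + 1"

lemma real_bound_pos: "real_bound T d > 0"
  by (simp add: real_bound_def)

lemma sgn_eq_nonneg: "sgn a = sgn (b::real) \<Longrightarrow> a \<ge> 0 \<Longrightarrow> b \<ge> 0"
  by (auto simp: sgn_real_def split: if_splits)

text \<open>The bounds on coordinates and determinants are sign conditions in the coordinates and
  the parameter h. They hold for the given points when h is huge, and pass to the new points when h
  is answered by \<open>real_bound T d\<close>.\<close>

lemma bounded_realization:
  fixes P :: "nat \<Rightarrow> point"
  shows "\<exists>P' :: nat \<Rightarrow> point. (\<forall>l<T. \<forall>k<d. \<bar>P' l k\<bar> \<le> real_bound T d) \<and>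
    (\<forall>\<tau>. (\<forall>i\<le>d. \<tau> i < T) \<longrightarrow> hdet d (\<lambda>i. P (\<tau> i)) \<noteq> 0 \<longrightarrow>
       sgn (hdet d (\<lambda>i. P' (\<tau> i))) = sgn (hdet d (\<lambda>i. P (\<tau> i))) \<and>
       real_bound T d * \<bar>hdet d (\<lambda>i. P' (\<tau> i))\<bar> \<ge> 1)"
proof -
  define n where "n = T * d"
  define K where "K = (back_level ^^ n) (det_level d)"
  define H where "H = real (real_bound T d)"
  \<comment> \<open>All \<open>T * d\<close> coordinates in one sequence: coordinate k of point l
    has place l * d + k.\<close>
  define x where "x v = P (v div d) (v mod d)" for v
  define good where "good h \<longleftrightarrow> h > 2 ^ (2 ^ K) \<and> (\<forall>v<n. \<bar>x v\<bar> \<le> h) \<and>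
     (\<forall>\<tau>\<in>{..d} \<rightarrow>\<^sub>E {..<T}. hdet d (\<lambda>i. P (\<tau> i)) \<noteq> 0 \<longrightarrow> h * \<bar>hdet d (\<lambda>i. P (\<tau> i))\<bar> \<ge> 1)" for h :: real
  have "eventually good at_top"
  proof -
    have "eventually (\<lambda>h. \<forall>v\<in>{..<n}. \<bar>x v\<bar> \<le> h) at_top"
      by (intro eventually_ball_finite ballI eventually_ge_at_top) auto
    moreover have "eventually (\<lambda>h. \<forall>\<tau>\<in>{..d} \<rightarrow>\<^sub>E {..<T}. hdet d (\<lambda>i. P (\<tau> i)) \<noteq> 0 \<longrightarrow> h * \<bar>hdet d (\<lambda>i. P (\<tau> i))\<bar> \<ge> 1) at_top"
    proof (intro eventually_ball_finite ballI finite_PiE)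
      fix \<tau>
      show "eventually (\<lambda>h. hdet d (\<lambda>i. P (\<tau> i)) \<noteq> 0 \<longrightarrow> h * \<bar>hdet d (\<lambda>i. P (\<tau> i))\<bar> \<ge> 1) at_top"
        using eventually_ge_at_top[of "1 / \<bar>hdet d (\<lambda>i. P (\<tau> i))\<bar>"]
        by eventually_elim (auto simp: field_simps)
    qed auto
    ultimately show ?thesis using eventually_gt_at_top[of "2 ^ (2 ^ K)"]
      unfolding good_def by eventually_elim auto
  qed
  then obtain h where h: "good h" using eventually_happens[of good at_top] by auto
  have "sgn_ok {(h,H)} K"
    by (rule sgn_ok_single) (use h in \<open>auto simp: good_def H_def real_bound_def K_def n_def\<close>)
  then have "\<exists>x'. sgn_ok ({(h,H)} \<union> (\<lambda>v. (x v, x' v)) ` {..<n}) (det_level d)"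
    unfolding K_def by (intro sgn_ok_extend_many) auto
  then obtain x' where x': "sgn_ok ({(h,H)} \<union> (\<lambda>v. (x v, x' v)) ` {..<n}) (det_level d)" by blast
  define G where "G = {(h,H)} \<union> (\<lambda>v. (x v, x' v)) ` {..<n}"
  have ok: "sgn a = sgn b" if "(a,b) \<in> pair_cl G k" "k \<le> det_level d" for a b k
    using x' that pair_cl_mono[of k "det_level d" G] unfolding sgn_ok_def G_def by blast
  define P' where "P' l k = x' (l * d + k)" for l k
  have idx: "l * d + k < n" "x (l * d + k) = P l k" if "l < T" "k < d" for l k
  proof -
    have "l * d + k < Suc l * d" using that by simp
    also have "\<dots> \<le> n" unfolding n_def using that by (intro mult_right_mono) auto
    finally show "l * d + k < n" .
    show "x (l * d + k) = P l k" using that unfolding x_def by simp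
  qed
  have inG: "(P l k, P' l k) \<in> G" if "l < T" "k < d" for l k
    using idx[OF that] unfolding G_def P'_def by force
  have hG: "(h,H) \<in> G" unfolding G_def by simp
  have b: "\<bar>P' l k\<bar> \<le> H" if "l < T" "k < d" for l k
  proof -
    have *: "(P l k, P' l k) \<in> pair_cl G 1" "(h, H) \<in> pair_cl G 1" "(P l k, P' l k) \<in> pair_cl G 0" "(h, H) \<in> pair_cl G 0"
      using inG[OF that] hG gen_in_pair_cl by blast+
    have "(h + P l k, H + P' l k) \<in> pair_cl G (Suc 0)" using pair_cl_add[OF *(4,3)] .
    moreover have "(- P l k, - P' l k) \<in> pair_cl G 1" using pair_cl_uminus[OF *(3)] by simp
    from pair_cl_add[OF *(2) this] have "(h - P l k, H - P' l k) \<in> pair_cl G (Suc 1)" by simp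
    ultimately have "sgn (h + P l k) = sgn (H + P' l k)" "sgn (h - P l k) = sgn (H - P' l k)"
      using ok by (auto simp: det_level_def)
    moreover have "\<bar>P l k\<bar> \<le> h" using h idx[OF that] unfolding good_def by metis
    ultimately have "H + P' l k \<ge> 0" "H - P' l k \<ge> 0"
      using sgn_eq_nonneg[of "h + P l k" "H + P' l k"] sgn_eq_nonneg[of "h - P l k" "H - P' l k"] by linarith+
    then show ?thesis by linarith
  qed
  have dd: "sgn (hdet d (\<lambda>i. P' (\<tau> i))) = sgn (hdet d (\<lambda>i. P (\<tau> i))) \<and> H * \<bar>hdet d (\<lambda>i. P' (\<tau> i))\<bar> \<ge> 1"
    if \<tau>: "\<forall>i\<le>d. \<tau> i < T" and nz: "hdet d (\<lambda>i. P (\<tau> i)) \<noteq> 0" for \<tau>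
  proof -
    let ?D = "hdet d (\<lambda>i. P (\<tau> i))" and ?D' = "hdet d (\<lambda>i. P' (\<tau> i))"
    let ?k = "Suc d + 1 + fact (Suc d)"
    have D: "(?D, ?D') \<in> pair_cl G ?k"
    proof -
      have "((if j = 0 then 1 else P (\<tau> i) (j - 1)), (if j = 0 then 1 else P' (\<tau> i) (j - 1))) \<in> pair_cl G 0"
        if "i < Suc d" "j < Suc d" for i j
        using that \<tau> inG[of "\<tau> i" "j - 1"] by (auto simp: less_Suc_eq_le pair_cl.simps)
      from pair_cl_det_n[of "Suc d" _ _ G 0, OF this] show ?thesis unfolding hdet_def by (simp del: fact_Suc)
    qed
    have s1: "sgn ?D = sgn ?D'" using ok[OF D] by (simp add: det_level_def del: fact_Suc)
    have hk: "(h, H) \<in> pair_cl G ?k" using hG gen_in_pair_cl by blast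
    have m: "(h * ?D, H * ?D') \<in> pair_cl G (Suc ?k)" by (rule pair_cl_mult[OF hk D])
    \<comment> \<open>The bound on the absolute value of the determinant is split into two
      polynomial sign conditions, one for each sign of it.\<close>
    have a1: "(h * ?D - 1, H * ?D' - 1) \<in> pair_cl G (Suc (Suc ?k))"
      using pair_cl_add[OF m consts_in_pair_cl(3)] by simp
    have a2: "(- (h * ?D) - 1, - (H * ?D') - 1) \<in> pair_cl G (Suc (Suc (Suc ?k)))"
      using pair_cl_add[OF pair_cl_uminus[OF m] consts_in_pair_cl(3)] by simp
    have s2: "sgn (h * ?D - 1) = sgn (H * ?D' - 1)" "sgn (- (h * ?D) - 1) = sgn (- (H * ?D') - 1)"
      using ok[OF a1] ok[OF a2] by (auto simp: det_level_def simp del: fact_Suc)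
    \<comment> \<open>\<open>good\<close> speaks of extensional tuples only, to keep its conditions
      finite in number.\<close>
    have "hdet d (\<lambda>i. P (\<tau> i)) = hdet d (\<lambda>i. P (restrict \<tau> {..d} i))" by (rule hdet_cong) simp
    moreover have "restrict \<tau> {..d} \<in> {..d} \<rightarrow>\<^sub>E {..<T}" using \<tau> by auto
    ultimately have hD: "h * \<bar>?D\<bar> \<ge> 1" using h nz unfolding good_def by metis
    have H0: "H > 0" unfolding H_def using real_bound_pos by simp
    have "H * \<bar>?D'\<bar> \<ge> 1"
    proof (cases "?D > 0")
      case True
      then have "h * ?D - 1 \<ge> 0" using hD by simp
      then have "H * ?D' - 1 \<ge> 0" using s2(1) sgn_eq_nonneg by blast
      moreover have "?D' > 0" using s1 True by (metis sgn_greater)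
      ultimately show ?thesis by simp
    next
      case False
      then have "?D < 0" using nz by simp
      then have "- (h * ?D) - 1 \<ge> 0" using hD by simp
      then have "- (H * ?D') - 1 \<ge> 0" using s2(2) sgn_eq_nonneg by blast
      moreover have "?D' < 0" using s1 \<open>?D < 0\<close> by (metis sgn_less)
      ultimately show ?thesis by simp
    qed
    then show ?thesis using s1 by simp
  qed
  show ?thesis using b dd unfolding H_def by blast
qed

section \<open>Rounding to a grid\<close>

lemma prod_diff_bound:
  fixes a b :: "nat \<Rightarrow> real"
  assumes "\<And>i. i < n \<Longrightarrow> \<bar>a i\<bar> \<le> B" "\<And>i. i < n \<Longrightarrow> \<bar>b i\<bar> \<le> B" "\<And>i. i < n \<Longrightarrow> \<bar>a i - b i\<bar> \<le> e" "B \<ge> 1" "e \<ge> 0"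
  shows "\<bar>(\<Prod>i<n. a i) - (\<Prod>i<n. b i)\<bar> \<le> n * B ^ n * e"
  using assms
proof (induction n)
  case (Suc n)
  have IH: "\<bar>(\<Prod>i<n. a i) - (\<Prod>i<n. b i)\<bar> \<le> n * B ^ n * e" by (rule Suc.IH) (use Suc.prems in auto)
  have pb: "\<bar>\<Prod>i<n. b i\<bar> \<le> B ^ n"
    unfolding abs_prod using prod_mono[of "{..<n}" "\<lambda>i. \<bar>b i\<bar>" "\<lambda>_. B"] Suc.prems(2) by auto
  have "(\<Prod>i<Suc n. a i) - (\<Prod>i<Suc n. b i) = ((\<Prod>i<n. a i) - (\<Prod>i<n. b i)) * a n + (\<Prod>i<n. b i) * (a n - b n)"
    by (simp add: algebra_simps)
  also have "\<bar>\<dots>\<bar> \<le> (n * B ^ n * e) * B + B ^ n * e"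
  proof (rule order_trans[OF abs_triangle_ineq add_mono])
    show "\<bar>((\<Prod>i<n. a i) - (\<Prod>i<n. b i)) * a n\<bar> \<le> n * B ^ n * e * B"
      unfolding abs_mult using IH Suc.prems by (intro mult_mono) auto
    show "\<bar>(\<Prod>i<n. b i) * (a n - b n)\<bar> \<le> B ^ n * e"
      unfolding abs_mult using pb Suc.prems by (intro mult_mono) auto
  qed
  also have "\<dots> \<le> (n * B ^ n * e) * B + B ^ Suc n * e"
    using Suc.prems by (intro add_left_mono mult_right_mono) (auto intro!: power_increasing)
  also have "\<dots> = Suc n * B ^ Suc n * e" by (simp add: algebra_simps)
  finally show ?case .
qed simp

lemma det_n_diff_bound:
  assumes "\<And>i j. i < n \<Longrightarrow> j < n \<Longrightarrow> \<bar>A i j\<bar> \<le> C" "\<And>i j. i < n \<Longrightarrow> j < n \<Longrightarrow> \<bar>B i j\<bar> \<le> C"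
    "\<And>i j. i < n \<Longrightarrow> j < n \<Longrightarrow> \<bar>A i j - B i j\<bar> \<le> e" "C \<ge> 1" "e \<ge> 0"
  shows "\<bar>det_n n A - det_n n B\<bar> \<le> fact n * (n * C ^ n * e)"
proof -
  have "det_n n A - det_n n B = (\<Sum>\<sigma> | \<sigma> permutes {..<n}. of_int (sign \<sigma>) * ((\<Prod>i<n. A i (\<sigma> i)) - (\<Prod>i<n. B i (\<sigma> i))))"
    unfolding det_n_def by (simp add: sum_subtractf[symmetric] right_diff_distrib)
  also have "\<bar>\<dots>\<bar> \<le> (\<Sum>\<sigma> | \<sigma> permutes {..<n}. n * C ^ n * e)"
  proof (rule order_trans[OF sum_abs sum_mono])
    fix \<sigma> assume "\<sigma> \<in> {\<sigma>. \<sigma> permutes {..<n}}"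
    then have \<sigma>: "\<sigma> i < n" if "i < n" for i using that permutes_in_image by fastforce
    have "\<bar>of_int (sign \<sigma>) * ((\<Prod>i<n. A i (\<sigma> i)) - (\<Prod>i<n. B i (\<sigma> i)))\<bar> = \<bar>(\<Prod>i<n. A i (\<sigma> i)) - (\<Prod>i<n. B i (\<sigma> i))\<bar>"
      unfolding abs_mult by (simp add: sign_def)
    also have "\<dots> \<le> n * C ^ n * e" by (rule prod_diff_bound) (use assms \<sigma> in auto)
    finally show "\<bar>of_int (sign \<sigma>) * ((\<Prod>i<n. A i (\<sigma> i)) - (\<Prod>i<n. B i (\<sigma> i)))\<bar> \<le> n * C ^ n * e" .
  qed
  also have "\<dots> = fact n * (n * C ^ n * e)" by (simp add: card_permutations[of "{..<n}" n])
  finally show ?thesis .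
qed

text \<open>Rounding to denominator q moves a determinant by at most (d+1)! (d+1) (H+1)^(d+1) / q,
  where H is \<open>real_bound T d\<close>. For this q that is 1/(H+1), less than the lower bound
  1/H on its absolute value, so the sign survives.\<close>

definition grid_den :: "nat \<Rightarrow> nat \<Rightarrow> nat" where
  "grid_den T d = fact (Suc d) * Suc d * (real_bound T d + 1) ^ (d + 2)"

lemma grid_den_pos: "grid_den T d > 0"
  by (simp add: grid_den_def)

theorem grid_realization:
  fixes P :: "nat \<Rightarrow> point"
  shows "\<exists>z :: nat \<Rightarrow> nat \<Rightarrow> int. (\<forall>l<T. \<forall>k<d. \<bar>z l k\<bar> \<le> int (real_bound T d * grid_den T d)) \<and>
    (\<forall>\<tau>. (\<forall>i\<le>d. \<tau> i < T) \<longrightarrow> orientation d (\<lambda>i. P (\<tau> i)) \<noteq> 0 \<longrightarrow>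
       orientation d (\<lambda>i k. of_int (z (\<tau> i) k) / grid_den T d) = orientation d (\<lambda>i. P (\<tau> i)))"
proof -
  let ?H = "real_bound T d" and ?q = "grid_den T d"
  have q0: "real ?q > 0" using grid_den_pos by simp
  obtain P' :: "nat \<Rightarrow> point" where P': "\<And>l k. l < T \<Longrightarrow> k < d \<Longrightarrow> \<bar>P' l k\<bar> \<le> ?H"
    "\<And>\<tau>. (\<forall>i\<le>d. \<tau> i < T) \<Longrightarrow> hdet d (\<lambda>i. P (\<tau> i)) \<noteq> 0 \<Longrightarrow>
       sgn (hdet d (\<lambda>i. P' (\<tau> i))) = sgn (hdet d (\<lambda>i. P (\<tau> i))) \<and> ?H * \<bar>hdet d (\<lambda>i. P' (\<tau> i))\<bar> \<ge> 1"
    using bounded_realization[of T d P] by blast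
  define z where "z l k = \<lfloor>P' l k * ?q\<rfloor>" for l k
  define P'' where "P'' l k = of_int (z l k) / real ?q" for l k
  have zb: "\<bar>z l k\<bar> \<le> int (?H * ?q)" if "l < T" "k < d" for l k
  proof -
    have "P' l k \<le> ?H" "- P' l k \<le> ?H" using P'(1)[OF that] by auto
    then have "P' l k * ?q \<le> real (?H * ?q)" "- (P' l k) * ?q \<le> real (?H * ?q)"
      unfolding of_nat_mult by (intro mult_right_mono; simp)+
    then have "P' l k * ?q \<le> of_int (int (?H * ?q))" "of_int (- int (?H * ?q)) \<le> P' l k * ?q" by auto
    then have "z l k \<le> int (?H * ?q)" "- int (?H * ?q) \<le> z l k"
      unfolding z_def by (metis floor_mono floor_of_int)+
    then show ?thesis by linarith
  qed
  have diff: "\<bar>P' l k - P'' l k\<bar> \<le> 1 / ?q" for l k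
  proof -
    have "\<bar>P' l k * ?q - of_int (z l k)\<bar> \<le> 1" unfolding z_def by linarith
    moreover have "P' l k - P'' l k = (P' l k * ?q - of_int (z l k)) / ?q"
      unfolding P''_def using q0 by (simp add: field_simps)
    ultimately show ?thesis using q0 by (simp add: abs_div divide_right_mono)
  qed
  have "orientation d (\<lambda>i. P'' (\<tau> i)) = orientation d (\<lambda>i. P (\<tau> i))"
    if \<tau>: "\<forall>i\<le>d. \<tau> i < T" and nz: "orientation d (\<lambda>i. P (\<tau> i)) \<noteq> 0" for \<tau>
  proof -
    let ?D' = "hdet d (\<lambda>i. P' (\<tau> i))" and ?D'' = "hdet d (\<lambda>i. P'' (\<tau> i))"
    have nz': "hdet d (\<lambda>i. P (\<tau> i)) \<noteq> 0" using nz by (simp add: orientation_eq sgn_0_0)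
    have b1: "\<bar>P' l k\<bar> \<le> real ?H + 1" "\<bar>P'' l k\<bar> \<le> real ?H + 1" if "l < T" "k < d" for l k
    proof -
      show "\<bar>P' l k\<bar> \<le> real ?H + 1" using P'(1)[OF that] by simp
      have "real_of_int \<bar>z l k\<bar> \<le> real_of_int (int (?H * ?q))" using zb[OF that] by (simp only: of_int_le_iff)
      then have "\<bar>P'' l k\<bar> \<le> ?H" unfolding P''_def using q0 by (simp add: field_simps)
      then show "\<bar>P'' l k\<bar> \<le> real ?H + 1" by simp
    qed
    have "\<bar>?D' - ?D''\<bar> \<le> fact (Suc d) * (Suc d * (real ?H + 1) ^ Suc d * (1 / ?q))"
      unfolding hdet_def
      by (rule det_n_diff_bound) (use \<tau> b1 diff in \<open>auto simp: less_Suc_eq_le\<close>)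
    also have "\<dots> = 1 / (real ?H + 1)"
    proof -
      define F where "F = fact (Suc d) * real (Suc d)"
      define a where "a = real ?H + 1"
      have "real ?q = F * a ^ (d + 2)" unfolding grid_den_def F_def a_def
        by (simp only: of_nat_mult of_nat_power of_nat_add of_nat_1 of_nat_fact)
      then have "fact (Suc d) * (Suc d * (real ?H + 1) ^ Suc d * (1 / ?q)) = (F * a ^ Suc d) / (F * a ^ (d + 2))"
        unfolding F_def a_def by simp
      also have "\<dots> = 1 / a"
      proof -
        have "F \<noteq> 0" "a \<noteq> 0" unfolding F_def a_def by (simp_all del: fact_Suc of_nat_Suc)
        then show ?thesis by (simp add: power_add)
      qed
      finally show ?thesis unfolding a_def .
    qed
    finally have df: "\<bar>?D' - ?D''\<bar> \<le> 1 / (real ?H + 1)" .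
    have H0: "real ?H > 0" using real_bound_pos by simp
    have "1 / real ?H \<le> \<bar>?D'\<bar>" using P'(2)[OF \<tau> nz'] H0 by (simp add: field_simps)
    moreover have "1 / (real ?H + 1) < 1 / real ?H" using H0 by (intro divide_strict_left_mono) auto
    ultimately have "\<bar>?D' - ?D''\<bar> < \<bar>?D'\<bar>" using df by linarith
    then have "sgn ?D'' = sgn ?D'" by (auto simp: sgn_real_def abs_if split: if_splits)
    then show ?thesis using P'(2)[OF \<tau> nz'] by (simp add: orientation_eq)
  qed
  then have "\<forall>\<tau>. (\<forall>i\<le>d. \<tau> i < T) \<longrightarrow> orientation d (\<lambda>i. P (\<tau> i)) \<noteq> 0 \<longrightarrow>
       orientation d (\<lambda>i k. of_int (z (\<tau> i) k) / ?q) = orientation d (\<lambda>i. P (\<tau> i))"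
    unfolding P''_def by blast
  then show ?thesis using zb by blast
qed

subsection \<open>Approximation of a finite set by a bounded sample\<close>

text \<open>Only linear half-spaces; affine ones arise from u = \<open>hat\<close>, whose entry 0 is
  constantly 1.\<close>

definition halfspace_traces :: "'k set \<Rightarrow> ('i \<Rightarrow> 'k \<Rightarrow> real) \<Rightarrow> 'i set \<Rightarrow> 'i set set" where
  "halfspace_traces K u I = range (\<lambda>w. {i\<in>I. (\<Sum>k\<in>K. w k * u i k) > 0})"

lemma finite_halfspace_traces: "finite I \<Longrightarrow> finite (halfspace_traces K u I)"
  by (rule finite_subset[of _ "Pow I"]) (auto simp: halfspace_traces_def)

text \<open>A trace on I that extends to v in both ways is also cut out by a functional vanishing at v, which has one degree of freedom less.\<close>

lemma card_halfspace_traces: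
  assumes "finite I" "finite K"
  shows "card (halfspace_traces K u I) \<le> (card I + 1) ^ card K"
  using assms
proof (induction I arbitrary: K u rule: finite_induct)
  case empty
  have "halfspace_traces K u {} = {{}}" by (auto simp: halfspace_traces_def)
  then show ?case by simp
next
  case (insert v I)
  let ?n = "card I"
  let ?f = "\<lambda>w i. \<Sum>k\<in>K. w k * u i k"
  define B where "B = halfspace_traces K u (insert v I)"
  \<comment> \<open>Deleting v is injective on \<open>B1\<close> and on \<open>B2\<close>
    separately; \<open>B2\<close> consists of the traces containing v that remain traces without
    it.\<close>
  define B1 where "B1 = {T\<in>B. v \<notin> T \<or> T - {v} \<notin> B}"
  define B2 where "B2 = {T\<in>B. v \<in> T \<and> T - {v} \<in> B}"
  have finB: "finite B" unfolding B_def using insert by (intro finite_halfspace_traces) auto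
  have B12: "B = B1 \<union> B2" unfolding B1_def B2_def by auto
  have c1: "card B1 \<le> (?n + 1) ^ card K"
  proof -
    have inj: "inj_on (\<lambda>T. T - {v}) B1"
    proof (rule inj_onI)
      fix T T' assume *: "T \<in> B1" "T' \<in> B1" "T - {v} = T' - {v}"
      then show "T = T'" unfolding B1_def
        by (cases "v \<in> T"; cases "v \<in> T'") (auto simp: insert_absorb dest: Diff_insert_absorb)
    qed
    have "(\<lambda>T. T - {v}) ` B1 \<subseteq> halfspace_traces K u I"
      using insert.hyps(2) unfolding B1_def B_def halfspace_traces_def by auto
    then have "card B1 \<le> card (halfspace_traces K u I)"
      using card_inj_on_le[OF inj _ finite_halfspace_traces[OF insert.hyps(1)]] by blast
    also have "\<dots> \<le> (?n + 1) ^ card K" by (rule insert.IH[OF insert.prems])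
    finally show ?thesis .
  qed
  show ?case
  proof (cases "\<exists>k\<in>K. u v k \<noteq> 0")
    case False
    then have "?f w v = 0" for w by simp
    then have "B2 = {}" unfolding B2_def B_def halfspace_traces_def by auto
    then have "card B \<le> (?n + 1) ^ card K" using c1 B12 by simp
    also have "\<dots> \<le> (?n + 2) ^ card K" by (rule power_mono) auto
    finally show ?thesis using insert.hyps unfolding B_def by simp
  next
    case True
    then obtain k0 where k0: "k0 \<in> K" "u v k0 \<noteq> 0" by blast
    let ?K = "K - {k0}"
    \<comment> \<open>Solving the condition of vanishing at v for the coefficient of k0 leaves a
      functional in the other coordinates, on these modified vectors.\<close>
    define u' where "u' i j = u i j - u i k0 * u v j / u v k0" for i j
    have cK: "card K = Suc (card ?K)" using k0 insert.prems by (metis card.remove)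
    have c2: "card B2 \<le> (?n + 1) ^ card ?K"
    proof -
      have inj: "inj_on (\<lambda>T. T - {v}) B2" unfolding B2_def by (auto intro!: inj_onI)
      have "(\<lambda>T. T - {v}) ` B2 \<subseteq> halfspace_traces ?K u' I"
      proof clarify
        fix T assume "T \<in> B2"
        then obtain w1 w2 where w1: "T = {i\<in>insert v I. ?f w1 i > 0}" and w2: "T - {v} = {i\<in>insert v I. ?f w2 i > 0}"
          and v: "v \<in> T" unfolding B2_def B_def halfspace_traces_def by auto
        \<comment> \<open>Weights for which \<open>a * w1 + b * w2\<close> vanishes at v. They are
          nonnegative because w1 is positive and w2 nonpositive at v, so the common trace of w1 and
          w2 on I is kept.\<close>
        define a b where "a = - ?f w2 v" and "b = ?f w1 v"
        have b: "b > 0" using v unfolding w1 b_def by simp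
        have a: "a \<ge> 0"
        proof -
          have "v \<notin> {i\<in>insert v I. ?f w2 i > 0}" using w2 by blast
          then show ?thesis unfolding a_def by simp
        qed
        define w where "w k = a * w1 k + b * w2 k" for k
        have fw: "?f w i = a * ?f w1 i + b * ?f w2 i" for i
          unfolding w_def by (simp add: sum_distrib_left sum.distrib algebra_simps)
        have v0: "?f w v = 0" unfolding fw a_def b_def by simp
        have split: "?f w i = w k0 * u i k0 + (\<Sum>k\<in>?K. w k * u i k)" for i
          using sum.remove[OF insert.prems k0(1)] .
        have f': "(\<Sum>k\<in>?K. w k * u' i k) = ?f w i" for i
        proof -
          have "(\<Sum>k\<in>?K. w k * u' i k) = (\<Sum>k\<in>?K. w k * u i k) - u i k0 / u v k0 * (\<Sum>k\<in>?K. w k * u v k)"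
            unfolding u'_def by (simp add: sum_distrib_left sum_subtractf algebra_simps)
          also have "(\<Sum>k\<in>?K. w k * u v k) = - w k0 * u v k0" using split[of v] v0 by simp
          finally show ?thesis unfolding split[of i] using k0(2) by simp
        qed
        have "i \<in> T \<longleftrightarrow> ?f w i > 0" if "i \<in> I" for i
        proof -
          have "i \<noteq> v" using that insert.hyps by blast
          then have e: "?f w1 i > 0 \<longleftrightarrow> ?f w2 i > 0" "i \<in> T \<longleftrightarrow> ?f w1 i > 0" using w1 w2 that by auto
          show ?thesis
          proof (cases "i \<in> T")
            case True
            then have "a * ?f w1 i \<ge> 0" "b * ?f w2 i > 0" using e a b by auto
            then show ?thesis using True unfolding fw by linarith
          next
            case False
            then have "a * ?f w1 i \<le> 0" "b * ?f w2 i \<le> 0" using e a b by (auto simp: mult_le_0_iff)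
            then show ?thesis using False unfolding fw by linarith
          qed
        qed
        then have "T - {v} = {i\<in>I. (\<Sum>k\<in>?K. w k * u' i k) > 0}"
          unfolding f' using w1 insert.hyps by auto
        then show "T - {v} \<in> halfspace_traces ?K u' I" unfolding halfspace_traces_def by blast
      qed
      then have "card B2 \<le> card (halfspace_traces ?K u' I)"
        using card_inj_on_le[OF inj _ finite_halfspace_traces[OF insert.hyps(1)]] by blast
      also have "\<dots> \<le> (?n + 1) ^ card ?K" using insert.IH[of ?K u'] insert.prems by simp
      finally show ?thesis .
    qed
    have "card B \<le> card B1 + card B2" unfolding B12 by (rule card_Un_le)
    also have "\<dots> \<le> (?n + 1) ^ card K + (?n + 1) ^ card ?K" using c1 c2 by simp
    also have "\<dots> = (?n + 2) * (?n + 1) ^ card ?K" unfolding cK by simp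
    also have "\<dots> \<le> (?n + 2) * (?n + 2) ^ card ?K" by (intro mult_left_mono power_mono) auto
    finally show ?thesis using insert.hyps unfolding B_def cK by simp
  qed
qed

definition polytope_family :: "'k set \<Rightarrow> ('i \<Rightarrow> 'k \<Rightarrow> real) \<Rightarrow> 'j set \<Rightarrow> 'i set set" where
  "polytope_family K u J = range (\<lambda>w. {i. \<forall>l\<in>J. (\<Sum>k\<in>K. w l k * u i k) > 0})"

text \<open>The trace of a polytope is determined by the traces of its half-spaces, one for each
  index in J.\<close>

lemma card_polytope_traces:
  assumes "finite I" "finite K" "finite J"
  shows "card ((\<lambda>T. T \<inter> I) ` polytope_family K u J) \<le> (card I + 1) ^ (card K * card J)"
proof -
  let ?H = "halfspace_traces K u I"
  have "(\<lambda>T. T \<inter> I) ` polytope_family K u J \<subseteq> (\<lambda>t. {i\<in>I. \<forall>l\<in>J. i \<in> t l}) ` (J \<rightarrow>\<^sub>E ?H)"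
  proof clarify
    fix T assume "T \<in> polytope_family K u J"
    then obtain w where T: "T = {i. \<forall>l\<in>J. (\<Sum>k\<in>K. w l k * u i k) > 0}" unfolding polytope_family_def by blast
    define t where "t = (\<lambda>l\<in>J. {i\<in>I. (\<Sum>k\<in>K. w l k * u i k) > 0})"
    have "t \<in> J \<rightarrow>\<^sub>E ?H" unfolding t_def halfspace_traces_def by auto
    moreover have "T \<inter> I = {i\<in>I. \<forall>l\<in>J. i \<in> t l}" unfolding T t_def by auto
    ultimately show "T \<inter> I \<in> (\<lambda>t. {i\<in>I. \<forall>l\<in>J. i \<in> t l}) ` (J \<rightarrow>\<^sub>E ?H)" by blast
  qed
  then have "card ((\<lambda>T. T \<inter> I) ` polytope_family K u J) \<le> card (J \<rightarrow>\<^sub>E ?H)"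
    by (rule surj_card_le[rotated]) (intro finite_PiE assms finite_halfspace_traces)
  also have "\<dots> = card ?H ^ card J" by (rule card_funcsetE[OF assms(3)])
  also have "\<dots> \<le> ((card I + 1) ^ card K) ^ card J" by (intro power_mono card_halfspace_traces assms) auto
  finally show ?thesis by (simp add: power_mult)
qed

section \<open>Halving with an exponential potential\<close>

lemma exp_add_exp_minus_le:
  fixes x :: real
  assumes "\<bar>x\<bar> \<le> 1"
  shows "exp x + exp (-x) \<le> 2 * (1 + x\<^sup>2)"
proof -
  have "exp x + exp (-x) \<le> 2 * (1 + x\<^sup>2)" if "0 \<le> x" "x \<le> 1" for x :: real
  proof -
    have "(1 + x) * (1 - x + x\<^sup>2) = 1 + x ^ 3" by (simp add: algebra_simps power2_eq_square power3_eq_cube)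
    then have "1 \<le> (1 + x) * (1 - x + x\<^sup>2)" using that by simp
    also have "\<dots> \<le> exp x * (1 - x + x\<^sup>2)"
    proof (rule mult_right_mono)
      show "0 \<le> 1 - x + x\<^sup>2" using that by simp
    qed (rule exp_ge_add_one_self)
    finally have "exp (-x) \<le> 1 - x + x\<^sup>2" by (simp add: exp_minus field_simps)
    then show ?thesis using exp_bound[OF that] by simp
  qed
  from this[of x] this[of "-x"] assms show ?thesis by (cases "x \<ge> 0") auto
qed

text \<open>Derandomised random signs: averaged over the two choices of the next sign, the potential
  grows by a factor of at most 1 + t^2, because cosh x <= 1 + x^2 for |x| <= 1; so one of the
  choices does no worse.\<close>

lemma greedy_signs:
  fixes v :: "nat \<Rightarrow> 't \<Rightarrow> real" and t :: real
  assumes "finite F" "\<And>i T. \<bar>v i T\<bar> \<le> 1" "0 \<le> t" "t \<le> 1"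
  shows "\<exists>\<sigma>. (\<forall>i. \<sigma> i = 1 \<or> \<sigma> i = -1) \<and>
    (\<Sum>T\<in>F. exp (t * (\<Sum>i<k. \<sigma> i * v i T))) \<le> card F * (1 + t\<^sup>2) ^ k"
proof (induction k)
  case 0
  show ?case by (intro exI[of _ "\<lambda>_. 1"]) simp
next
  case (Suc k)
  then obtain \<sigma> where \<sigma>: "\<forall>i. \<sigma> i = 1 \<or> \<sigma> i = (-1::real)"
    "(\<Sum>T\<in>F. exp (t * (\<Sum>i<k. \<sigma> i * v i T))) \<le> card F * (1 + t\<^sup>2) ^ k" by blast
  let ?s = "\<lambda>T. \<Sum>i<k. \<sigma> i * v i T"
  let ?P = "\<lambda>e. \<Sum>T\<in>F. exp (t * (?s T + e * v k T))"
  have "?P 1 + ?P (-1) = (\<Sum>T\<in>F. exp (t * ?s T) * (exp (t * v k T) + exp (- (t * v k T))))"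
    by (simp add: sum.distrib[symmetric] exp_add[symmetric] algebra_simps)
  also have "\<dots> \<le> (\<Sum>T\<in>F. exp (t * ?s T) * (2 * (1 + t\<^sup>2)))"
  proof (intro sum_mono mult_left_mono)
    fix T
    have tv: "\<bar>t * v k T\<bar> \<le> t" unfolding abs_mult using assms(2)[of k T] assms(3)
      by (simp add: mult_left_le)
    then have "exp (t * v k T) + exp (- (t * v k T)) \<le> 2 * (1 + (t * v k T)\<^sup>2)"
      using assms(4) by (intro exp_add_exp_minus_le) linarith
    also have "(t * v k T)\<^sup>2 \<le> t\<^sup>2" using tv assms(3) by (simp add: abs_le_square_iff[symmetric])
    finally show "exp (t * v k T) + exp (- (t * v k T)) \<le> 2 * (1 + t\<^sup>2)" by simp
  qed simp
  also have "\<dots> = (\<Sum>T\<in>F. exp (t * ?s T)) * (2 * (1 + t\<^sup>2))" by (simp only: sum_distrib_right)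
  also have "\<dots> \<le> (card F * (1 + t\<^sup>2) ^ k) * (2 * (1 + t\<^sup>2))"
    by (rule mult_right_mono[OF \<sigma>(2)]) simp
  finally have "?P 1 \<le> card F * (1 + t\<^sup>2) ^ Suc k \<or> ?P (-1) \<le> card F * (1 + t\<^sup>2) ^ Suc k"
    by (simp add: algebra_simps) linarith
  then obtain e where e: "e = 1 \<or> e = -1" "?P e \<le> card F * (1 + t\<^sup>2) ^ Suc k" by blast
  have "(\<Sum>i<Suc k. (\<sigma>(k := e)) i * v i T) = ?s T + e * v k T" for T by simp
  then show ?case using \<sigma>(1) e by (intro exI[of _ "\<sigma>(k := e)"]) auto
qed

text \<open>X is split into pairs and one element of each is kept; the sign decides which. The
  excess of T over half its size is at most half a signed sum, and the potential controls all these
  sums at once. Only the excess is bounded, which is the direction needed for sampling.\<close>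

lemma halving:
  fixes X :: "'i set"
  assumes fin: "finite X" and k: "k = card X div 2" "k \<ge> 1"
    and growth: "card ((\<lambda>T. T \<inter> X) ` \<G>) \<le> c" "c \<ge> 1"
  shows "\<exists>X'\<subseteq>X. card X' = k \<and>
    (\<forall>T\<in>\<G>. real (card (T \<inter> X')) \<le> card (T \<inter> X) / 2 + sqrt k * (ln c + 1) / 2)"
proof -
  obtain e where e: "bij_betw e {0..<card X} X" using ex_bij_betw_nat_finite[OF fin] by blast
  have eX: "e i \<in> X" if "i < card X" for i using bij_betwE[OF e] that by auto
  have einj: "e i = e j \<longleftrightarrow> i = j" if "i < card X" "j < card X" for i j
    using bij_betw_imp_inj_on[OF e] that by (auto simp: inj_on_def)
  define F where "F = (\<lambda>T. T \<inter> X) ` \<G>"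
  have finF: "finite F" by (rule finite_subset[of _ "Pow X"]) (use fin in \<open>auto simp: F_def\<close>)
  define ind where "ind T x = (if x \<in> T then 1 else 0 :: real)" for T :: "'i set" and x
  have ind_sum: "(\<Sum>x\<in>Y. ind T x) = card (T \<inter> Y)" if "finite Y" for T Y
  proof -
    have "Y \<inter> {x. x \<in> T} = T \<inter> Y" by auto
    then show ?thesis unfolding ind_def using that by (simp add: sum.If_cases)
  qed
  define v where "v i T = ind T (e (2*i)) - ind T (e (2*i+1))" for i T
  \<comment> \<open>This t keeps (1 + t^2)^k at most e, so that t times a signed sum is at most ln c
    + 1.\<close>
  define t where "t = 1 / sqrt k"
  have t: "0 < t" "t \<le> 1" "t\<^sup>2 = 1 / k" using k(2) unfolding t_def by (auto simp: power_divide)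
  have v1: "\<bar>v i T\<bar> \<le> 1" for i T unfolding v_def ind_def by auto
  from greedy_signs[OF finF, where v = v and t = t and k = k] v1 t obtain \<sigma> where \<sigma>: "\<forall>i. \<sigma> i = 1 \<or> \<sigma> i = (-1::real)"
    "(\<Sum>T\<in>F. exp (t * (\<Sum>i<k. \<sigma> i * v i T))) \<le> card F * (1 + t\<^sup>2) ^ k" by auto
  define g where "g i = (if \<sigma> i = 1 then 2 * i else 2 * i + 1)" for i
  have g2: "g i div 2 = i" for i unfolding g_def by simp
  have gb: "g i < card X" if "i < k" for i using that k(1) unfolding g_def by auto
  define X' where "X' = (\<lambda>i. e (g i)) ` {..<k}"
  have inj: "inj_on (\<lambda>i. e (g i)) {..<k}"
    by (rule inj_onI) (metis einj gb g2 lessThan_iff)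
  have "X' \<subseteq> X" unfolding X'_def using gb eX by auto
  moreover have "card X' = k" unfolding X'_def using card_image[OF inj] by simp
  moreover have "real (card (T \<inter> X')) \<le> card (T \<inter> X) / 2 + sqrt k * (ln c + 1) / 2" if T: "T \<in> \<G>" for T
  proof -
    let ?T = "T \<inter> X"
    let ?s = "\<Sum>i<k. \<sigma> i * v i ?T"
    have TF: "?T \<in> F" unfolding F_def using T by blast
    have "exp (t * ?s) \<le> (\<Sum>T\<in>F. exp (t * (\<Sum>i<k. \<sigma> i * v i T)))"
      by (rule member_le_sum[OF TF]) (use finF in auto)
    also have "\<dots> \<le> card F * (1 + t\<^sup>2) ^ k" by (rule \<sigma>(2))
    also have "\<dots> \<le> c * exp (t\<^sup>2) ^ k"
      using growth(1) unfolding F_def by (intro mult_mono power_mono exp_ge_add_one_self) auto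
    also have "\<dots> = exp (ln c) * exp 1" using growth(2) t(3) k(2) by (simp add: exp_of_nat_mult[symmetric])
    finally have "t * ?s \<le> ln c + 1" by (simp add: exp_add[symmetric])
    then have s: "?s \<le> sqrt k * (ln c + 1)" using k(2) unfolding t_def by (simp add: field_simps)
    have "real (card (T \<inter> X')) = real (card (?T \<inter> X'))" using \<open>X' \<subseteq> X\<close> by (simp add: Int_assoc Int_absorb1)
    also have "\<dots> = (\<Sum>x\<in>X'. ind ?T x)"
      by (rule ind_sum[symmetric]) (simp add: X'_def)
    also have "\<dots> = (\<Sum>i<k. ind ?T (e (g i)))" unfolding X'_def by (simp add: sum.reindex[OF inj])
    also have "\<dots> = (\<Sum>i<k. (ind ?T (e (2*i)) + ind ?T (e (2*i+1))) / 2 + \<sigma> i * v i ?T / 2)"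
    proof (rule sum.cong[OF refl])
      fix i
      show "ind ?T (e (g i)) = (ind ?T (e (2*i)) + ind ?T (e (2*i+1))) / 2 + \<sigma> i * v i ?T / 2"
        using \<sigma>(1)[rule_format, of i] unfolding g_def v_def by (auto simp: field_simps)
    qed
    also have "\<dots> = (\<Sum>i<k. ind ?T (e (2*i)) + ind ?T (e (2*i+1))) / 2 + ?s / 2"
      by (simp add: sum.distrib sum_divide_distrib add_divide_distrib)
    \<comment> \<open>Only an inequality: if \<open>card X\<close> is odd, the last element belongs
      to no pair.\<close>
    also have "(\<Sum>i<k. ind ?T (e (2*i)) + ind ?T (e (2*i+1))) \<le> card ?T"
    proof -
      have "(\<Sum>i<k. ind ?T (e (2*i)) + ind ?T (e (2*i+1))) = (\<Sum>j<2*k. ind ?T (e j))"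
        by (induction k) auto
      also have "\<dots> \<le> (\<Sum>j<card X. ind ?T (e j))"
        using k(1) by (intro sum_mono2) (auto simp: ind_def)
      also have "\<dots> = (\<Sum>x\<in>X. ind ?T x)"
        using sum.reindex_bij_betw[OF e] by (simp add: lessThan_atLeast0)
      also have "\<dots> = card ?T" using ind_sum[OF fin] by (simp add: Int_assoc)
      finally show ?thesis .
    qed
    finally show ?thesis using s by (simp add: field_simps)
  qed
  ultimately show ?thesis by blast
qed

text \<open>The error of one halving is at most the increase of A / n^(1/4) as the size n drops, so
  the total telescopes. Fourth roots in place of square roots leave room for the logarithm in
  \<open>halving\<close>. Stopping at \<open>2 * N0 + 1\<close> guarantees that a halved set still
  has at least N0 elements.\<close>

lemma eps_approximation_aux:
  fixes X :: "'i set"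
  assumes growth: "\<And>X. finite X \<Longrightarrow> card ((\<lambda>T. T \<inter> X) ` \<G>) \<le> (card X + 1) ^ L"
    and N0: "N0 \<ge> 1" and A: "A = 8 * (2 * real L + 1)"
    and "finite X" "card X \<ge> N0"
  shows "\<exists>X'\<subseteq>X. X' \<noteq> {} \<and> card X' \<le> 2 * N0 + 1 \<and>
    (\<forall>T\<in>\<G>. card (T \<inter> X') / card X' \<le> card (T \<inter> X) / card X + A / sqrt (sqrt N0) - A / sqrt (sqrt (card X)))"
  using assms(4,5)
proof (induction "card X" arbitrary: X rule: less_induct)
  case less
  define n where "n = card X"
  have A0: "A > 0" using A by simp
  show ?case
  proof (cases "n \<le> 2 * N0 + 1")
    case True
    have "A / sqrt (sqrt n) \<le> A / sqrt (sqrt N0)"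
      using A0 N0 less.prems unfolding n_def by (intro divide_left_mono) auto
    then have "card (T \<inter> X) / card X \<le> card (T \<inter> X) / card X + A / sqrt (sqrt N0) - A / sqrt (sqrt (card X))" for T
      unfolding n_def by linarith
    moreover have "X \<noteq> {}" using less.prems N0 by auto
    ultimately show ?thesis using True unfolding n_def by blast
  next
    case False
    define k where "k = n div 2"
    have kn: "k \<ge> N0" "k \<ge> 1" "k < n" "2 * k \<le> n" "n \<le> 2 * k + 1" using False N0 unfolding k_def by auto
    obtain X1 where X1: "X1 \<subseteq> X" "card X1 = k"
      "\<And>T. T \<in> \<G> \<Longrightarrow> real (card (T \<inter> X1)) \<le> card (T \<inter> X) / 2 + sqrt k * (ln ((n + 1) ^ L) + 1) / 2"
      using halving[OF less.prems(1), of k \<G> "(n + 1) ^ L"] growth[OF less.prems(1)] kn(2) unfolding k_def n_def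
      by auto
    have finX1: "finite X1" using X1(1) less.prems finite_subset by blast
    obtain X' where X': "X' \<subseteq> X1" "X' \<noteq> {}" "card X' \<le> 2 * N0 + 1"
      "\<And>T. T \<in> \<G> \<Longrightarrow> card (T \<inter> X') / card X' \<le> card (T \<inter> X1) / k + A / sqrt (sqrt N0) - A / sqrt (sqrt k)"
      using less.hyps[of X1] X1(2) finX1 kn unfolding n_def by auto
    define s where "s = sqrt (sqrt k)"
    have s1: "s \<ge> 1" using kn unfolding s_def by simp
    have s2: "sqrt k = s\<^sup>2" unfolding s_def by simp
    have s4: "real k = s ^ 4" using s2 by (metis of_nat_0_le_iff power2_eq_square power4_eq_xxxx real_sqrt_pow2 mult.assoc)
    have step: "card (T \<inter> X1) / k \<le> card (T \<inter> X) / n + (A / s - A / sqrt (sqrt n))" if T: "T \<in> \<G>" for T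
    proof -
      define c where "c = real (card (T \<inter> X))"
      have cn: "c \<le> n" "c \<ge> 0" unfolding c_def n_def using less.prems by (auto intro!: card_mono)
      have k0: "real k > 0" "real n > 0" using kn by auto
      \<comment> \<open>n + 1 <= 4 s^4 with s the fourth root of k, so the logarithm is at most
        linear in s.\<close>
      have l: "ln (real n + 1) \<le> 4 * s"
      proof -
        have "real n + 1 \<le> 4 * s ^ 4" unfolding s4[symmetric] using kn by linarith
        then have "ln (real n + 1) \<le> ln (4 * s ^ 4)" using k0 by (subst ln_le_cancel_iff) (use s1 in auto)
        also have "\<dots> = ln 4 + 4 * ln s" using s1 by (simp add: ln_mult ln_realpow)
        also have "\<dots> \<le> 3 + 4 * (s - 1)" using ln_le_minus_one[of 4] ln_le_minus_one[of s] s1 by simp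
        finally show ?thesis by simp
      qed
      have "card (T \<inter> X1) / k \<le> (c / 2 + sqrt k * (ln (real ((n + 1) ^ L)) + 1) / 2) / k"
        unfolding c_def using X1(3)[OF T] k0 by (intro divide_right_mono) auto
      also have "\<dots> = c / (2 * k) + (L * ln (real n + 1) + 1) / (2 * s\<^sup>2)"
      proof -
        have "ln (real ((n + 1) ^ L)) = L * ln (real n + 1)" by (simp add: ln_realpow add.commute)
        moreover have "(c / 2 + y * z / 2) / (y * y) = c / (2 * (y * y)) + z / (2 * y)" if "y > 0" for y z
          using that by (simp add: field_simps)
        from this[of "s\<^sup>2" "L * ln (real n + 1) + 1"]
        have "(c / 2 + sqrt k * (L * ln (real n + 1) + 1) / 2) / k = c / (2 * k) + (L * ln (real n + 1) + 1) / (2 * s\<^sup>2)"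
          using s1 s2 s4 by (simp add: power2_eq_square power4_eq_xxxx mult.assoc)
        ultimately show ?thesis by simp
      qed
      also have "c / (2 * k) \<le> c / n + 1 / (2 * s)"
      proof -
        have "c / (2 * k) - c / n = (c / n) * ((n - 2 * real k) / (2 * k))" using k0 by (simp add: field_simps)
        also have "\<dots> \<le> 1 * (1 / (2 * k))"
          using cn k0 kn(4,5) by (intro mult_mono divide_right_mono) auto
        also have "\<dots> \<le> 1 / (2 * s)"
        proof -
          have "s \<le> k" using self_le_power[of s 4] s1 s4 by simp
          then show ?thesis using s1 k0 by (simp add: field_simps)
        qed
        finally show ?thesis by simp
      qed
      also have "(L * ln (real n + 1) + 1) / (2 * s\<^sup>2) \<le> (L * (4 * s) + s) / (2 * s\<^sup>2)"
        using l s1 by (intro divide_right_mono add_mono mult_left_mono) auto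
      also have "\<dots> = (4 * real L + 1) / (2 * s)" using s1 by (simp add: field_simps power2_eq_square)
      also have "c / n + 1 / (2 * s) + (4 * real L + 1) / (2 * s) = c / n + (A / 8) / s"
        using s1 A by (simp add: field_simps)
      also have "(A / 8) / s \<le> A / s - A / sqrt (sqrt n)"
      proof -
        \<comment> \<open>Since n >= 2 k and (8/7)^4 <= 2, the difference of A / s and A / n^(1/4)
          is at least an eighth of A / s; hence the factor 8 in A.\<close>
        have "(8 / 7 * s) ^ 4 \<le> 2 * s ^ 4" using s1 by (simp add: power_mult_distrib power4_eq_xxxx)
        also have "\<dots> \<le> real n" unfolding s4[symmetric] using kn by linarith
        finally have "(8 / 7 * s) ^ 4 \<le> real n" .
        then have "8 / 7 * s \<le> sqrt (sqrt n)"
          using s1 by (intro real_le_rsqrt) (simp add: power_mult[symmetric])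
        then have "A / sqrt (sqrt n) \<le> A / (8 / 7 * s)" using A0 s1 k0
          by (intro divide_left_mono) (auto intro!: mult_pos_pos)
        also have "\<dots> = A / s - A / 8 / s" by (simp add: field_simps)
        finally show ?thesis by simp
      qed
      finally show ?thesis unfolding c_def by simp
    qed
    have "card (T \<inter> X') / card X' \<le> card (T \<inter> X) / card X + A / sqrt (sqrt N0) - A / sqrt (sqrt (card X))"
      if T: "T \<in> \<G>" for T
      using X'(4)[OF T] step[OF T] unfolding s_def n_def by linarith
    moreover have "X' \<subseteq> X" using X'(1) X1(1) by (rule subset_trans)
    ultimately show ?thesis using X'(2,3) by (intro exI[of _ X'] conjI ballI)
  qed
qed

text \<open>N0 is the value for which A / N0^(1/4) with A = 8 (2 L + 1) equals 1/(2b). A set with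
  fewer than N0 elements is its own sample.\<close>

theorem eps_approximation:
  fixes X :: "'i set"
  assumes growth: "\<And>X. finite X \<Longrightarrow> card ((\<lambda>T. T \<inter> X) ` \<G>) \<le> (card X + 1) ^ L"
    and "finite X" "X \<noteq> {}" "b \<ge> 1" and N0: "N0 = (16 * b * (2 * L + 1)) ^ 4"
  shows "\<exists>X'\<subseteq>X. X' \<noteq> {} \<and> card X' \<le> 2 * N0 + 1 \<and>
    (\<forall>T\<in>\<G>. card (T \<inter> X') / card X' \<le> card (T \<inter> X) / card X + 1 / (2 * real b))"
proof (cases "card X \<ge> N0")
  case False
  then show ?thesis using assms by (intro exI[of _ X]) auto
next
  case True
  define A where "A = 8 * (2 * real L + 1)"
  have N1: "N0 \<ge> 1" using \<open>b \<ge> 1\<close> unfolding N0 by simp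
  obtain X' where X': "X' \<subseteq> X" "X' \<noteq> {}" "card X' \<le> 2 * N0 + 1"
    "\<And>T. T \<in> \<G> \<Longrightarrow> card (T \<inter> X') / card X' \<le> card (T \<inter> X) / card X + A / sqrt (sqrt N0) - A / sqrt (sqrt (card X))"
    using eps_approximation_aux[OF growth N1 A_def \<open>finite X\<close> True] by blast
  have "sqrt (sqrt N0) = 2 * b * A"
  proof -
    have "real N0 = ((2 * b * A)\<^sup>2)\<^sup>2" unfolding N0 A_def by (simp add: algebra_simps flip: power_mult)
    then have "sqrt N0 = (2 * b * A)\<^sup>2" by (simp only: real_sqrt_abs) simp
    then show ?thesis unfolding A_def by simp
  qed
  moreover have "A > 0" unfolding A_def by simp
  ultimately have e: "A / sqrt (sqrt N0) = 1 / (2 * real b)" by simp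
  have "A / sqrt (sqrt (card X)) \<ge> 0" using \<open>A > 0\<close> by simp
  then have "card (T \<inter> X') / card X' \<le> card (T \<inter> X) / card X + 1 / (2 * real b)" if "T \<in> \<G>" for T
    using X'(4)[OF that] e by linarith
  then show ?thesis using X' by blast
qed

subsection \<open>Separation of same-type families\<close>

lemma det_n_eq_det: "det_n n A = det (mat n n (\<lambda>(i,j). A i j))"
  unfolding det_n_def det_def
  by (auto simp: lessThan_atLeast0 intro!: sum.cong prod.cong)

lemma det_n_0_iff_cols:
  "det_n n A = 0 \<longleftrightarrow> (\<exists>c. (\<exists>j<n. c j \<noteq> 0) \<and> (\<forall>i<n. (\<Sum>j<n. A i j * c j) = 0))"
proof -
  let ?M = "mat n n (\<lambda>(i,j). A i j)"
  have M: "?M \<in> carrier_mat n n" by simp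
  have mv: "(?M *\<^sub>v v) $ i = (\<Sum>j<n. A i j * v $ j)" if "i < n" "v \<in> carrier_vec n" for i v
    using that by (simp add: scalar_prod_def lessThan_atLeast0)
  show ?thesis unfolding det_n_eq_det det_0_iff_vec_prod_zero_field[OF M]
  proof
    assume "\<exists>v. v \<in> carrier_vec n \<and> v \<noteq> 0\<^sub>v n \<and> ?M *\<^sub>v v = 0\<^sub>v n"
    then obtain v where v: "v \<in> carrier_vec n" "v \<noteq> 0\<^sub>v n" "?M *\<^sub>v v = 0\<^sub>v n" by blast
    have "\<exists>j<n. v $ j \<noteq> 0" using v(1,2) by (metis carrier_vecD eq_vecI index_zero_vec(1) index_zero_vec(2))
    moreover have "(\<Sum>j<n. A i j * v $ j) = 0" if "i < n" for i
      using mv[OF that v(1)] v(3) that by simp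
    ultimately show "\<exists>c. (\<exists>j<n. c j \<noteq> 0) \<and> (\<forall>i<n. (\<Sum>j<n. A i j * c j) = 0)" by blast
  next
    assume "\<exists>c. (\<exists>j<n. c j \<noteq> 0) \<and> (\<forall>i<n. (\<Sum>j<n. A i j * c j) = 0)"
    then obtain c where c: "\<exists>j<n. c j \<noteq> 0" "\<And>i. i < n \<Longrightarrow> (\<Sum>j<n. A i j * c j) = 0" by blast
    let ?v = "vec n c"
    have "?M *\<^sub>v ?v = 0\<^sub>v n"
    proof (rule eq_vecI)
      fix i assume "i < dim_vec (0\<^sub>v n)"
      then have i: "i < n" by simp
      have "(?M *\<^sub>v ?v) $ i = (\<Sum>j<n. A i j * ?v $ j)" using mv[OF i] by simp
      also have "\<dots> = (\<Sum>j<n. A i j * c j)" by (rule sum.cong) auto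
      finally show "(?M *\<^sub>v ?v) $ i = 0\<^sub>v n $ i" using c(2)[OF i] i by simp
    qed simp
    moreover have "?v \<noteq> 0\<^sub>v n" using c(1) by (metis index_vec index_zero_vec(1))
    ultimately show "\<exists>v. v \<in> carrier_vec n \<and> v \<noteq> 0\<^sub>v n \<and> ?M *\<^sub>v v = 0\<^sub>v n" by (intro exI[of _ ?v]) auto
  qed
qed

lemma det_n_transpose: "det_n n (\<lambda>i j. A j i) = det_n n A"
proof -
  have "mat n n (\<lambda>(i,j). A j i) = transpose_mat (mat n n (\<lambda>(i,j). A i j))" by auto
  then show ?thesis unfolding det_n_eq_det by (metis det_transpose mat_carrier)
qed

lemma det_n_0_iff_rows:
  "det_n n A = 0 \<longleftrightarrow> (\<exists>c. (\<exists>i<n. c i \<noteq> 0) \<and> (\<forall>j<n. (\<Sum>i<n. c i * A i j) = 0))"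
  using det_n_0_iff_cols[of n "\<lambda>i j. A j i"] det_n_transpose[of n A] by (simp add: mult.commute)

lemma det_n_row_linear:
  assumes "i < n"
  shows "det_n n (A(i := \<lambda>j. a * x j + b * y j)) = a * det_n n (A(i := x)) + b * det_n n (A(i := y))"
proof -
  have p: "(\<Prod>l<n. (A(i := r)) l (\<sigma> l)) = r (\<sigma> i) * (\<Prod>l\<in>{..<n} - {i}. A l (\<sigma> l))" for r \<sigma>
  proof -
    have "(\<Prod>l<n. (A(i := r)) l (\<sigma> l)) = (A(i := r)) i (\<sigma> i) * (\<Prod>l\<in>{..<n} - {i}. (A(i := r)) l (\<sigma> l))"
      using assms by (intro prod.remove) auto
    also have "(\<Prod>l\<in>{..<n} - {i}. (A(i := r)) l (\<sigma> l)) = (\<Prod>l\<in>{..<n} - {i}. A l (\<sigma> l))"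
      by (rule prod.cong) auto
    finally show ?thesis by simp
  qed
  show ?thesis unfolding det_n_def p by (simp add: sum_distrib_left sum.distrib[symmetric] algebra_simps)
qed

text \<open>The condition a > 0 keeps the empty combination out: 0 lies in the cone only through a
  nontrivial nonnegative dependence.\<close>

inductive_set cone :: "('k \<Rightarrow> real) set \<Rightarrow> ('k \<Rightarrow> real) set" for V where
  cone_base: "v \<in> V \<Longrightarrow> v \<in> cone V"
| cone_comb: "x \<in> cone V \<Longrightarrow> y \<in> cone V \<Longrightarrow> a > 0 \<Longrightarrow> b \<ge> 0 \<Longrightarrow> (\<lambda>k. a * x k + b * y k) \<in> cone V"

lemma cone_subset:
  assumes "V' \<subseteq> cone V" "x \<in> cone V'" shows "x \<in> cone V"
  using assms(2) by induction (use assms(1) cone.intros in blast)+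

lemma ex_between_finite:
  fixes A B :: "real set"
  assumes "finite A" "finite B" "\<And>a b. a \<in> A \<Longrightarrow> b \<in> B \<Longrightarrow> a < b"
  shows "\<exists>t. (\<forall>a\<in>A. a < t) \<and> (\<forall>b\<in>B. t < b)"
proof -
  consider "A = {}" | "B = {}" | "A \<noteq> {}" "B \<noteq> {}" by blast
  then show ?thesis
  proof cases
    case 1
    then show ?thesis using Min_le[OF assms(2)]
      by (intro exI[of _ "Min B - 1"]) (auto, smt (verit))
  next
    case 2
    then show ?thesis using Max_ge[OF assms(1)]
      by (intro exI[of _ "Max A + 1"]) (auto, smt (verit))
  next
    case 3
    then have "Max A < Min B" using assms by (simp add: Max_less_iff Min_gr_iff)
    then obtain t where "Max A < t" "t < Min B" using dense by blast
    then show ?thesis using Max_ge[OF assms(1)] Min_le[OF assms(2)] by (meson le_less_trans less_le_trans)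
  qed
qed

text \<open>Fourier-Motzkin elimination of the coordinate k0.\<close>

theorem gordan:
  fixes V :: "('k \<Rightarrow> real) set"
  assumes "finite K" "finite V"
  shows "(\<exists>w. \<forall>v\<in>V. (\<Sum>k\<in>K. w k * v k) > 0) \<or> (\<exists>x\<in>cone V. \<forall>k\<in>K. x k = 0)"
  using assms
proof (induction K arbitrary: V rule: finite_induct)
  case empty
  then show ?case by (cases "V = {}") (auto intro: cone_base)
next
  case (insert k0 K)
  define P where "P = {v\<in>V. v k0 > 0}"
  define N where "N = {v\<in>V. v k0 < 0}"
  define comb where "comb p n = (\<lambda>k. (- n k0) * p k + p k0 * n k)" for p n :: "'k \<Rightarrow> real"
  define V' where "V' = {v\<in>V. v k0 = 0} \<union> (\<lambda>(p,n). comb p n) ` (P \<times> N)"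
  have fin: "finite P" "finite N" "finite V'" unfolding P_def N_def V'_def using insert.prems by auto
  have V'V: "V' \<subseteq> cone V"
  proof
    fix v assume "v \<in> V'"
    then consider "v \<in> V" | p n where "p \<in> P" "n \<in> N" "v = comb p n" unfolding V'_def by auto
    then show "v \<in> cone V"
    proof cases
      case 2
      have "comb p n \<in> cone V" unfolding comb_def
        by (rule cone_comb) (use 2 in \<open>auto simp: P_def N_def intro: cone_base\<close>)
      then show ?thesis using 2 by simp
    qed (rule cone_base)
  qed
  have V'0: "v k0 = 0" if "v \<in> cone V'" for v
    using that by induction (auto simp: V'_def comb_def)
  from insert.IH[OF fin(3)] show ?case
  proof
    assume "\<exists>x\<in>cone V'. \<forall>k\<in>K. x k = 0"
    then obtain x where "x \<in> cone V'" "\<forall>k\<in>K. x k = 0" by blast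
    then have "x \<in> cone V" "\<forall>k\<in>insert k0 K. x k = 0" using V'0 cone_subset[OF V'V] by auto
    then show ?thesis by blast
  next
    assume "\<exists>w. \<forall>v\<in>V'. (\<Sum>k\<in>K. w k * v k) > 0"
    then obtain w where w: "\<And>v. v \<in> V' \<Longrightarrow> (\<Sum>k\<in>K. w k * v k) > 0" by blast
    let ?f = "\<lambda>v. \<Sum>k\<in>K. w k * v k"
    have "\<exists>t. (\<forall>a\<in>(\<lambda>p. - ?f p / p k0) ` P. a < t) \<and> (\<forall>b\<in>(\<lambda>n. ?f n / (- n k0)) ` N. t < b)"
    proof (rule ex_between_finite)
      fix a b assume "a \<in> (\<lambda>p. - ?f p / p k0) ` P" "b \<in> (\<lambda>n. ?f n / (- n k0)) ` N"
      then obtain p n where pn: "p \<in> P" "n \<in> N" "a = - ?f p / p k0" "b = ?f n / (- n k0)" by blast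
      have "?f (comb p n) = (- n k0) * ?f p + p k0 * ?f n"
        unfolding comb_def by (simp add: sum_distrib_left sum.distrib[symmetric] algebra_simps)
      moreover have "?f (comb p n) > 0" using pn by (intro w) (auto simp: V'_def)
      ultimately have "(- n k0) * ?f p + p k0 * ?f n > 0" by simp
      moreover have "p k0 > 0" "- n k0 > 0" using pn unfolding P_def N_def by auto
      ultimately show "a < b" unfolding pn(3,4) by (simp add: field_simps)
    qed (use fin in auto)
    then obtain t where t: "\<And>p. p \<in> P \<Longrightarrow> - ?f p / p k0 < t" "\<And>n. n \<in> N \<Longrightarrow> t < ?f n / (- n k0)" by blast
    have "(\<Sum>k\<in>insert k0 K. (w(k0 := t)) k * v k) > 0" if v: "v \<in> V" for v
    proof -
      have "(\<Sum>k\<in>K. (w(k0 := t)) k * v k) = ?f v" using insert.hyps by (intro sum.cong) auto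
      then have e: "(\<Sum>k\<in>insert k0 K. (w(k0 := t)) k * v k) = t * v k0 + ?f v" using insert.hyps by simp
      consider "v k0 = 0" | "v \<in> P" | "v \<in> N" using v unfolding P_def N_def by fastforce
      then show ?thesis
      proof cases
        case 1
        then show ?thesis unfolding e using w[of v] v by (simp add: V'_def)
      next
        case 2
        then have "v k0 > 0" unfolding P_def by simp
        then show ?thesis unfolding e using t(1)[OF 2] by (simp add: field_simps)
      next
        case 3
        then have "- v k0 > 0" unfolding N_def by simp
        then show ?thesis unfolding e using t(2)[OF 3] by (simp add: field_simps)
      qed
    qed
    then show ?thesis by blast
  qed
qed

text \<open>Homogeneous coordinates: affine functionals become linear, and orientations are signs of
  determinants with rows \<open>hat y\<close>.\<close>

definition hat :: "point \<Rightarrow> nat \<Rightarrow> real" where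
  "hat y k = (if k = 0 then 1 else y (k - 1))"

lemma hdet_hat: "hdet d ys = det_n (Suc d) (\<lambda>i. hat (ys i))"
  unfolding hdet_def hat_def ..

text \<open>The determinant is linear in each row, so its sign passes to the cones one row at a
  time; j counts the rows already replaced by their cone elements.\<close>

lemma det_cone_sign:
  assumes pos: "\<And>ys. (\<forall>i<n. ys i \<in> V i) \<Longrightarrow> s * det_n n ys > 0"
    and g: "\<And>i. i < n \<Longrightarrow> g i \<in> cone (V i)"
  shows "s * det_n n g > 0"
proof -
  have "s * det_n n (\<lambda>i. if i < j then g i else ys i) > 0" if "j \<le> n" "\<forall>i<n. ys i \<in> V i" for j ys
    using that
  proof (induction j arbitrary: ys)
    case 0
    then show ?case using pos by simp
  next
    case (Suc j)
    have "s * det_n n ((\<lambda>i. if i < j then g i else ys i)(j := x)) > 0" if "x \<in> cone (V j)" for x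
      using that
    proof induction
      case (cone_base v)
      have "(\<lambda>i. if i < j then g i else ys i)(j := v) = (\<lambda>i. if i < j then g i else (ys(j := v)) i)" by auto
      then show ?case using Suc.IH[of "ys(j := v)"] Suc.prems cone_base by auto
    next
      case (cone_comb x y a b)
      have "j < n" using Suc.prems by simp
      then have "s * det_n n ((\<lambda>i. if i < j then g i else ys i)(j := (\<lambda>k. a * x k + b * y k)))
         = a * (s * det_n n ((\<lambda>i. if i < j then g i else ys i)(j := x))) + b * (s * det_n n ((\<lambda>i. if i < j then g i else ys i)(j := y)))"
        unfolding det_n_row_linear[OF \<open>j < n\<close>] by (simp add: algebra_simps)
      also have "\<dots> > 0"
        by (rule add_pos_nonneg[OF mult_pos_pos[OF cone_comb.hyps(3) cone_comb.IH(1)]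
              mult_nonneg_nonneg[OF cone_comb.hyps(4) less_imp_le[OF cone_comb.IH(2)]]])
      finally show ?case .
    qed
    from this[OF g[of j]] Suc.prems
    have "s * det_n n ((\<lambda>i. if i < j then g i else ys i)(j := g j)) > 0" by simp
    moreover have "(\<lambda>i. if i < j then g i else ys i)(j := g j) = (\<lambda>i. if i < Suc j then g i else ys i)" by auto
    ultimately show ?case by simp
  qed
  moreover have "\<exists>ys. \<forall>i<n. ys i \<in> V i"
  proof -
    have "V i \<noteq> {}" if "i < n" for i
    proof
      assume "V i = {}"
      moreover have "x \<notin> cone {}" for x :: "nat \<Rightarrow> real"
      proof
        assume "x \<in> cone {}" then show False by induction auto
      qed
      ultimately show False using g[OF that] by simp
    qed
    then have "\<forall>i. \<exists>y. i < n \<longrightarrow> y \<in> V i" by auto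
    then show ?thesis by metis
  qed
  ultimately obtain ys where "s * det_n n (\<lambda>i. if i < n then g i else ys i) > 0" by blast
  moreover have "det_n n (\<lambda>i. if i < n then g i else ys i) = det_n n g" by (rule det_n_cong) auto
  ultimately show ?thesis by simp
qed

text \<open>The terms are collected set by set; A records the sets that occur and is nonempty
  because the cone has no empty combination.\<close>

lemma cone_sum_decomp:
  fixes V :: "nat \<Rightarrow> ('k \<Rightarrow> real) set"
  assumes "x \<in> cone (\<Union>i<n. (\<lambda>v k. \<epsilon> i * v k) ` V i)"
  shows "\<exists>A g. A \<subseteq> {..<n} \<and> A \<noteq> {} \<and> (\<forall>i\<in>A. g i \<in> cone (V i)) \<and> x = (\<lambda>k. \<Sum>i\<in>A. \<epsilon> i * g i k)"
  using assms
proof induction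
  case (cone_base v)
  then obtain i v' where "i < n" "v' \<in> V i" "v = (\<lambda>k. \<epsilon> i * v' k)" by auto
  then show ?case by (intro exI[of _ "{i}"] exI[of _ "\<lambda>_. v'"]) (auto intro: cone.cone_base)
next
  case (cone_comb x y a b)
  obtain A g where A: "A \<subseteq> {..<n}" "A \<noteq> {}" "\<forall>i\<in>A. g i \<in> cone (V i)" "x = (\<lambda>k. \<Sum>i\<in>A. \<epsilon> i * g i k)"
    using cone_comb.IH(1) by blast
  obtain B h where B: "B \<subseteq> {..<n}" "B \<noteq> {}" "\<forall>i\<in>B. h i \<in> cone (V i)" "y = (\<lambda>k. \<Sum>i\<in>B. \<epsilon> i * h i k)"
    using cone_comb.IH(2) by blast
  have scale: "(\<lambda>k. c * z k) \<in> cone W" if "z \<in> cone W" "c > 0" for z c and W :: "('k \<Rightarrow> real) set"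
    using cone.cone_comb[OF that(1) that(1) that(2), of 0] by simp
  show ?case
  proof (cases "b = 0")
    case True
    then show ?thesis
      using A scale cone_comb(3) by (intro exI[of _ A] exI[of _ "\<lambda>i k. a * g i k"]) (auto simp: sum_distrib_left algebra_simps)
  next
    case False
    then have b: "b > 0" using cone_comb by simp
    define f where "f i = (if i \<in> A then if i \<in> B then (\<lambda>k. a * g i k + b * h i k) else (\<lambda>k. a * g i k) else (\<lambda>k. b * h i k))" for i
    have f1: "f i \<in> cone (V i)" if "i \<in> A \<union> B" for i
      using that A B b cone_comb(3) scale unfolding f_def by (auto intro: cone.cone_comb)
    have fin: "finite A" "finite B" using A(1) B(1) finite_subset by auto
    have "(\<Sum>i\<in>A\<union>B. \<epsilon> i * f i k) = a * x k + b * y k" for k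
    proof -
      have "(\<Sum>i\<in>A\<union>B. \<epsilon> i * f i k) = (\<Sum>i\<in>A\<union>B. (if i \<in> A then a * (\<epsilon> i * g i k) else 0) + (if i \<in> B then b * (\<epsilon> i * h i k) else 0))"
        by (rule sum.cong) (auto simp: f_def algebra_simps)
      also have "\<dots> = (\<Sum>i\<in>A\<union>B. if i \<in> A then a * (\<epsilon> i * g i k) else 0) + (\<Sum>i\<in>A\<union>B. if i \<in> B then b * (\<epsilon> i * h i k) else 0)"
        by (rule sum.distrib)
      also have "(\<Sum>i\<in>A\<union>B. if i \<in> A then a * (\<epsilon> i * g i k) else 0) = (\<Sum>i\<in>A. a * (\<epsilon> i * g i k))"
        using fin by (subst sum.inter_restrict[symmetric]) (auto simp: Int_absorb1)
      also have "(\<Sum>i\<in>A\<union>B. if i \<in> B then b * (\<epsilon> i * h i k) else 0) = (\<Sum>i\<in>B. b * (\<epsilon> i * h i k))"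
        using fin by (subst sum.inter_restrict[symmetric]) (auto simp: Int_absorb1)
      finally show ?thesis unfolding A(4) B(4) by (simp add: sum_distrib_left)
    qed
    then show ?thesis using f1 A(1,2) B(1)
      by (intro exI[of _ "A \<union> B"] exI[of _ f]) auto
  qed
qed

text \<open>Without such a hyperplane, Gordan's theorem gives a vanishing combination of the signed
  points; collected set by set it is a linear dependence between rows from the cones over the sets,
  where the determinant cannot vanish.\<close>

lemma same_sign_separation:
  assumes fin: "\<And>i. i \<le> d \<Longrightarrow> finite (Y i)" and ne: "\<And>i. i \<le> d \<Longrightarrow> Y i \<noteq> {}"
    and s: "s \<noteq> 0" "\<And>ys. (\<forall>i\<le>d. ys i \<in> Y i) \<Longrightarrow> orientation d ys = s"
    and \<epsilon>: "\<And>i. i \<le> d \<Longrightarrow> \<epsilon> i \<noteq> 0"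
  shows "\<exists>w. \<forall>i\<le>d. \<forall>y\<in>Y i. \<epsilon> i * (\<Sum>k\<le>d. w k * hat y k) > 0"
proof -
  define V where "V i = hat ` Y i" for i
  let ?n = "Suc d"
  define U where "U = (\<Union>i<?n. (\<lambda>v k. \<epsilon> i * v k) ` V i)"
  have finU: "finite U" unfolding U_def V_def using fin by auto
  have pos: "s * det_n ?n ys > 0" if ys: "\<forall>i<?n. ys i \<in> V i" for ys
  proof -
    have "\<forall>i. \<exists>y. i < ?n \<longrightarrow> y \<in> Y i \<and> ys i = hat y" using ys unfolding V_def by blast
    then obtain zs where zs: "\<And>i. i < ?n \<Longrightarrow> zs i \<in> Y i \<and> ys i = hat (zs i)" by metis
    have "det_n ?n ys = hdet d zs" unfolding hdet_hat using zs by (intro det_n_cong) auto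
    moreover have "sgn (hdet d zs) = s" using s(2)[of zs] zs unfolding orientation_eq by auto
    ultimately have "sgn (det_n ?n ys) = s" by simp
    then show ?thesis using s(1) by (auto simp: sgn_real_def split: if_splits)
  qed
  have no: "\<not> (\<exists>x\<in>cone U. \<forall>k\<in>{..d}. x k = 0)"
  proof
    assume "\<exists>x\<in>cone U. \<forall>k\<in>{..d}. x k = 0"
    then obtain x where x: "x \<in> cone U" "\<And>k. k \<le> d \<Longrightarrow> x k = 0" by auto
    obtain A g where A: "A \<subseteq> {..<?n}" "A \<noteq> {}" "\<forall>i\<in>A. g i \<in> cone (V i)" "x = (\<lambda>k. \<Sum>i\<in>A. \<epsilon> i * g i k)"
      using cone_sum_decomp[of x \<epsilon> V ?n] x(1) unfolding U_def by blast
    \<comment> \<open>A set that does not occur contributes any of its points, with coefficient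
      0.\<close>
    define h where "h i = (if i \<in> A then g i else hat (SOME y. y \<in> Y i))" for i
    have "h i \<in> cone (V i)" if "i < ?n" for i
      using that A(3) ne[of i] some_in_eq[of "Y i"] unfolding h_def V_def by (auto intro!: cone_base)
    then have "s * det_n ?n h > 0" using det_cone_sign[of ?n V s h] pos by blast
    moreover have "det_n ?n h = 0"
      unfolding det_n_0_iff_rows
    proof (intro exI[of _ "\<lambda>i. if i \<in> A then \<epsilon> i else 0"] conjI allI impI)
      show "\<exists>i<?n. (if i \<in> A then \<epsilon> i else 0) \<noteq> 0" using A(1,2) \<epsilon> by fastforce
      fix j assume j: "j < ?n"
      have "(\<Sum>i<?n. (if i \<in> A then \<epsilon> i else 0) * h i j) = (\<Sum>i<?n. if i \<in> A then \<epsilon> i * g i j else 0)"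
        by (rule sum.cong) (auto simp: h_def)
      also have "\<dots> = (\<Sum>i\<in>A. \<epsilon> i * g i j)"
        using A(1) by (subst sum.inter_restrict[symmetric]) (auto simp: Int_absorb1)
      also have "\<dots> = 0" using x(2)[of j] j A(4) by simp
      finally show "(\<Sum>i<?n. (if i \<in> A then \<epsilon> i else 0) * h i j) = 0" .
    qed
    ultimately show False by simp
  qed
  with gordan[of "{..d}" U] finU obtain w where w: "\<And>v. v \<in> U \<Longrightarrow> (\<Sum>k\<le>d. w k * v k) > 0" by auto
  have "\<epsilon> i * (\<Sum>k\<le>d. w k * hat y k) > 0" if "i \<le> d" "y \<in> Y i" for i y
  proof -
    have "(\<lambda>k. \<epsilon> i * hat y k) \<in> U" unfolding U_def V_def
      by (rule UN_I[of i]) (use that in \<open>auto intro!: image_eqI[of _ _ "hat y"]\<close>)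
    from w[OF this] show ?thesis by (simp add: sum_distrib_left mult.left_commute)
  qed
  then show ?thesis by blast
qed

text \<open>Given a dependence with coefficients c, the functional for the sign pattern of c makes
  every product of c i with its value nonnegative and one positive, yet the sum is 0.\<close>

lemma det_nonzero_of_signs:
  assumes "\<And>\<epsilon>. (\<forall>i\<le>d. \<epsilon> i = 1 \<or> \<epsilon> i = (-1::real)) \<Longrightarrow> \<exists>w. \<forall>i\<le>d. \<epsilon> i * (\<Sum>k\<le>d. w k * r i k) > 0"
  shows "det_n (Suc d) r \<noteq> 0"
proof
  assume "det_n (Suc d) r = 0"
  then obtain c where c: "\<exists>i<Suc d. c i \<noteq> 0" "\<And>j. j < Suc d \<Longrightarrow> (\<Sum>i<Suc d. c i * r i j) = 0"
    unfolding det_n_0_iff_rows by blast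
  define \<epsilon> where "\<epsilon> i = (if c i \<ge> 0 then 1 else -1 :: real)" for i
  obtain w where w: "\<And>i. i \<le> d \<Longrightarrow> \<epsilon> i * (\<Sum>k\<le>d. w k * r i k) > 0"
  proof -
    have "\<forall>i\<le>d. \<epsilon> i = 1 \<or> \<epsilon> i = -1" unfolding \<epsilon>_def by simp
    from assms[OF this] that show ?thesis by blast
  qed
  have nn: "c i * (\<Sum>k\<le>d. w k * r i k) \<ge> 0" if "i \<le> d" for i
    using w[OF that] unfolding \<epsilon>_def by (auto simp: mult_nonneg_nonneg mult_nonpos_nonpos split: if_splits)
  obtain i0 where i0: "i0 \<le> d" "c i0 \<noteq> 0" using c(1) by (auto simp: less_Suc_eq_le)
  have "c i0 * (\<Sum>k\<le>d. w k * r i0 k) \<noteq> 0" using i0 w[OF i0(1)] by auto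
  then have "c i0 * (\<Sum>k\<le>d. w k * r i0 k) > 0" using nn[OF i0(1)] by linarith
  then have "(\<Sum>i\<le>d. c i * (\<Sum>k\<le>d. w k * r i k)) > 0"
    using i0 nn by (intro sum_pos2[of _ i0]) auto
  moreover have "(\<Sum>i\<le>d. c i * (\<Sum>k\<le>d. w k * r i k)) = (\<Sum>k\<le>d. w k * (\<Sum>i\<le>d. c i * r i k))"
    unfolding sum_distrib_left by (subst sum.swap) (simp add: algebra_simps)
  moreover have "(\<Sum>i\<le>d. c i * r i k) = 0" if "k \<le> d" for k
    using c(2)[of k] that by (simp add: lessThan_Suc_atMost)
  ultimately show False by simp
qed

text \<open>One row is exchanged at a time, along the segment between the two points. Hyperplanes
  that separate the ends also separate the points of the segment, so the determinant, affine along
  it, has no zero there.\<close>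

lemma separation_same_sign:
  assumes sep: "\<And>\<epsilon>. (\<forall>i\<le>d. \<epsilon> i = 1 \<or> \<epsilon> i = (-1::real)) \<Longrightarrow> \<exists>w. \<forall>i\<le>d. \<forall>y\<in>R i. \<epsilon> i * (\<Sum>k\<le>d. w k * hat y k) > 0"
    and ys: "\<forall>i\<le>d. ys i \<in> R i" and zs: "\<forall>i\<le>d. zs i \<in> R i"
  shows "orientation d ys = orientation d zs"
proof -
  define r where "r j i = (if i < j then hat (zs i) else hat (ys i))" for j i :: nat
  have step: "sgn (det_n (Suc d) (r (Suc j))) = sgn (det_n (Suc d) (r j))" if j: "j \<le> d" for j
  proof -
    define f where "f t = det_n (Suc d) ((r j)(j := \<lambda>k. (1 - t) * hat (ys j) k + t * hat (zs j) k))" for t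
    have nz: "f t \<noteq> 0" if t: "0 \<le> t" "t \<le> 1" for t
      unfolding f_def
    proof (rule det_nonzero_of_signs)
      fix \<epsilon> assume "\<forall>i\<le>d. \<epsilon> i = 1 \<or> \<epsilon> i = (-1::real)"
      from sep[OF this] obtain w where w: "\<And>i y. i \<le> d \<Longrightarrow> y \<in> R i \<Longrightarrow> \<epsilon> i * (\<Sum>k\<le>d. w k * hat y k) > 0"
        by blast
      show "\<exists>w. \<forall>i\<le>d. \<epsilon> i * (\<Sum>k\<le>d. w k * ((r j)(j := \<lambda>k. (1 - t) * hat (ys j) k + t * hat (zs j) k)) i k) > 0"
      proof (intro exI[of _ w] allI impI)
        fix i assume i: "i \<le> d"
        have a: "\<epsilon> i * (\<Sum>k\<le>d. w k * hat (ys i) k) > 0" "\<epsilon> i * (\<Sum>k\<le>d. w k * hat (zs i) k) > 0"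
          using w ys zs i by auto
        show "\<epsilon> i * (\<Sum>k\<le>d. w k * ((r j)(j := \<lambda>k. (1 - t) * hat (ys j) k + t * hat (zs j) k)) i k) > 0"
        proof (cases "i = j")
          case True
          have "\<epsilon> i * (\<Sum>k\<le>d. w k * ((1 - t) * hat (ys j) k + t * hat (zs j) k))
            = (1 - t) * (\<epsilon> i * (\<Sum>k\<le>d. w k * hat (ys i) k)) + t * (\<epsilon> i * (\<Sum>k\<le>d. w k * hat (zs i) k))"
            unfolding True by (simp add: sum_distrib_left sum.distrib[symmetric] algebra_simps)
          also have "\<dots> > 0"
          proof (cases "t = 0")
            case False
            then show ?thesis using a t by (intro add_nonneg_pos mult_pos_pos[of t] mult_nonneg_nonneg[of "1 - t"]) auto
          qed (use a in auto)
          finally show ?thesis using True by simp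
        next
          case False
          then show ?thesis using a unfolding r_def by auto
        qed
      qed
    qed
    have fl: "f t = (1 - t) * f 0 + t * f 1" for t
      unfolding f_def using det_n_row_linear[of j "Suc d" "r j" "1 - t" "hat (ys j)" t "hat (zs j)"] j by simp
    have "sgn (f 0) = sgn (f 1)"
    proof (rule ccontr)
      assume ne: "sgn (f 0) \<noteq> sgn (f 1)"
      have nz01: "f 0 \<noteq> 0" "f 1 \<noteq> 0" using nz by auto
      define t where "t = f 0 / (f 0 - f 1)"
      have "f 0 \<noteq> f 1" using ne by auto
      then have "(1 - t) * f 0 + t * f 1 = 0" unfolding t_def by (simp add: field_simps)
      then have "f t = 0" using fl[of t] by simp
      moreover have "0 \<le> t" "t \<le> 1"
        using ne nz01 unfolding t_def sgn_real_def
        by (auto simp: divide_le_eq_1 zero_le_divide_iff split: if_splits)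
      ultimately show False using nz by blast
    qed
    moreover have "f 0 = det_n (Suc d) (r j)"
    proof -
      have "(r j)(j := \<lambda>k. (1 - 0) * hat (ys j) k + 0 * hat (zs j) k) = r j" unfolding r_def by auto
      then show ?thesis unfolding f_def by simp
    qed
    moreover have "f 1 = det_n (Suc d) (r (Suc j))"
    proof -
      have "(r j)(j := \<lambda>k. (1 - 1) * hat (ys j) k + 1 * hat (zs j) k) = r (Suc j)" unfolding r_def by (auto simp: less_Suc_eq)
      then show ?thesis unfolding f_def by simp
    qed
    ultimately show ?thesis by simp
  qed
  have "sgn (det_n (Suc d) (r j)) = sgn (det_n (Suc d) (r 0))" if "j \<le> Suc d" for j
    using that by (induction j) (auto simp: step)
  from this[of "Suc d"] have "sgn (det_n (Suc d) (r (Suc d))) = sgn (det_n (Suc d) (r 0))" by simp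
  moreover have "det_n (Suc d) (r (Suc d)) = hdet d zs" unfolding hdet_hat by (rule det_n_cong) (simp add: r_def)
  moreover have "det_n (Suc d) (r 0) = hdet d ys" unfolding hdet_hat by (rule det_n_cong) (simp add: r_def)
  ultimately show ?thesis by (simp add: orientation_eq)
qed

subsection \<open>Sampling families\<close>

text \<open>One half-space is reserved for each tuple of sets and each sign pattern. Taking all
  tuples and not only the increasing ones makes their number a simple product; the others receive a
  trivial half-space.\<close>

definition sep_conds :: "nat \<Rightarrow> nat \<Rightarrow> ((nat \<Rightarrow> nat) \<times> (nat \<Rightarrow> real)) set" where
  "sep_conds m d = ({..d} \<rightarrow>\<^sub>E {..<m}) \<times> ({..d} \<rightarrow>\<^sub>E {1, -1})"

lemma finite_sep_conds: "finite (sep_conds m d)"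
  unfolding sep_conds_def by (intro finite_cartesian_product finite_PiE) auto

lemma card_sep_conds: "card (sep_conds m d) = m ^ Suc d * 2 ^ Suc d"
  unfolding sep_conds_def by (simp add: card_cartesian_product card_funcsetE numeral_2_eq_2)

lemma strict_mono_on_le_last:
  assumes "strict_mono_on {..d} (idx :: nat \<Rightarrow> nat)" "i \<le> d" shows "idx i \<le> idx d"
  using assms strict_mono_onD[of "{..d}" idx i d] by (cases "i = d") auto

lemma same_type_mono:
  assumes "same_type d m T" "\<And>i. i < m \<Longrightarrow> Y i \<subseteq> T i"
  shows "same_type d m Y"
  unfolding same_type_def
proof (intro allI impI)
  fix idx :: "nat \<Rightarrow> nat" assume idx: "strict_mono_on {..d} idx" "idx d < m"
  then obtain s where s: "\<And>ys. (\<forall>i\<le>d. ys i \<in> T (idx i)) \<Longrightarrow> orientation d ys = s"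
    using assms(1) unfolding same_type_def by blast
  have "idx i < m" if "i \<le> d" for i using strict_mono_on_le_last[OF idx(1) that] idx(2) by simp
  then have "\<And>ys. (\<forall>i\<le>d. ys i \<in> Y (idx i)) \<Longrightarrow> orientation d ys = s" using s assms(2) by blast
  then show "\<exists>s. \<forall>ys. (\<forall>i\<le>d. ys i \<in> Y (idx i)) \<longrightarrow> orientation d ys = s" by blast
qed

lemma gen_pos_transversal:
  assumes "gen_pos_family d m X" "strict_mono_on {..d} idx" "idx d < m" "\<And>i. i \<le> d \<Longrightarrow> ys i \<in> X (idx i)"
  shows "orientation d ys \<noteq> 0"
proof -
  have lt: "idx i < m" if "i \<le> d" for i using strict_mono_on_le_last[OF assms(2) that] assms(3) by simp
  have "inj_on ys {..d}"
  proof (rule inj_onI)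
    fix i j assume ij: "i \<in> {..d}" "j \<in> {..d}" "ys i = ys j"
    have "idx i = idx j"
      using assms(1,4) lt ij unfolding gen_pos_family_def by (metis atMost_iff disjoint_iff)
    then show "i = j" using strict_mono_on_imp_inj_on[OF assms(2)] ij by (auto simp: inj_on_def)
  qed
  moreover have "\<forall>i\<le>d. ys i \<in> (\<Union>i<m. X i)" using assms(4) lt by blast
  ultimately show ?thesis using assms(1) unfolding gen_pos_family_def gen_pos_points_def by blast
qed

text \<open>T i is the intersection of all separating half-spaces on the side of Y i. The same
  hyperplanes separate the T i, so T is of the same type by \<open>separation_same_sign\<close>.
  General position and nonemptiness make the common orientation of Y nonzero, as separation
  requires.\<close>

lemma same_type_extend:
  assumes gp: "gen_pos_family d m X"
    and Y: "\<And>i. i < m \<Longrightarrow> Y i \<subseteq> X i \<and> finite (Y i) \<and> Y i \<noteq> {}" and st: "same_type d m Y"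
  shows "\<exists>T. (\<forall>i<m. T i \<in> polytope_family {..d} hat (sep_conds m d) \<and> Y i \<subseteq> T i) \<and> same_type d m T"
proof -
  let ?J = "sep_conds m d"
  have sep: "\<exists>w. \<forall>e\<le>d. \<forall>y\<in>Y (idx e). \<epsilon> e * (\<Sum>k\<le>d. w k * hat y k) > 0"
    if l: "(idx,\<epsilon>) \<in> ?J" and sm: "strict_mono_on {..d} idx" for idx \<epsilon>
  proof -
    have lt: "idx i < m" if "i \<le> d" for i using l that unfolding sep_conds_def by auto
    obtain s where s: "\<And>ys. (\<forall>i\<le>d. ys i \<in> Y (idx i)) \<Longrightarrow> orientation d ys = s"
      using st sm lt[of d] unfolding same_type_def by auto
    have "\<forall>i. \<exists>y. i \<le> d \<longrightarrow> y \<in> Y (idx i)" using Y lt by blast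
    then obtain ys where ys: "\<And>i. i \<le> d \<Longrightarrow> ys i \<in> Y (idx i)" by metis
    have "orientation d ys \<noteq> 0"
      by (rule gen_pos_transversal[OF gp sm]) (use lt ys Y in blast)+
    then have "s \<noteq> 0" using s ys by blast
    show ?thesis
    proof (rule same_sign_separation[where Y = "\<lambda>i. Y (idx i)" and s = s])
      show "\<epsilon> i \<noteq> 0" if "i \<le> d" for i
      proof -
        have "\<epsilon> i \<in> {1, -1}" using l that unfolding sep_conds_def by blast
        then show ?thesis by auto
      qed
    qed (use Y lt s \<open>s \<noteq> 0\<close> in auto)
  qed
  have "\<exists>w. l \<in> ?J \<and> strict_mono_on {..d} (fst l) \<longrightarrow>
      (\<forall>e\<le>d. \<forall>y\<in>Y (fst l e). snd l e * (\<Sum>k\<le>d. w k * hat y k) > 0)" for l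
  proof (cases "l \<in> ?J \<and> strict_mono_on {..d} (fst l)")
    case True
    then show ?thesis using sep[of "fst l" "snd l"] by simp
  qed blast
  then have "\<forall>l. \<exists>w. l \<in> ?J \<and> strict_mono_on {..d} (fst l) \<longrightarrow>
      (\<forall>e\<le>d. \<forall>y\<in>Y (fst l e). snd l e * (\<Sum>k\<le>d. w k * hat y k) > 0)" by (rule allI)
  from choice[OF this] obtain W where
    "\<forall>l. l \<in> ?J \<and> strict_mono_on {..d} (fst l) \<longrightarrow>
      (\<forall>e\<le>d. \<forall>y\<in>Y (fst l e). snd l e * (\<Sum>k\<le>d. W l k * hat y k) > 0)" by blast
  then have W: "snd l e * (\<Sum>k\<le>d. W l k * hat y k) > 0"
    if "l \<in> ?J" "strict_mono_on {..d} (fst l)" "e \<le> d" "y \<in> Y (fst l e)" for l e y using that by blast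
  define rel where "rel i l \<longleftrightarrow> strict_mono_on {..d} (fst l) \<and> i \<in> fst l ` {..d}"
    for i and l :: "(nat \<Rightarrow> nat) \<times> (nat \<Rightarrow> real)"
  \<comment> \<open>If i does not occur in l, or l is not increasing, the functional is constantly 1
    on the points \<open>hat y\<close> and imposes nothing.\<close>
  define v where "v i l = (if rel i l then (\<lambda>k. snd l (inv_into {..d} (fst l) i) * W l k)
      else (\<lambda>k. if k = 0 then 1 else 0))" for i l
  have vrel: "(\<Sum>k\<le>d. v i l k * hat y k) = snd l e * (\<Sum>k\<le>d. W l k * hat y k)"
    if "strict_mono_on {..d} (fst l)" "e \<le> d" "fst l e = i" for i l e y
  proof -
    have "inv_into {..d} (fst l) i = e"
      using inv_into_f_f[OF strict_mono_on_imp_inj_on[OF that(1)], of e] that by simp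
    moreover have "rel i l" unfolding rel_def using that by auto
    ultimately show ?thesis unfolding v_def by (simp add: sum_distrib_left mult.assoc)
  qed
  define T where "T i = {x. \<forall>l\<in>?J. (\<Sum>k\<in>{..d}. v i l k * hat x k) > 0}" for i
  have "T i \<in> polytope_family {..d} hat ?J" for i unfolding T_def polytope_family_def by blast
  moreover have "Y i \<subseteq> T i" if "i < m" for i
  proof
    fix y assume y: "y \<in> Y i"
    have "(\<Sum>k\<in>{..d}. v i l k * hat y k) > 0" if l: "l \<in> ?J" for l
    proof (cases "rel i l")
      case True
      then obtain e where e: "e \<le> d" "fst l e = i" "strict_mono_on {..d} (fst l)" unfolding rel_def by auto
      show ?thesis unfolding vrel[OF e(3,1,2)] using W[OF l e(3,1)] e(2) y by blast
    next
      case False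
      have "(\<Sum>k\<in>{..d}. v i l k * hat y k) = (\<Sum>k\<in>{..d}. if k = 0 then hat y 0 else 0)"
        using False by (intro sum.cong) (auto simp: v_def)
      also have "\<dots> = 1" by (simp add: hat_def)
      finally show ?thesis by simp
    qed
    then show "y \<in> T i" unfolding T_def by blast
  qed
  moreover have "same_type d m T"
    unfolding same_type_def
  proof (intro allI impI)
    fix idx :: "nat \<Rightarrow> nat" assume idx: "strict_mono_on {..d} idx" "idx d < m"
    define idx' where "idx' = restrict idx {..d}"
    have lt: "idx i < m" if "i \<le> d" for i using strict_mono_on_le_last[OF idx(1) that] idx(2) by simp
    have sm: "strict_mono_on {..d} idx'" using idx(1) unfolding idx'_def strict_mono_on_def by auto
    have "orientation d ys = orientation d zs"
      if yz: "\<forall>i\<le>d. ys i \<in> T (idx i)" "\<forall>i\<le>d. zs i \<in> T (idx i)" for ys zs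
    proof (rule separation_same_sign[where R = "\<lambda>i. T (idx i)", OF _ yz])
      fix \<epsilon> assume \<epsilon>: "\<forall>i\<le>d. \<epsilon> i = 1 \<or> \<epsilon> i = (-1::real)"
      define l where "l = (idx', restrict \<epsilon> {..d})"
      have sml: "strict_mono_on {..d} (fst l)" using sm by (simp add: l_def)
      have lJ: "l \<in> ?J" unfolding l_def sep_conds_def idx'_def using lt \<epsilon> by auto
      have "\<epsilon> e * (\<Sum>k\<le>d. W l k * hat y k) > 0" if "e \<le> d" "y \<in> T (idx e)" for e y
      proof -
        have f: "fst l e = idx e" "snd l e = \<epsilon> e" using that unfolding l_def idx'_def by auto
        have "(\<Sum>k\<le>d. v (idx e) l k * hat y k) = \<epsilon> e * (\<Sum>k\<le>d. W l k * hat y k)"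
          using vrel[OF sml that(1) f(1), of y] f(2) by simp
        then show ?thesis using that(2) lJ unfolding T_def by auto
      qed
      then show "\<exists>w. \<forall>i\<le>d. \<forall>y\<in>T (idx i). \<epsilon> i * (\<Sum>k\<le>d. w k * hat y k) > 0" by blast
    qed
    then show "\<exists>s. \<forall>ys. (\<forall>i\<le>d. ys i \<in> T (idx i)) \<longrightarrow> orientation d ys = s" by metis
  qed
  ultimately show ?thesis by blast
qed

text \<open>The bound \<open>2 * N0 + 1\<close> of \<open>eps_approximation\<close>, the exponent L
  being the dimension \<open>Suc d\<close> times the number of half-spaces in
  \<open>sep_conds m d\<close>.\<close>

definition sample_size :: "nat \<Rightarrow> nat \<Rightarrow> nat \<Rightarrow> nat" where
  "sample_size m d b = 2 * (16 * b * (2 * (Suc d * (m ^ Suc d * 2 ^ Suc d)) + 1)) ^ 4 + 1"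

text \<open>Each X' i approximates X i with respect to the polytopes of
  \<open>same_type_extend\<close>. A selection in the samples is enlarged to such polytopes, which
  are then cut with the original sets.\<close>

theorem sampling:
  assumes gp: "gen_pos_family d m X" and X: "\<And>i. i < m \<Longrightarrow> finite (X i) \<and> X i \<noteq> {}" and b: "b \<ge> 1"
  shows "\<exists>X'. (\<forall>i<m. X' i \<subseteq> X i \<and> X' i \<noteq> {} \<and> card (X' i) \<le> sample_size m d b) \<and>
    (\<forall>Y'. same_type d m Y' \<longrightarrow> (\<forall>i<m. Y' i \<subseteq> X' i \<and> Y' i \<noteq> {}) \<longrightarrow>
      (\<exists>Y. same_type d m Y \<and> (\<forall>i<m. Y i \<subseteq> X i \<and>
         card (Y' i) / card (X' i) \<le> card (Y i) / card (X i) + 1 / (2 * real b))))"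
proof -
  let ?G = "polytope_family {..d} hat (sep_conds m d)"
  define L where "L = Suc d * (m ^ Suc d * 2 ^ Suc d)"
  have growth: "card ((\<lambda>T. T \<inter> I) ` ?G) \<le> (card I + 1) ^ L" if "finite I" for I
    using card_polytope_traces[OF that finite_atMost finite_sep_conds, of d hat m d]
    unfolding card_sep_conds L_def by simp
  have "\<exists>X'\<subseteq>X i. X' \<noteq> {} \<and> card X' \<le> sample_size m d b \<and>
    (\<forall>T\<in>?G. card (T \<inter> X') / card X' \<le> card (T \<inter> X i) / card (X i) + 1 / (2 * real b))" if "i < m" for i
    using eps_approximation[OF growth _ _ b refl, of "X i"] X[OF that] unfolding sample_size_def L_def by blast
  then obtain X' where X': "\<And>i. i < m \<Longrightarrow> X' i \<subseteq> X i \<and> X' i \<noteq> {} \<and> card (X' i) \<le> sample_size m d b"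
    "\<And>i T. i < m \<Longrightarrow> T \<in> ?G \<Longrightarrow> card (T \<inter> X' i) / card (X' i) \<le> card (T \<inter> X i) / card (X i) + 1 / (2 * real b)"
    by metis
  have "\<exists>Y. same_type d m Y \<and> (\<forall>i<m. Y i \<subseteq> X i \<and>
         card (Y' i) / card (X' i) \<le> card (Y i) / card (X i) + 1 / (2 * real b))"
    if st: "same_type d m Y'" and Y': "\<forall>i<m. Y' i \<subseteq> X' i \<and> Y' i \<noteq> {}" for Y'
  proof -
    have fin': "finite (X' i)" if "i < m" for i using X' X that finite_subset by metis
    have "Y' i \<subseteq> X i \<and> finite (Y' i) \<and> Y' i \<noteq> {}" if "i < m" for i
      using Y' X'(1)[OF that] fin'[OF that] that finite_subset by (metis order_trans)
    from same_type_extend[OF gp this st] obtain T where T: "\<And>i. i < m \<Longrightarrow> T i \<in> ?G \<and> Y' i \<subseteq> T i" "same_type d m T"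
      by blast
    define Y where "Y i = T i \<inter> X i" for i
    have "same_type d m Y" by (rule same_type_mono[OF T(2)]) (auto simp: Y_def)
    moreover have "card (Y' i) / card (X' i) \<le> card (Y i) / card (X i) + 1 / (2 * real b)" if i: "i < m" for i
    proof -
      have "card (Y' i) \<le> card (T i \<inter> X' i)" using T(1)[OF i] Y' i fin'[OF i] by (intro card_mono) auto
      then have "card (Y' i) / card (X' i) \<le> card (T i \<inter> X' i) / card (X' i)" by (intro divide_right_mono) auto
      also have "\<dots> \<le> card (Y i) / card (X i) + 1 / (2 * real b)" unfolding Y_def using X'(2)[OF i] T(1)[OF i] by blast
      finally show ?thesis .
    qed
    ultimately show ?thesis by (intro exI[of _ Y]) (auto simp: Y_def)
  qed
  then show ?thesis using X'(1) by blast
qed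

subsection \<open>Recursive functions\<close>

text \<open>Total access with default 0, so that dropping the head of the argument list is a shift
  of the index without conditions on the length. The bound variables of sums and quantifiers are
  stored in front of the list.\<close>

definition entry :: "nat list \<Rightarrow> nat \<Rightarrow> nat" where
  "entry xs i = (if i < length xs then xs ! i else 0)"

lemma entry_tl [simp]: "entry (tl xs) i = entry xs (Suc i)"
  by (cases xs) (auto simp: entry_def)

lemma entry_Cons_0 [simp]: "entry (x # xs) 0 = x"
  and entry_Cons_Suc [simp]: "entry (x # xs) (Suc i) = entry xs i"
  by (auto simp: entry_def)

definition computable :: "nat \<Rightarrow> (nat list \<Rightarrow> nat) \<Rightarrow> bool" where
  "computable n f \<longleftrightarrow> (\<exists>r. \<forall>xs. length xs = n \<longrightarrow> recf_eval r xs (f xs))"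

definition pcomputable :: "nat \<Rightarrow> (nat list \<Rightarrow> bool) \<Rightarrow> bool" where
  "pcomputable n P \<longleftrightarrow> computable n (\<lambda>xs. of_bool (P xs))"

text \<open>An integer is computed through its positive and negative parts, as recursive functions
  have natural values.\<close>

definition icomputable :: "nat \<Rightarrow> (nat list \<Rightarrow> int) \<Rightarrow> bool" where
  "icomputable n f \<longleftrightarrow> computable n (\<lambda>xs. nat (f xs)) \<and> computable n (\<lambda>xs. nat (- f xs))"

lemma computable_cong:
  assumes "\<And>xs. length xs = n \<Longrightarrow> f xs = g xs"
  shows "computable n f \<longleftrightarrow> computable n g"
  unfolding computable_def by (rule ex_cong1) (use assms in auto)

lemma computable_comp:
  assumes f: "computable (length gs) f" and g: "\<And>g. g \<in> set gs \<Longrightarrow> computable n g"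
  shows "computable n (\<lambda>xs. f (map (\<lambda>g. g xs) gs))"
proof -
  obtain r where r: "\<And>ys. length ys = length gs \<Longrightarrow> recf_eval r ys (f ys)" using f unfolding computable_def by blast
  have "\<forall>g. \<exists>s. g \<in> set gs \<longrightarrow> (\<forall>xs. length xs = n \<longrightarrow> recf_eval s xs (g xs))"
    using g unfolding computable_def by blast
  then obtain s where s: "\<And>g xs. g \<in> set gs \<Longrightarrow> length xs = n \<Longrightarrow> recf_eval (s g) xs (g xs)" by metis
  have "recf_eval (Cn r (map s gs)) xs (f (map (\<lambda>g. g xs) gs))" if "length xs = n" for xs
    by (rule recf_eval.comp[where ys = "map (\<lambda>g. g xs) gs"]) (use that r s in auto)
  then show ?thesis unfolding computable_def by blast
qed

lemma computable_nth: "i < n \<Longrightarrow> computable n (\<lambda>xs. xs ! i)"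
  unfolding computable_def using recf_eval.proj by blast

lemma computable_entry: "i < n \<Longrightarrow> computable n (\<lambda>xs. entry xs i)"
  using computable_nth[of i n] computable_cong[of n "\<lambda>xs. entry xs i" "\<lambda>xs. xs ! i"] by (simp add: entry_def)

lemma computable_Suc:
  assumes "computable n A" shows "computable n (\<lambda>xs. Suc (A xs))"
proof -
  have "recf_eval S xs (Suc (entry xs 0))" if "length xs = 1" for xs
    using that recf_eval.succ by (cases xs) auto
  then have "computable (length [A]) (\<lambda>xs. Suc (entry xs 0))" unfolding computable_def by auto
  from computable_comp[OF this] assms show ?thesis by simp
qed

lemma computable_const: "computable n (\<lambda>_. c)"
proof (induction c)
  case 0
  show ?case unfolding computable_def using recf_eval.zero by blast
qed (rule computable_Suc)

lemma computable_comp1: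
  assumes "computable (Suc 0) (\<lambda>xs. f (entry xs 0))" "computable n A"
  shows "computable n (\<lambda>xs. f (A xs))"
  using computable_comp[of "[A]" "\<lambda>xs. f (entry xs 0)" n] assms by simp

lemma computable_comp2:
  assumes "computable (Suc (Suc 0)) (\<lambda>xs. f (entry xs 0) (entry xs (Suc 0)))" "computable n A" "computable n B"
  shows "computable n (\<lambda>xs. f (A xs) (B xs))"
  using computable_comp[of "[A,B]" "\<lambda>xs. f (entry xs 0) (entry xs (Suc 0))" n] assms by auto

lemma computable_rec:
  assumes B: "computable n B" and F: "computable n F"
    and G: "computable (Suc (Suc n)) (\<lambda>ys. G (entry ys 0) (entry ys (Suc 0)) (tl (tl ys)))"
  shows "computable n (\<lambda>xs. rec_nat (F xs) (\<lambda>k y. G k y xs) (B xs))"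
proof -
  obtain rF where rF: "\<And>xs. length xs = n \<Longrightarrow> recf_eval rF xs (F xs)" using F unfolding computable_def by blast
  obtain rG where rG: "\<And>ys. length ys = Suc (Suc n) \<Longrightarrow> recf_eval rG ys (G (entry ys 0) (entry ys (Suc 0)) (tl (tl ys)))"
    using G unfolding computable_def by blast
  have pr: "recf_eval (Pr rF rG) (k # xs) (rec_nat (F xs) (\<lambda>k y. G k y xs) k)" if "length xs = n" for k xs
  proof (induction k)
    case 0
    then show ?case using recf_eval.pr0[OF rF[OF that]] by simp
  next
    case (Suc k)
    show ?case
      using recf_eval.prS[OF Suc] rG[of "k # rec_nat (F xs) (\<lambda>k y. G k y xs) k # xs"] that by simp
  qed
  let ?gs = "B # map (\<lambda>i xs. xs ! i) [0..<n]"
  have "computable (length ?gs) (\<lambda>ys. rec_nat (F (tl ys)) (\<lambda>k y. G k y (tl ys)) (entry ys 0))"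
    unfolding computable_def
  proof (intro exI[of _ "Pr rF rG"] allI impI)
    fix ys :: "nat list" assume "length ys = length ?gs"
    then obtain k xs where "ys = k # xs" "length xs = n" by (cases ys) auto
    then show "recf_eval (Pr rF rG) ys (rec_nat (F (tl ys)) (\<lambda>k y. G k y (tl ys)) (entry ys 0))" using pr by simp
  qed
  then have "computable n (\<lambda>xs. rec_nat (F (tl (map (\<lambda>g. g xs) ?gs))) (\<lambda>k y. G k y (tl (map (\<lambda>g. g xs) ?gs))) (entry (map (\<lambda>g. g xs) ?gs) 0))"
    by (rule computable_comp) (use B computable_nth in auto)
  moreover have "map (\<lambda>g. g xs) ?gs = B xs # xs" if "length xs = n" for xs
    using that by (auto simp: comp_def intro: nth_equalityI)
  ultimately show ?thesis by (subst (asm) computable_cong[of n]) (simp_all only: list.sel entry_Cons_0)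
qed

text \<open>Weakening: a term over counter and parameters remains computable when the accumulator of
  a recursion stands between them.\<close>

lemma computable_skip:
  assumes "computable (Suc n) (\<lambda>ys. F (entry ys 0) (tl ys))"
  shows "computable (Suc (Suc n)) (\<lambda>ys. F (entry ys 0) (tl (tl ys)))"
proof -
  let ?gs = "(\<lambda>ys. entry ys 0) # map (\<lambda>i ys. ys ! (Suc (Suc i))) [0..<n]"
  have "computable (Suc (Suc n)) (\<lambda>ys. F (entry (map (\<lambda>g. g ys) ?gs) 0) (tl (map (\<lambda>g. g ys) ?gs)))"
    by (rule computable_comp[of ?gs "\<lambda>ys. F (entry ys 0) (tl ys)"]) (use assms in \<open>auto intro!: computable_nth computable_entry\<close>)
  moreover have "tl (map (\<lambda>g. g ys) ?gs) = tl (tl ys)" if "length ys = Suc (Suc n)" for ys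
    using that by (auto simp: comp_def nth_tl intro: nth_equalityI)
  ultimately show ?thesis
    using computable_cong[of "Suc (Suc n)" "\<lambda>ys. F (entry (map (\<lambda>g. g ys) ?gs) 0) (tl (map (\<lambda>g. g ys) ?gs))"
        "\<lambda>ys. F (entry ys 0) (tl (tl ys))"] by simp
qed

lemma computable_add:
  assumes "computable n A" "computable n B" shows "computable n (\<lambda>xs. A xs + B xs)"
proof -
  have "rec_nat a (\<lambda>k y. Suc y) b = a + b" for a b :: nat by (induction b) auto
  then show ?thesis
    using computable_rec[OF assms(2,1), of "\<lambda>k y xs. Suc y"] by (simp add: computable_Suc computable_entry)
qed

lemma computable_mult:
  assumes "computable n A" "computable n B" shows "computable n (\<lambda>xs. A xs * B xs)"
proof (rule computable_comp2[OF _ assms])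
  have "rec_nat 0 (\<lambda>k y. y + a) b = a * b" for a b :: nat by (induction b) auto
  then show "computable (Suc (Suc 0)) (\<lambda>xs. entry xs 0 * entry xs (Suc 0))"
    using computable_rec[of "Suc (Suc 0)" "\<lambda>xs. entry xs (Suc 0)" "\<lambda>xs. 0" "\<lambda>k y xs. y + entry xs 0"]
    by (simp add: computable_add computable_entry computable_const)
qed

lemma computable_power:
  assumes "computable n A" "computable n B" shows "computable n (\<lambda>xs. A xs ^ B xs)"
proof (rule computable_comp2[OF _ assms])
  have "rec_nat (Suc 0) (\<lambda>k y. y * a) b = a ^ b" for a b :: nat by (induction b) auto
  then show "computable (Suc (Suc 0)) (\<lambda>xs. entry xs 0 ^ entry xs (Suc 0))"
    using computable_rec[of "Suc (Suc 0)" "\<lambda>xs. entry xs (Suc 0)" "\<lambda>xs. Suc 0" "\<lambda>k y xs. y * entry xs 0"]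
    by (simp add: computable_mult computable_entry computable_const)
qed

lemma computable_diff:
  assumes "computable n A" "computable n B" shows "computable n (\<lambda>xs. A xs - B xs)"
proof (rule computable_comp2[OF _ assms])
  have "rec_nat 0 (\<lambda>k y. k) a = a - Suc 0" for a :: nat by (cases a) auto
  then have pred: "computable (Suc 0) (\<lambda>xs. entry xs 0 - Suc 0)"
    using computable_rec[of "Suc 0" "\<lambda>xs. entry xs 0" "\<lambda>xs. 0" "\<lambda>k y xs. k"]
    by (simp add: computable_entry computable_const)
  have "rec_nat a (\<lambda>k y. y - Suc 0) b = a - b" for a b :: nat by (induction b) auto
  then show "computable (Suc (Suc 0)) (\<lambda>xs. entry xs 0 - entry xs (Suc 0))"
    using computable_rec[of "Suc (Suc 0)" "\<lambda>xs. entry xs (Suc 0)" "\<lambda>xs. entry xs 0" "\<lambda>k y xs. y - Suc 0"]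
      computable_comp1[OF pred] by (simp add: computable_entry)
qed

lemma computable_sum:
  assumes "computable n B" "computable (Suc n) (\<lambda>ys. F (entry ys 0) (tl ys))"
  shows "computable n (\<lambda>xs. \<Sum>k<B xs. F k xs)"
proof -
  have "rec_nat 0 (\<lambda>k y. y + f k) b = (\<Sum>k<b. f k)" for f :: "nat \<Rightarrow> nat" and b by (induction b) auto
  then show ?thesis
    using computable_rec[OF assms(1), of "\<lambda>_. 0" "\<lambda>k y xs. y + F k xs"] computable_skip[OF assms(2)]
    by (simp add: computable_add computable_entry computable_const)
qed

lemma computable_prod:
  assumes "computable n B" "computable (Suc n) (\<lambda>ys. F (entry ys 0) (tl ys))"
  shows "computable n (\<lambda>xs. \<Prod>k<B xs. F k xs)"
proof -
  have "rec_nat (Suc 0) (\<lambda>k y. y * f k) b = (\<Prod>k<b. f k)" for f :: "nat \<Rightarrow> nat" and b by (induction b) auto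
  then show ?thesis
    using computable_rec[OF assms(1), of "\<lambda>_. Suc 0" "\<lambda>k y xs. y * F k xs"] computable_skip[OF assms(2)]
    by (simp add: computable_mult computable_entry computable_const)
qed

section \<open>Decidable predicates\<close>

lemma pcomputable_le:
  assumes "computable n A" "computable n B" shows "pcomputable n (\<lambda>xs. A xs \<le> B xs)"
proof -
  have "of_bool (a \<le> b) = Suc 0 - (a - b)" for a b :: nat by auto
  then show ?thesis unfolding pcomputable_def using assms by (simp add: computable_diff computable_const)
qed

lemma pcomputable_not:
  assumes "pcomputable n P" shows "pcomputable n (\<lambda>xs. \<not> P xs)"
proof -
  have "of_bool (\<not> p) = Suc 0 - of_bool p" for p by auto
  then show ?thesis using assms unfolding pcomputable_def by (simp add: computable_diff computable_const del: of_bool_not_iff)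
qed

lemma pcomputable_conj:
  assumes "pcomputable n P" "pcomputable n R" shows "pcomputable n (\<lambda>xs. P xs \<and> R xs)"
  using assms unfolding pcomputable_def by (simp add: of_bool_conj computable_mult)

lemma pcomputable_imp:
  assumes "pcomputable n P" "pcomputable n R" shows "pcomputable n (\<lambda>xs. P xs \<longrightarrow> R xs)"
  using pcomputable_not[OF pcomputable_conj[OF assms(1) pcomputable_not[OF assms(2)]]] by simp

lemma pcomputable_less:
  assumes "computable n A" "computable n B" shows "pcomputable n (\<lambda>xs. A xs < B xs)"
  using pcomputable_le[OF computable_Suc[OF assms(1)] assms(2)] by (simp add: Suc_le_eq)

lemma pcomputable_eq:
  assumes "computable n A" "computable n B" shows "pcomputable n (\<lambda>xs. A xs = B xs)"
  using pcomputable_conj[OF pcomputable_le[OF assms] pcomputable_le[OF assms(2,1)]] by (simp add: eq_iff)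

lemma pcomputable_ball:
  assumes "computable n B" "pcomputable (Suc n) (\<lambda>ys. P (entry ys 0) (tl ys))"
  shows "pcomputable n (\<lambda>xs. \<forall>k<B xs. P k xs)"
proof -
  have "of_bool (\<forall>k<b. p k) = (\<Prod>k<b. of_bool (p k) :: nat)" for b and p :: "nat \<Rightarrow> bool"
    by (induction b) (auto simp: less_Suc_eq)
  then show ?thesis using computable_prod[OF assms(1), of "\<lambda>k xs. of_bool (P k xs)"] assms(2)
    unfolding pcomputable_def by simp
qed

lemma pcomputable_bex:
  assumes "computable n B" "pcomputable (Suc n) (\<lambda>ys. P (entry ys 0) (tl ys))"
  shows "pcomputable n (\<lambda>xs. \<exists>k<B xs. P k xs)"
  using pcomputable_not[OF pcomputable_ball[OF assms(1), of "\<lambda>k xs. \<not> P k xs"]] pcomputable_not[OF assms(2)] by simp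

lemma computable_if:
  assumes "pcomputable n P" "computable n A" "computable n B"
  shows "computable n (\<lambda>xs. if P xs then A xs else B xs)"
proof -
  have "(if p then a else b) = of_bool p * a + of_bool (\<not> p) * b" for p and a b :: nat by auto
  then show ?thesis using assms pcomputable_not[OF assms(1)] unfolding pcomputable_def
    by (simp add: computable_add computable_mult del: of_bool_not_iff)
qed

lemma computable_of_bool: "pcomputable n P \<Longrightarrow> computable n (\<lambda>xs. of_bool (P xs))"
  unfolding pcomputable_def .

text \<open>The quotient counts the positive multiples of b that do not exceed a; the conjunct 0 < b
  gives the value 0 for division by zero.\<close>

lemma computable_div:
  assumes "computable n A" "computable n B" shows "computable n (\<lambda>xs. A xs div B xs)"
proof (rule computable_comp2[OF _ assms])
  have *: "a div b = (\<Sum>k<a. of_bool (0 < b \<and> Suc k * b \<le> a))" for a b :: nat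
  proof (cases "b = 0")
    case False
    have "(\<Sum>k<a. of_bool (0 < b \<and> Suc k * b \<le> a)) = card {k\<in>{..<a}. Suc k * b \<le> a}"
      using False by (subst sum_of_bool_eq) (auto intro: arg_cong[of _ _ card])
    also have "{k\<in>{..<a}. Suc k * b \<le> a} = {..<a div b}"
    proof -
      have "Suc k * b \<le> a \<longleftrightarrow> k < a div b" for k
        using False less_eq_div_iff_mult_less_eq[of b "Suc k" a] by (simp add: Suc_le_eq)
      moreover have "a div b \<le> a" by simp
      ultimately show ?thesis by (auto intro: less_le_trans)
    qed
    finally show ?thesis by simp
  qed simp
  show "computable (Suc (Suc 0)) (\<lambda>xs. entry xs 0 div entry xs (Suc 0))"
    unfolding * by (rule computable_sum)
      (auto intro!: computable_of_bool pcomputable_conj pcomputable_less pcomputable_le computable_mult computable_add computable_Suc computable_entry computable_const)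
qed

lemma computable_mod:
  assumes "computable n A" "computable n B" shows "computable n (\<lambda>xs. A xs mod B xs)"
  using assms by (simp add: modulo_nat_def computable_diff computable_mult computable_div)

section \<open>Integer-valued functions\<close>

lemma icomputable_of_nat: "computable n A \<Longrightarrow> icomputable n (\<lambda>xs. int (A xs))"
  unfolding icomputable_def by (simp add: computable_const)

lemma icomputable_diff_nat:
  assumes "computable n A" "computable n B" shows "icomputable n (\<lambda>xs. int (A xs) - int (B xs))"
proof -
  have "nat (int a - int b) = a - b" "nat (- (int a - int b)) = b - a" for a b by auto
  then show ?thesis unfolding icomputable_def using assms by (simp add: computable_diff)
qed

lemma icomputable_alt: "icomputable n f \<longleftrightarrow> (\<exists>A B. computable n A \<and> computable n B \<and> f = (\<lambda>xs. int (A xs) - int (B xs)))"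
proof
  assume "icomputable n f"
  then show "\<exists>A B. computable n A \<and> computable n B \<and> f = (\<lambda>xs. int (A xs) - int (B xs))"
    unfolding icomputable_def by (intro exI[of _ "\<lambda>xs. nat (f xs)"] exI[of _ "\<lambda>xs. nat (- f xs)"]) auto
qed (auto intro: icomputable_diff_nat)

lemma icomputable_diff:
  assumes "icomputable n f" "icomputable n g" shows "icomputable n (\<lambda>xs. f xs - g xs)"
proof -
  obtain A B C D where *: "computable n A" "computable n B" "computable n C" "computable n D"
    "f = (\<lambda>xs. int (A xs) - int (B xs))" "g = (\<lambda>xs. int (C xs) - int (D xs))"
    using assms unfolding icomputable_alt by blast
  have "(\<lambda>xs. f xs - g xs) = (\<lambda>xs. int (A xs + D xs) - int (B xs + C xs))" using * by auto
  then show ?thesis using * by (simp add: icomputable_diff_nat computable_add del: of_nat_add)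
qed

lemma icomputable_mult:
  assumes "icomputable n f" "icomputable n g" shows "icomputable n (\<lambda>xs. f xs * g xs)"
proof -
  obtain A B C D where *: "computable n A" "computable n B" "computable n C" "computable n D"
    "f = (\<lambda>xs. int (A xs) - int (B xs))" "g = (\<lambda>xs. int (C xs) - int (D xs))"
    using assms unfolding icomputable_alt by blast
  have "(\<lambda>xs. f xs * g xs) = (\<lambda>xs. int (A xs * C xs + B xs * D xs) - int (A xs * D xs + B xs * C xs))"
    using * by (auto simp: algebra_simps)
  then show ?thesis using * by (simp add: icomputable_diff_nat computable_add computable_mult del: of_nat_add of_nat_mult)
qed

lemma icomputable_sum:
  assumes "computable n B" "icomputable (Suc n) (\<lambda>ys. F (entry ys 0) (tl ys))"
  shows "icomputable n (\<lambda>xs. \<Sum>k<B xs. F k xs)"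
proof -
  have "(\<lambda>xs. \<Sum>k<B xs. F k xs) = (\<lambda>xs. int (\<Sum>k<B xs. nat (F k xs)) - int (\<Sum>k<B xs. nat (- F k xs)))"
    by (auto simp: sum_subtractf[symmetric] intro!: sum.cong)
  then show ?thesis using assms unfolding icomputable_def[of "Suc n"]
    by (simp add: icomputable_diff_nat computable_sum del: of_nat_sum)
qed

lemma icomputable_if:
  assumes "pcomputable n P" "icomputable n A" "icomputable n B"
  shows "icomputable n (\<lambda>xs. if P xs then A xs else B xs)"
  using assms unfolding icomputable_def by (simp add: computable_if if_distrib[of nat] if_distrib[of uminus])

lemma pcomputable_ieq:
  assumes "icomputable n f" "icomputable n g" shows "pcomputable n (\<lambda>xs. f xs = g xs)"
proof -
  have "(a = b) = (nat a = nat b \<and> nat (- a) = nat (- b))" for a b :: int by auto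
  then show ?thesis using assms unfolding icomputable_def by (simp add: pcomputable_conj pcomputable_eq)
qed

lemma pcomputable_iless0: "icomputable n f \<Longrightarrow> pcomputable n (\<lambda>xs. f xs < 0)"
  unfolding icomputable_def using pcomputable_less[OF computable_const[of n 0], of "\<lambda>xs. nat (- f xs)"] by simp

lemma icomputable_const: "icomputable n (\<lambda>_. c)"
  unfolding icomputable_def by (simp add: computable_const)

lemma icomputable_sgn:
  assumes "icomputable n f" shows "icomputable n (\<lambda>xs. sgn (f xs))"
proof -
  have "(\<lambda>xs. sgn (f xs)) = (\<lambda>xs. if f xs < 0 then -1 else if f xs = 0 then 0 else 1)" by (auto simp: sgn_if)
  then show ?thesis
    by (simp add: icomputable_if pcomputable_iless0 pcomputable_ieq icomputable_const assms)
qed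

text \<open>The absolute value is a product of naturals, and the sign is the parity of the number of
  negative factors.\<close>

lemma icomputable_prod:
  assumes B: "computable n B" and F: "icomputable (Suc n) (\<lambda>ys. F (entry ys 0) (tl ys))"
  shows "icomputable n (\<lambda>xs. \<Prod>k<B xs. F k xs)"
proof -
  have *: "(\<Prod>k<b. f k) = (if (\<Sum>k<b. of_bool (f k < 0)) mod 2 = (0::nat) then int (\<Prod>k<b. nat (f k) + nat (- f k))
      else 0 - int (\<Prod>k<b. nat (f k) + nat (- f k)))" for f :: "nat \<Rightarrow> int" and b
  proof (induction b)
    case (Suc b)
    have "f b = (if f b < 0 then - int (nat (f b) + nat (- f b)) else int (nat (f b) + nat (- f b)))" by simp
    then show ?case using Suc by (auto simp: mod_Suc split: if_splits)
  qed simp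
  have F': "computable (Suc n) (\<lambda>ys. nat (F (entry ys 0) (tl ys)) + nat (- F (entry ys 0) (tl ys)))"
    using F unfolding icomputable_def by (simp add: computable_add)
  have "computable n (\<lambda>xs. \<Prod>k<B xs. nat (F k xs) + nat (- F k xs))"
    by (rule computable_prod[OF B F'])
  then have P: "icomputable n (\<lambda>xs. int (\<Prod>k<B xs. nat (F k xs) + nat (- F k xs)))" by (rule icomputable_of_nat)
  have "computable n (\<lambda>xs. \<Sum>k<B xs. of_bool (F k xs < 0))"
    by (rule computable_sum[OF B]) (rule computable_of_bool[OF pcomputable_iless0[OF F]])
  then have "pcomputable n (\<lambda>xs. (\<Sum>k<B xs. of_bool (F k xs < 0)) mod 2 = (0::nat))"
    by (intro pcomputable_eq computable_mod computable_const)
  then show ?thesis unfolding * by (intro icomputable_if P icomputable_diff icomputable_const)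
qed

lemma computable_fact:
  assumes "computable n A" shows "computable n (\<lambda>xs. fact (A xs))"
proof -
  have "fact a = (\<Prod>k<a. Suc k)" for a by (simp add: fact_prod_Suc lessThan_atLeast0)
  then show ?thesis by (simp add: computable_prod assms computable_Suc computable_entry)
qed

lemma computable_funpow:
  assumes f: "computable (Suc 0) (\<lambda>xs. f (entry xs 0))" and "computable n A" "computable n B"
  shows "computable n (\<lambda>xs. (f ^^ A xs) (B xs))"
proof -
  have *: "(f ^^ a) b = rec_nat b (\<lambda>k y. f y) a" for a b by (induction a) auto
  show ?thesis unfolding *
    by (rule computable_rec[OF assms(2,3)]) (auto intro!: computable_comp1[OF f] computable_entry)
qed

text \<open>\<open>Mn\<close> stops at the value 0, hence the form as a search for the first failure
  of a predicate.\<close>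

lemma computable_minimization:
  assumes P: "pcomputable (Suc n) (\<lambda>ys. P (entry ys 0) (tl ys))"
  shows "\<exists>r. \<forall>xs. length xs = n \<longrightarrow> (\<exists>k. \<not> P k xs) \<longrightarrow> recf_eval r xs (LEAST k. \<not> P k xs)"
proof -
  obtain r where r: "\<And>ys. length ys = Suc n \<Longrightarrow> recf_eval r ys (of_bool (P (entry ys 0) (tl ys)))"
    using P unfolding pcomputable_def computable_def by blast
  have "recf_eval (Mn r) xs (LEAST k. \<not> P k xs)" if len: "length xs = n" and ex: "\<exists>k. \<not> P k xs" for xs
  proof (rule recf_eval.mn)
    have "\<not> P (LEAST k. \<not> P k xs) xs" using ex by (metis (mono_tags, lifting) LeastI)
    then show "recf_eval r ((LEAST k. \<not> P k xs) # xs) 0" using r[of "(LEAST k. \<not> P k xs) # xs"] len by simp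
    show "\<forall>k<LEAST k. \<not> P k xs. \<exists>y. recf_eval r (k # xs) (Suc y)"
    proof (intro allI impI)
      fix k assume "k < (LEAST k. \<not> P k xs)"
      then have "P k xs" using not_less_Least by blast
      then show "\<exists>y. recf_eval r (k # xs) (Suc y)" using r[of "k # xs"] len by (intro exI[of _ 0]) simp
    qed
  qed
  then show ?thesis by blast
qed

subsection \<open>Determinants from digit codes\<close>

text \<open>Digits in base b code finite sequences, so that quantifiers over points, sizes, tuples
  and subsets become bounded quantifiers over numbers.\<close>

definition digit :: "nat \<Rightarrow> nat \<Rightarrow> nat \<Rightarrow> nat" where
  "digit b c i = c div b ^ i mod b"

lemma digit_less: "b > 0 \<Longrightarrow> digit b c i < b"
  by (simp add: digit_def)

lemma ex_digit_code:
  assumes "\<And>i. i < n \<Longrightarrow> f i < b"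
  shows "\<exists>c<b ^ n. \<forall>i<n. digit b c i = f i"
  using assms
proof (induction n)
  case (Suc n)
  then obtain c where c: "c < b ^ n" "\<And>i. i < n \<Longrightarrow> digit b c i = f i" by (metis less_SucI)
  have fn: "f n < b" using Suc.prems by simp
  then have b: "b > 0" by simp
  let ?c = "c + f n * b ^ n"
  have "?c < b ^ Suc n"
  proof -
    have "?c < Suc (f n) * b ^ n" using c(1) by simp
    also have "\<dots> \<le> b * b ^ n" using fn by (intro mult_right_mono) auto
    finally show ?thesis by simp
  qed
  moreover have "digit b ?c i = f i" if "i < Suc n" for i
  proof (cases "i = n")
    case True
    then show ?thesis unfolding digit_def using c(1) b fn by simp
  next
    case False
    then have i: "i < n" using that by simp
    then obtain k where k: "n = i + Suc k" using less_imp_Suc_add by auto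
    define X where "X = f n * b ^ k"
    have "?c = c + b ^ i * (b * X)" unfolding k X_def by (simp add: power_add)
    then have "?c div b ^ i = c div b ^ i + b * X" using b by simp
    then show ?thesis using c(2)[OF i] unfolding digit_def by simp
  qed
  ultimately show ?case by blast
qed simp

lemma bij_betw_digits:
  assumes "b > 0"
  shows "bij_betw (\<lambda>c. restrict (digit b c) {..<n}) {..<b ^ n} ({..<n} \<rightarrow>\<^sub>E {..<b})"
proof -
  let ?h = "\<lambda>c. restrict (digit b c) {..<n}"
  have im: "?h ` {..<b ^ n} = {..<n} \<rightarrow>\<^sub>E {..<b}"
  proof
    show "?h ` {..<b ^ n} \<subseteq> {..<n} \<rightarrow>\<^sub>E {..<b}"
      by (rule image_subsetI) (use digit_less[OF assms] in \<open>auto simp: restrict_PiE_iff\<close>)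
    show "{..<n} \<rightarrow>\<^sub>E {..<b} \<subseteq> ?h ` {..<b ^ n}"
    proof
      fix f assume f: "f \<in> {..<n} \<rightarrow>\<^sub>E {..<b}"
      then have "f i < b" if "i < n" for i using that by auto
      then obtain c where c: "c < b ^ n" "\<forall>i<n. digit b c i = f i" using ex_digit_code by blast
      have "f = ?h c" using c(2) f by (auto simp: fun_eq_iff PiE_def extensional_def)
      then show "f \<in> ?h ` {..<b ^ n}" using c(1) by blast
    qed
  qed
  moreover have "inj_on ?h {..<b ^ n}"
    by (rule eq_card_imp_inj_on) (simp_all add: im card_funcsetE)
  ultimately show ?thesis unfolding bij_betw_def by blast
qed

text \<open>The sign of a permutation as a product over pairs. It is computable from the values of
  f, makes sense for every map, and is 0 as soon as two values below n coincide.\<close>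

definition inversion_sign :: "nat \<Rightarrow> (nat \<Rightarrow> nat) \<Rightarrow> int" where
  "inversion_sign n f = (\<Prod>i<n. \<Prod>j<i. sgn (int (f i) - int (f j)))"

lemma inversion_sign_pairs:
  "inversion_sign n f = (\<Prod>(i,j)\<in>{(i,j). j < i \<and> i < n}. sgn ((int (f i) - int (f j)) * (int i - int j)))"
proof -
  have "{(i,j). j < i \<and> i < n} = Sigma {..<n} (\<lambda>i. {..<i})" by auto
  then have "(\<Prod>(i,j)\<in>{(i,j). j < i \<and> i < n}. sgn ((int (f i) - int (f j)) * (int i - int j)))
      = (\<Prod>i<n. \<Prod>j<i. sgn ((int (f i) - int (f j)) * (int i - int j)))"
    by (simp add: prod.Sigma)
  also have "\<dots> = inversion_sign n f"
    unfolding inversion_sign_def by (intro prod.cong refl) (auto simp: sgn_mult)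
  finally show ?thesis by simp
qed

text \<open>The sign of the product of f i - f j and i - j depends only on the unordered pair of i and j, which a permutation merely reindexes.\<close>

lemma inversion_sign_compose:
  assumes "\<sigma> permutes {..<n}" "\<tau> permutes {..<n}"
  shows "inversion_sign n (\<sigma> \<circ> \<tau>) = inversion_sign n \<sigma> * inversion_sign n \<tau>"
proof -
  let ?P = "{(i,j). j < i \<and> i < n}"
  define g where "g \<rho> i j = sgn ((int (\<rho> i) - int (\<rho> j)) * (int i - int j))" for \<rho> :: "nat \<Rightarrow> nat" and i j
  have gsym: "g \<rho> i j = g \<rho> j i" for \<rho> i j unfolding g_def by (simp add: algebra_simps)
  have inj: "\<tau> i = \<tau> j \<longleftrightarrow> i = j" for i j using permutes_inj[OF assms(2)] by (auto simp: inj_def)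
  have mul: "g (\<sigma> \<circ> \<tau>) i j = g \<sigma> (\<tau> i) (\<tau> j) * g \<tau> i j" if "i \<noteq> j" for i j
  proof -
    have "int (\<tau> i) - int (\<tau> j) \<noteq> 0" using inj that by simp
    then have "sgn (int (\<tau> i) - int (\<tau> j)) * sgn (int (\<tau> i) - int (\<tau> j)) = 1" by (simp add: sgn_if)
    then show ?thesis unfolding g_def sgn_mult by (simp add: algebra_simps)
  qed
  define h where "h = (\<lambda>(i,j). (max (\<tau> i) (\<tau> j), min (\<tau> i) (\<tau> j)))"
  have fin: "finite ?P" by (rule finite_subset[of _ "{..<n} \<times> {..<n}"]) auto
  have "inj_on h ?P"
  proof (rule inj_onI, clarify)
    fix i j i' j' assume *: "j < i" "i < n" "j' < i'" "i' < n" "h (i,j) = h (i',j')"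
    then have "{\<tau> i, \<tau> j} = {\<tau> i', \<tau> j'}" unfolding h_def by (auto simp: max_def min_def split: if_splits)
    then have "{i, j} = {i', j'}" using inj by (auto simp: doubleton_eq_iff)
    then show "i = i' \<and> j = j'" using * by (auto simp: doubleton_eq_iff)
  qed
  moreover have "h ` ?P \<subseteq> ?P"
  proof clarify
    fix a b i j assume *: "(a,b) = h (i,j)" "j < i" "i < n"
    have "\<tau> i < n" "\<tau> j < n" using permutes_in_image[OF assms(2)] * by auto
    moreover have "\<tau> i \<noteq> \<tau> j" using inj * by simp
    ultimately show "b < a \<and> a < n" using *(1) unfolding h_def by auto
  qed
  ultimately have bij: "bij_betw h ?P ?P" using endo_inj_surj[OF fin] by (simp add: bij_betw_def)
  have "inversion_sign n (\<sigma> \<circ> \<tau>) = (\<Prod>(i,j)\<in>?P. g (\<sigma> \<circ> \<tau>) i j)"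
    unfolding inversion_sign_pairs g_def by simp
  also have "\<dots> = (\<Prod>(i,j)\<in>?P. g \<sigma> (\<tau> i) (\<tau> j) * g \<tau> i j)" by (rule prod.cong) (auto simp: mul)
  also have "\<dots> = (\<Prod>(i,j)\<in>?P. g \<sigma> (\<tau> i) (\<tau> j)) * (\<Prod>(i,j)\<in>?P. g \<tau> i j)"
    by (simp add: prod.distrib[symmetric] case_prod_unfold)
  also have "(\<Prod>(i,j)\<in>?P. g \<tau> i j) = inversion_sign n \<tau>" unfolding inversion_sign_pairs g_def by simp
  also have "(\<Prod>(i,j)\<in>?P. g \<sigma> (\<tau> i) (\<tau> j)) = (\<Prod>p\<in>?P. (\<lambda>(i,j). g \<sigma> i j) (h p))"
    by (rule prod.cong) (auto simp: h_def max_def min_def gsym)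
  also have "\<dots> = (\<Prod>(i,j)\<in>?P. g \<sigma> i j)" by (rule prod.reindex_bij_betw[OF bij])
  also have "\<dots> = inversion_sign n \<sigma>" unfolding inversion_sign_pairs g_def by simp
  finally show ?thesis .
qed

lemma inversion_sign_transpose_01:
  assumes "2 \<le> n"
  shows "inversion_sign n (transpose 0 1) = -1"
proof -
  let ?t = "transpose 0 (1::nat)"
  have big: "(\<Prod>j<i. sgn (int (?t i) - int (?t j))) = 1" if "i \<noteq> 1" for i
  proof (rule prod.neutral, intro ballI)
    fix j assume "j \<in> {..<i}"
    then have "?t j < ?t i" using that by (auto simp: transpose_def)
    then show "sgn (int (?t i) - int (?t j)) = 1" by simp
  qed
  have "inversion_sign n ?t = (\<Prod>j<1. sgn (int (?t 1) - int (?t j))) * (\<Prod>i\<in>{..<n} - {1}. \<Prod>j<i. sgn (int (?t i) - int (?t j)))"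
    unfolding inversion_sign_def using assms by (intro prod.remove) auto
  also have "(\<Prod>i\<in>{..<n} - {1}. \<Prod>j<i. sgn (int (?t i) - int (?t j))) = 1" by (rule prod.neutral) (use big in auto)
  finally show ?thesis by simp
qed

lemma inversion_sign_square:
  assumes "\<sigma> permutes {..<n}" shows "inversion_sign n \<sigma> * inversion_sign n \<sigma> = 1"
  unfolding inversion_sign_def prod.distrib[symmetric]
proof (intro prod.neutral ballI)
  fix i j :: nat assume "j \<in> {..<i}"
  then have "\<sigma> i \<noteq> \<sigma> j" using permutes_inj[OF assms] by (auto simp: inj_def)
  then show "sgn (int (\<sigma> i) - int (\<sigma> j)) * sgn (int (\<sigma> i) - int (\<sigma> j)) = 1" by (simp add: sgn_if)
qed

text \<open>The product formula is multiplicative with square 1 on permutations, so conjugate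
  transpositions have equal values, and all are conjugate to the exchange of 0 and 1.\<close>

lemma inversion_sign_transpose:
  assumes "a \<noteq> b" "a < n" "b < n"
  shows "inversion_sign n (transpose a b) = -1"
proof -
  let ?e = "\<lambda>a b. inversion_sign n (transpose a b)"
  have perm: "transpose a b permutes {..<n}" if "a < n" "b < n" for a b
    using that by (intro permutes_swap_id) auto
  have conj: "?e a c = ?e b c" if "a \<noteq> c" "b \<noteq> c" "a < n" "b < n" "c < n" for a b c
  proof -
    have "transpose a b \<circ> transpose b c \<circ> transpose a b = transpose a c"
      using that by (intro transpose_comp_triple) auto
    then have "?e a c = inversion_sign n (transpose a b \<circ> transpose b c \<circ> transpose a b)" by simp
    also have "\<dots> = ?e a b * ?e b c * ?e a b"
      using that perm by (simp add: inversion_sign_compose permutes_compose)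
    also have "\<dots> = ?e b c * (?e a b * ?e a b)" by (simp add: algebra_simps)
    also have "\<dots> = ?e b c" using inversion_sign_square[OF perm] that by simp
    finally show ?thesis .
  qed
  have n: "2 \<le> n" "0 < n" "1 < n" using assms by auto
  have zero: "?e 0 b = -1" if "b \<noteq> 0" "b < n" for b
    using conj[of b 0 1] inversion_sign_transpose_01[OF n(1)] n that by (metis transpose_commute zero_neq_one)
  show ?thesis
  proof (cases "b = 0")
    case True
    then show ?thesis using zero[of a] assms by (simp add: transpose_commute)
  next
    case False
    then show ?thesis using conj[of a b 0] zero[of b] assms n by metis
  qed
qed

lemma sign_eq_inversion_sign:
  assumes "\<sigma> permutes {..<n}"
  shows "sign \<sigma> = inversion_sign n \<sigma>"
  using assms finite_lessThan[of n]
proof (induction rule: permutes_induct)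
  case id
  have "inversion_sign n id = 1" unfolding inversion_sign_def by (intro prod.neutral ballI) auto
  then show ?case by (simp only: sign_id)
next
  case (swap a b p)
  have perm: "transpose a b permutes {..<n}" using swap.hyps(1,2) by (rule permutes_swap_id)
  have "sign (transpose a b \<circ> p) = sign (transpose a b) * sign p"
    using swap.hyps by (intro sign_compose permutation_swap_id permutation_permutes[THEN iffD2] exI[of _ "{..<n}"] conjI) auto
  also have "\<dots> = - inversion_sign n p" using swap by (simp add: sign_swap_id)
  also have "\<dots> = inversion_sign n (transpose a b \<circ> p)"
    using inversion_sign_compose[OF perm] inversion_sign_transpose[of a b n] swap.hyps by simp
  finally show ?case .
qed

text \<open>The n-digit numbers in base n code all maps on {..<n}; those that are not injective contribute 0.\<close>

definition code_det :: "nat \<Rightarrow> (nat \<Rightarrow> nat \<Rightarrow> int) \<Rightarrow> int" where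
  "code_det n A = (\<Sum>c<n ^ n. inversion_sign n (digit n c) * (\<Prod>i<n. A i (digit n c i)))"

lemma code_det_eq: "of_int (code_det n A) = det_n n (\<lambda>i j. of_int (A i j))"
proof (cases "n = 0")
  case True
  then show ?thesis by (simp add: code_det_def det_n_def inversion_sign_def)
next
  case False
  define F where "F f = inversion_sign n f * (\<Prod>i<n. A i (f i))" for f
  have Fr: "F (restrict f {..<n}) = F f" for f
  proof -
    have "inversion_sign n (restrict f {..<n}) = inversion_sign n f"
      unfolding inversion_sign_def by (intro prod.cong refl) auto
    moreover have "(\<Prod>i<n. A i (restrict f {..<n} i)) = (\<Prod>i<n. A i (f i))" by (intro prod.cong) auto
    ultimately show ?thesis unfolding F_def by simp
  qed
  have "code_det n A = (\<Sum>c<n ^ n. F (restrict (digit n c) {..<n}))"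
    unfolding Fr unfolding code_det_def F_def ..
  also have "\<dots> = (\<Sum>f\<in>{..<n} \<rightarrow>\<^sub>E {..<n}. F f)"
    using False by (intro sum.reindex_bij_betw bij_betw_digits) simp
  also have "\<dots> = (\<Sum>f\<in>{f\<in>{..<n} \<rightarrow>\<^sub>E {..<n}. inj_on f {..<n}}. F f)"
  proof (rule sum.mono_neutral_right)
    show "\<forall>f\<in>({..<n} \<rightarrow>\<^sub>E {..<n}) - {f\<in>{..<n} \<rightarrow>\<^sub>E {..<n}. inj_on f {..<n}}. F f = 0"
    proof
      fix f assume "f \<in> ({..<n} \<rightarrow>\<^sub>E {..<n}) - {f\<in>{..<n} \<rightarrow>\<^sub>E {..<n}. inj_on f {..<n}}"
      then obtain i j where ij: "i < n" "j < n" "f i = f j" "i \<noteq> j" unfolding inj_on_def by auto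
      have "\<exists>i j. j < i \<and> i < n \<and> f i = f j" using ij by (metis linorder_neqE_nat)
      then obtain i j where ij: "j < i" "i < n" "f i = f j" by blast
      have z: "(\<Prod>j<i. sgn (int (f i) - int (f j))) = 0" using ij by (intro prod_zero bexI[of _ j]) auto
      have "inversion_sign n f = 0" unfolding inversion_sign_def
      proof (rule prod_zero)
        show "\<exists>i\<in>{..<n}. (\<Prod>j<i. sgn (int (f i) - int (f j))) = 0" using ij(2) by (intro bexI[of _ i] z) simp
      qed simp
      then show "F f = 0" unfolding F_def by simp
    qed
  qed (auto intro: finite_PiE)
  also have "\<dots> = (\<Sum>\<sigma> | \<sigma> permutes {..<n}. F \<sigma>)"
  \<comment> \<open>Injective maps on \<open>{..<n}\<close> extend to permutations by the identity;
    restriction inverts this.\<close>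
  proof (rule sum.reindex_bij_witness[where i = "\<lambda>\<sigma>. restrict \<sigma> {..<n}" and j = "\<lambda>f x. if x < n then f x else x"])
    fix f assume "f \<in> {f\<in>{..<n} \<rightarrow>\<^sub>E {..<n}. inj_on f {..<n}}"
    then have f: "f \<in> {..<n} \<rightarrow>\<^sub>E {..<n}" "inj_on f {..<n}" by auto
    show "restrict (\<lambda>x. if x < n then f x else x) {..<n} = f"
      using f(1) by (auto simp: fun_eq_iff PiE_def extensional_def)
    have "f ` {..<n} = {..<n}" using f by (intro endo_inj_surj) auto
    then have "bij_betw (\<lambda>x. if x < n then f x else x) {..<n} {..<n}"
      using f(2) by (auto simp: bij_betw_def inj_on_def)
    then show "(\<lambda>x. if x < n then f x else x) \<in> {\<sigma>. \<sigma> permutes {..<n}}"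
      by (intro CollectI bij_imp_permutes) auto
    show "F (\<lambda>x. if x < n then f x else x) = F f"
      using Fr[of "\<lambda>x. if x < n then f x else x"] \<open>restrict (\<lambda>x. if x < n then f x else x) {..<n} = f\<close> by simp
  next
    fix \<sigma> assume "\<sigma> \<in> {\<sigma>. \<sigma> permutes {..<n}}"
    then have \<sigma>: "\<sigma> permutes {..<n}" by simp
    show "(\<lambda>x. if x < n then restrict \<sigma> {..<n} x else x) = \<sigma>"
      using permutes_not_in[OF \<sigma>] by auto
    show "restrict \<sigma> {..<n} \<in> {f\<in>{..<n} \<rightarrow>\<^sub>E {..<n}. inj_on f {..<n}}"
      using permutes_in_image[OF \<sigma>] permutes_inj_on[OF \<sigma>, of "{..<n}"] by (auto simp: inj_on_def)
  qed
  also have "\<dots> = (\<Sum>\<sigma> | \<sigma> permutes {..<n}. sign \<sigma> * (\<Prod>i<n. A i (\<sigma> i)))"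
    unfolding F_def by (rule sum.cong) (auto simp: sign_eq_inversion_sign)
  finally show ?thesis unfolding det_n_def by simp
qed

subsection \<open>The decision problem on codes\<close>

definition grid_radius :: "nat \<Rightarrow> nat \<Rightarrow> nat" where
  "grid_radius T d = real_bound T d * grid_den T d"

text \<open>A code x lists the integer numerators of all coordinates, shifted to be non-negative, as digits; the common denominator is
  \<open>grid_den T d\<close>.  The j-th point of the i-th set has the label i * N + j, the i-th set has
  Suc (digit N v i) points, t codes a tuple of d+1 labels, and y is the bit mask of the selected labels.\<close>

definition code_coord :: "nat \<Rightarrow> nat \<Rightarrow> nat \<Rightarrow> nat \<Rightarrow> nat \<Rightarrow> int" where
  "code_coord T d x l k = int (digit (2 * grid_radius T d + 1) x (l * d + k)) - int (grid_radius T d)"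

text \<open>Each row is multiplied by the common denominator, which keeps the entries integral and
  the sign unchanged; this is why column 0 holds \<open>grid_den T d\<close>.\<close>

definition code_orient :: "nat \<Rightarrow> nat \<Rightarrow> nat \<Rightarrow> nat \<Rightarrow> int" where
  "code_orient T d x t = sgn (code_det (Suc d)
     (\<lambda>i j. if j = 0 then int (grid_den T d) else code_coord T d x (digit T t i) (j - 1)))"

definition label_ok :: "nat \<Rightarrow> nat \<Rightarrow> nat \<Rightarrow> bool" where
  "label_ok N v l \<longleftrightarrow> l mod N \<le> digit N v (l div N)"

definition code_gen_pos :: "nat \<Rightarrow> nat \<Rightarrow> nat \<Rightarrow> nat \<Rightarrow> nat \<Rightarrow> bool" where
  "code_gen_pos N T d x v \<longleftrightarrow> (\<forall>t<T ^ Suc d.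
     (\<forall>i<Suc d. label_ok N v (digit T t i)) \<and> (\<forall>i<Suc d. \<forall>j<i. \<not> digit T t i = digit T t j) \<longrightarrow>
     \<not> code_orient T d x t = 0)"

definition tuple_ok :: "nat \<Rightarrow> nat \<Rightarrow> nat \<Rightarrow> nat \<Rightarrow> nat \<Rightarrow> nat \<Rightarrow> bool" where
  "tuple_ok N T d v y t \<longleftrightarrow> (\<forall>i<Suc d. label_ok N v (digit T t i) \<and> digit 2 y (digit T t i) = 1)"

definition code_same_type :: "nat \<Rightarrow> nat \<Rightarrow> nat \<Rightarrow> nat \<Rightarrow> nat \<Rightarrow> nat \<Rightarrow> bool" where
  "code_same_type N T d x v y \<longleftrightarrow> (\<forall>t<T ^ Suc d. \<forall>t'<T ^ Suc d.
     tuple_ok N T d v y t \<and> tuple_ok N T d v y t' \<and>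
     (\<forall>i<Suc d. digit T t i div N = digit T t' i div N) \<and>
     (\<forall>i<d. digit T t i div N < digit T t (Suc i) div N) \<longrightarrow>
     code_orient T d x t = code_orient T d x t')"

definition code_card :: "nat \<Rightarrow> nat \<Rightarrow> nat \<Rightarrow> nat \<Rightarrow> nat" where
  "code_card N v y i = (\<Sum>j<Suc (digit N v i). digit 2 y (i * N + j))"

definition density_bound_for :: "nat \<Rightarrow> nat \<Rightarrow> nat \<Rightarrow> nat \<Rightarrow> nat \<Rightarrow> nat \<Rightarrow> bool" where
  "density_bound_for N T m d p q \<longleftrightarrow>
    (\<forall>x<(2 * grid_radius T d + 1) ^ (T * d). \<forall>v<N ^ m. code_gen_pos N T d x v \<longrightarrow>
      (\<exists>y<2 ^ T. code_same_type N T d x v y \<and> (\<forall>i<m. p * Suc (digit N v i) \<le> q * code_card N v y i)))"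

text \<open>The step 1/(2b) of the tested densities equals the sampling error, and each set is given
  as many labels as a sample may have points.\<close>

definition density_bound :: "nat \<Rightarrow> nat \<Rightarrow> nat \<Rightarrow> nat \<Rightarrow> bool" where
  "density_bound m d b p \<longleftrightarrow> density_bound_for (sample_size m d b) (m * sample_size m d b) m d p (2 * b)"

lemma computable_digit:
  assumes "computable n A" "computable n B" "computable n C"
  shows "computable n (\<lambda>xs. digit (A xs) (B xs) (C xs))"
  unfolding digit_def by (intro computable_mod computable_div computable_power assms)

lemma computable_back_level: "computable (Suc 0) (\<lambda>xs. back_level (entry xs 0))"
  unfolding back_level_def
  by (intro computable_power computable_add computable_mult computable_const computable_entry) simp

lemma computable_real_bound:
  assumes "computable n A" "computable n B"
  shows "computable n (\<lambda>xs. real_bound (A xs) (B xs))"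
  unfolding real_bound_def det_level_def
  by (intro computable_add computable_power computable_const computable_funpow computable_back_level
      computable_mult computable_fact computable_Suc assms)

lemma computable_grid_den:
  assumes "computable n A" "computable n B"
  shows "computable n (\<lambda>xs. grid_den (A xs) (B xs))"
  unfolding grid_den_def
  by (intro computable_add computable_power computable_const computable_mult computable_fact computable_Suc
      computable_real_bound assms)

lemma computable_sample_size:
  assumes "computable n A" "computable n B" "computable n C"
  shows "computable n (\<lambda>xs. sample_size (A xs) (B xs) (C xs))"
  unfolding sample_size_def
  by (intro computable_add computable_power computable_const computable_mult computable_Suc assms)

lemma computable_grid_radius:
  assumes "computable n A" "computable n B"
  shows "computable n (\<lambda>xs. grid_radius (A xs) (B xs))"
  unfolding grid_radius_def by (intro computable_mult computable_real_bound computable_grid_den assms)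

lemma computable_comp4:
  assumes "computable (Suc (Suc (Suc (Suc 0)))) (\<lambda>xs. f (entry xs 0) (entry xs (Suc 0)) (entry xs (Suc (Suc 0))) (entry xs (Suc (Suc (Suc 0)))))"
    "computable n A" "computable n B" "computable n C" "computable n D"
  shows "computable n (\<lambda>xs. f (A xs) (B xs) (C xs) (D xs))"
  using computable_comp[of "[A,B,C,D]"
      "\<lambda>xs. f (entry xs 0) (entry xs (Suc 0)) (entry xs (Suc (Suc 0))) (entry xs (Suc (Suc (Suc 0))))" n] assms by auto

lemmas computable_rules =
  computable_const computable_entry computable_Suc computable_add computable_mult computable_diff computable_power
  computable_div computable_mod computable_digit computable_grid_radius computable_grid_den computable_sample_size
  computable_sum
  icomputable_const icomputable_of_nat icomputable_diff icomputable_mult icomputable_sgn icomputable_if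
  icomputable_sum icomputable_prod
  pcomputable_not pcomputable_conj pcomputable_imp pcomputable_ball pcomputable_bex
  pcomputable_eq pcomputable_ieq pcomputable_le pcomputable_less

lemma icomputable_code_orient:
  assumes "computable n A" "computable n B" "computable n C" "computable n D"
  shows "icomputable n (\<lambda>xs. code_orient (A xs) (B xs) (C xs) (D xs))"
proof -
  have "icomputable (Suc (Suc (Suc (Suc 0)))) (\<lambda>xs. code_orient (entry xs 0) (entry xs (Suc 0)) (entry xs (Suc (Suc 0))) (entry xs (Suc (Suc (Suc 0)))))"
    unfolding code_orient_def code_det_def inversion_sign_def code_coord_def
    by (rule computable_rules | (unfold entry_tl) | simp)+
  then show ?thesis unfolding icomputable_def
    using computable_comp4[of "\<lambda>a b c d. nat (code_orient a b c d)", OF _ assms]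
      computable_comp4[of "\<lambda>a b c d. nat (- code_orient a b c d)", OF _ assms] by blast
qed

text \<open>Argument 0 is the search variable, followed by the input m, d, a, b; so m, d and b have
  indices 1, 2 and 4. The successor is taken because the numerator 0 needs no test.\<close>

lemma pcomputable_density_bound:
  "pcomputable (Suc (Suc (Suc (Suc (Suc 0))))) (\<lambda>xs. density_bound (entry xs (Suc 0)) (entry xs (Suc (Suc 0))) (entry xs (Suc (Suc (Suc (Suc 0))))) (Suc (entry xs 0)))"
  unfolding density_bound_def density_bound_for_def code_gen_pos_def code_same_type_def code_card_def tuple_ok_def label_ok_def
  by (rule icomputable_code_orient computable_rules | (unfold entry_tl) | simp)+

subsection \<open>Correctness\<close>

lemma det_n_scale: "det_n n (\<lambda>i j. a * B i j) = a ^ n * det_n n B"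
  unfolding det_n_def by (simp add: prod.distrib sum_distrib_left mult.left_commute)

lemma code_orient_eq:
  assumes "\<And>i. i \<le> d \<Longrightarrow> digit T t i = \<tau> i"
    and "\<And>i k. i \<le> d \<Longrightarrow> k < d \<Longrightarrow> ys i k = of_int (code_coord T d x (\<tau> i) k) / grid_den T d"
  shows "orientation d ys = of_int (code_orient T d x t)"
proof -
  let ?q = "real (grid_den T d)"
  let ?A = "\<lambda>i j. if j = 0 then int (grid_den T d) else code_coord T d x (digit T t i) (j - 1)"
  have q: "?q > 0" using grid_den_pos by simp
  have "real_of_int (code_det (Suc d) ?A) = det_n (Suc d) (\<lambda>i j. of_int (?A i j))" by (rule code_det_eq)
  also have "\<dots> = det_n (Suc d) (\<lambda>i j. ?q * (if j = 0 then 1 else ys i (j - 1)))"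
  proof (rule det_n_cong)
    fix i j assume "i < Suc d" "j < Suc d"
    then show "of_int (?A i j) = ?q * (if j = 0 then 1 else ys i (j - 1))"
      using assms(1)[of i] assms(2)[of i "j - 1"] q by auto
  qed
  also have "\<dots> = ?q ^ Suc d * hdet d ys" unfolding det_n_scale hdet_def ..
  finally have "sgn (real_of_int (code_det (Suc d) ?A)) = sgn (hdet d ys)" using q by (simp add: sgn_mult)
  moreover have "sgn (real_of_int k) = of_int (sgn k)" for k by (simp add: sgn_if)
  ultimately show ?thesis unfolding code_orient_def orientation_eq by simp
qed

lemma ex_point_code:
  assumes "\<And>l k. l < T \<Longrightarrow> k < d \<Longrightarrow> \<bar>z l k\<bar> \<le> int (grid_radius T d)"
  shows "\<exists>x<(2 * grid_radius T d + 1) ^ (T * d). \<forall>l<T. \<forall>k<d. code_coord T d x l k = z l k"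
proof -
  let ?R = "grid_radius T d"
  define f where "f i = nat (z (i div d) (i mod d) + int ?R)" for i
  have "f i < 2 * ?R + 1" if "i < T * d" for i
  proof -
    have "d > 0" using that by (cases d) auto
    then have "i div d < T" "i mod d < d" using that by (auto simp: div_less_iff_less_mult)
    from assms[OF this] show ?thesis unfolding f_def by auto
  qed
  from ex_digit_code[of "T * d" f, OF this] obtain x where
    x: "x < (2 * ?R + 1) ^ (T * d)" "\<And>i. i < T * d \<Longrightarrow> digit (2 * ?R + 1) x i = f i" by blast
  have "code_coord T d x l k = z l k" if lk: "l < T" "k < d" for l k
  proof -
    have "l * d + k < Suc l * d" using lk by simp
    also have "\<dots> \<le> T * d" using lk by (intro mult_right_mono) auto
    finally have "digit (2 * ?R + 1) x (l * d + k) = nat (z l k + int ?R)"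
      using x(2) lk unfolding f_def by simp
    then show ?thesis unfolding code_coord_def using assms[OF lk] by simp
  qed
  then show ?thesis using x(1) by blast
qed

section \<open>Elementary bounds on c\<close>

definition densities :: "nat \<Rightarrow> nat \<Rightarrow> (nat \<Rightarrow> point set) \<Rightarrow> real set" where
  "densities d m X = {c. \<exists>Y. same_type d m Y \<and>
       (\<forall>i<m. Y i \<subseteq> X i \<and> c * real (card (X i)) \<le> real (card (Y i)))}"

lemma c_fam_eq: "c_fam d m X = Sup (densities d m X)"
  unfolding c_fam_def densities_def ..

lemma zero_in_densities: "0 \<in> densities d m X"
  unfolding densities_def same_type_def by (intro CollectI exI[of _ "\<lambda>_. {}"]) auto

lemma densities_le_1:
  assumes "m \<ge> 1" "finite (X 0)" "X 0 \<noteq> {}" "c \<in> densities d m X"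
  shows "c \<le> 1"
proof -
  obtain Y where Y: "Y 0 \<subseteq> X 0" "c * real (card (X 0)) \<le> real (card (Y 0))"
    using assms(1,4) unfolding densities_def by auto
  have "card (Y 0) \<le> card (X 0)" using Y(1) assms(2) by (rule card_mono[rotated])
  then have "c * real (card (X 0)) \<le> 1 * real (card (X 0))" using Y(2) by simp
  moreover have "real (card (X 0)) > 0" using assms by (simp add: card_gt_0_iff)
  ultimately show ?thesis by (simp only: mult_le_cancel_right_pos)
qed

definition families :: "nat \<Rightarrow> nat \<Rightarrow> (nat \<Rightarrow> point set) set" where
  "families d m = {X. gen_pos_family d m X \<and> (\<forall>i<m. finite (X i) \<and> X i \<noteq> {})}"

lemma c_const_eq: "c_const m d = Inf (c_fam d m ` families d m)"
  unfolding c_const_def families_def by (rule arg_cong[of _ _ Inf]) auto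

lemma c_fam_bounds:
  assumes "m \<ge> 1" "X \<in> families d m"
  shows "bdd_above (densities d m X)" "0 \<le> c_fam d m X" "c_fam d m X \<le> 1"
proof -
  have le: "c \<le> 1" if "c \<in> densities d m X" for c
    using densities_le_1[OF assms(1) _ _ that] assms unfolding families_def by auto
  show bdd: "bdd_above (densities d m X)" by (rule bdd_aboveI) (rule le)
  show "0 \<le> c_fam d m X" unfolding c_fam_eq by (rule cSup_upper[OF zero_in_densities bdd])
  show "c_fam d m X \<le> 1" unfolding c_fam_eq by (rule cSup_least) (use zero_in_densities[of d m X] le in auto)
qed

lemma c_const_le_c_fam:
  assumes "m \<ge> 1" "X \<in> families d m" shows "c_const m d \<le> c_fam d m X"
  unfolding c_const_eq
proof (rule cInf_lower)
  show "bdd_below (c_fam d m ` families d m)" 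
    by (rule bdd_belowI2) (rule c_fam_bounds(2)[OF assms(1)])
qed (use assms in auto)

text \<open>On the moment curve a dependence between the columns is a nonzero polynomial of degree
  at most d with d + 1 roots.\<close>

lemma moment_orientation_nonzero:
  assumes a: "inj_on a {..d}" and ys: "\<And>i k. i \<le> d \<Longrightarrow> k < d \<Longrightarrow> ys i k = a i ^ Suc k"
  shows "orientation d ys \<noteq> 0"
proof
  assume "orientation d ys = 0"
  then have "det_n (Suc d) (\<lambda>i j. if j = 0 then 1 else ys i (j - 1)) = 0"
    by (simp add: orientation_def sgn_0_0)
  moreover have "det_n (Suc d) (\<lambda>i j. if j = 0 then 1 else ys i (j - 1)) = det_n (Suc d) (\<lambda>i j. a i ^ j)"
  proof (rule det_n_cong)
    fix i j assume "i < Suc d" "j < Suc d"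
    then show "(if j = 0 then 1 else ys i (j - 1)) = a i ^ j" using ys[of i "j - 1"] by (cases j) auto
  qed
  ultimately have "det_n (Suc d) (\<lambda>i j. a i ^ j) = 0" by simp
  then obtain c where c: "\<exists>j<Suc d. c j \<noteq> 0" "\<And>i. i < Suc d \<Longrightarrow> (\<Sum>j<Suc d. a i ^ j * c j) = 0"
    unfolding det_n_0_iff_cols by blast
  define p where "p = (\<Sum>j<Suc d. monom (c j) j)"
  have cp: "coeff p j = (if j < Suc d then c j else 0)" for j
    unfolding p_def by (simp add: coeff_sum)
  have "p \<noteq> 0" using c(1) cp by (metis coeff_0)
  have deg: "degree p \<le> d" by (rule degree_le) (simp add: cp)
  have "poly p (a i) = 0" if "i \<le> d" for i
  proof -
    have "poly p (a i) = (\<Sum>j<Suc d. a i ^ j * c j)"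
      unfolding p_def poly_sum by (intro sum.cong refl) (simp add: poly_monom)
    then show ?thesis using c(2)[of i] that by simp
  qed
  then have "a ` {..d} \<subseteq> {x. poly p x = 0}" by auto
  then have "card (a ` {..d}) \<le> card {x. poly p x = 0}" using poly_roots_finite[OF \<open>p \<noteq> 0\<close>] by (rule card_mono[rotated])
  also have "\<dots> \<le> degree p" by (rule card_poly_roots_bound[OF \<open>p \<noteq> 0\<close>])
  finally show False using card_image[OF a] deg by simp
qed

text \<open>Points of the moment curve, taken as one-element sets. Without any family the infimum
  would carry no information.\<close>

lemma families_nonempty:
  assumes "d \<ge> 1" shows "families d m \<noteq> {}"
proof -
  define pt where "pt i = (\<lambda>k. if k < d then real i ^ Suc k else 0)" for i :: nat
  define X where "X i = {pt i}" for i
  have inj: "pt i = pt j \<longleftrightarrow> i = j" for i j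
  proof
    assume "pt i = pt j"
    then have "pt i 0 = pt j 0" by simp
    then show "i = j" using assms unfolding pt_def by simp
  qed simp
  have "gen_pos_points d (\<Union>i<m. X i)"
    unfolding gen_pos_points_def
  proof (intro allI impI)
    fix ys assume ys: "\<forall>i\<le>d. ys i \<in> (\<Union>i<m. X i)" "inj_on ys {..d}"
    then have "\<forall>i. \<exists>n. i \<le> d \<longrightarrow> ys i = pt n" unfolding X_def by blast
    then obtain n where n: "\<And>i. i \<le> d \<Longrightarrow> ys i = pt (n i)" by metis
    have "inj_on (\<lambda>i. real (n i)) {..d}"
      using ys(2) n by (auto simp: inj_on_def)
    then show "orientation d ys \<noteq> 0"
      by (rule moment_orientation_nonzero) (simp add: n pt_def)
  qed
  then have "X \<in> families d m"
    unfolding families_def gen_pos_family_def in_Rd_def X_def using inj by (auto simp: pt_def[of _, THEN fun_cong])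
  then show ?thesis by blast
qed

section \<open>Lower bound: from families to codes\<close>

lemma sample_size_pos: "sample_size m d b > 0"
  by (simp add: sample_size_def)

lemma label_div_mod:
  fixes i j m N :: nat
  assumes "i < m" "j < N"
  shows "i * N + j < m * N" "(i * N + j) div N = i" "(i * N + j) mod N = j"
proof -
  have "i * N + j < Suc i * N" using assms by simp
  also have "\<dots> \<le> m * N" using assms by (intro mult_right_mono) auto
  finally show "i * N + j < m * N" .
qed (use assms in auto)

lemma code_card_eq: "code_card N v y i = card {j. j < Suc (digit N v i) \<and> digit 2 y (i * N + j) = 1}"
proof -
  have "digit 2 y l = of_bool (digit 2 y l = 1)" for l using digit_less[of 2 y l] by auto
  then have "code_card N v y i = (\<Sum>j<Suc (digit N v i). of_bool (digit 2 y (i * N + j) = 1))"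
    unfolding code_card_def by (intro sum.cong refl)
  also have "\<dots> = card ({..<Suc (digit N v i)} \<inter> {j. digit 2 y (i * N + j) = 1})"
    by (subst sum_of_bool_eq) auto
  also have "{..<Suc (digit N v i)} \<inter> {j. digit 2 y (i * N + j) = 1} = {j. j < Suc (digit N v i) \<and> digit 2 y (i * N + j) = 1}"
    by auto
  finally show ?thesis .
qed

lemma gen_pos_orientation:
  assumes "gen_pos_family d m X" "\<forall>i\<le>d. ys i \<in> (\<Union>i<m. X i)" "inj_on ys {..d}"
  shows "orientation d ys \<noteq> 0"
  using assms(1)[unfolded gen_pos_family_def gen_pos_points_def] assms(2,3) by simp

text \<open>The family is replaced by its sample, labelled, and realised on the grid without
  changing the orientation of any nondegenerate tuple. The mask y found for the code gives a
  same-type selection in the sample, and \<open>sampling\<close> carries it back at a loss of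
  1/(2b).\<close>

lemma density_bound_lower:
  assumes m: "m \<ge> 1" and d: "d \<ge> 1" and b: "b \<ge> 1" and bound: "density_bound m d b p" and p: "p \<ge> 1"
    and X: "X \<in> families d m"
  shows "real p / (2 * real b) - 1 / (2 * real b) \<le> c_fam d m X"
proof -
  define N where "N = sample_size m d b"
  define T where "T = m * N"
  have N0: "N > 0" unfolding N_def by (rule sample_size_pos)
  have T0: "T > 0" unfolding T_def using N0 m by simp
  have gp: "gen_pos_family d m X" and finX: "\<And>i. i < m \<Longrightarrow> finite (X i) \<and> X i \<noteq> {}"
    using X unfolding families_def by auto
  obtain X' where X': "\<And>i. i < m \<Longrightarrow> X' i \<subseteq> X i \<and> X' i \<noteq> {} \<and> card (X' i) \<le> N"
    "\<And>Y'. same_type d m Y' \<Longrightarrow> (\<forall>i<m. Y' i \<subseteq> X' i \<and> Y' i \<noteq> {}) \<Longrightarrow>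
      \<exists>Y. same_type d m Y \<and> (\<forall>i<m. Y i \<subseteq> X i \<and> card (Y' i) / card (X' i) \<le> card (Y i) / card (X i) + 1 / (2 * real b))"
    using sampling[OF gp finX b] unfolding N_def by blast
  have finX': "finite (X' i)" if "i < m" for i using X'(1) finX that finite_subset by metis
  have "\<forall>i. \<exists>e. i < m \<longrightarrow> bij_betw e {0..<card (X' i)} (X' i)" using ex_bij_betw_nat_finite[OF finX'] by blast
  then obtain e where e: "\<And>i. i < m \<Longrightarrow> bij_betw (e i) {0..<card (X' i)} (X' i)" by metis
  have c1: "card (X' i) \<ge> 1" if "i < m" for i using X'(1)[OF that] finX'[OF that] by (simp add: Suc_le_eq card_gt_0_iff)
  have "card (X' i) - 1 < N" if "i < m" for i using X'(1)[OF that] c1[OF that] by linarith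
  from ex_digit_code[of m "\<lambda>i. card (X' i) - 1", OF this] obtain v where v: "v < N ^ m" "\<And>i. i < m \<Longrightarrow> digit N v i = card (X' i) - 1" by blast
  have sv: "Suc (digit N v i) = card (X' i)" if "i < m" for i using v(2)[OF that] c1[OF that] by simp
  \<comment> \<open>Labels beyond the size of their set denote arbitrary points;
    \<open>label_ok\<close> excludes them wherever it matters.\<close>
  define P where "P l = e (l div N) (l mod N)" for l
  have lab: "l div N < m" "l mod N < card (X' (l div N))" if "l < T" "label_ok N v l" for l
  proof -
    show 1: "l div N < m" using that(1) N0 unfolding T_def by (simp add: div_less_iff_less_mult)
    show "l mod N < card (X' (l div N))" using that(2) sv[OF 1] unfolding label_ok_def by simp
  qed
  have PX: "P l \<in> X' (l div N)" if "l < T" "label_ok N v l" for l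
    using bij_betwE[OF e[OF lab(1)[OF that]]] lab(2)[OF that] unfolding P_def by auto
  have Pinj: "l = l'" if l: "l < T" "label_ok N v l" "l' < T" "label_ok N v l'" "P l = P l'" for l l'
  proof -
    have "l div N = l' div N"
    proof (rule ccontr)
      assume ne: "l div N \<noteq> l' div N"
      have "X (l div N) \<inter> X (l' div N) = {}"
        using gp ne lab(1)[OF l(1,2)] lab(1)[OF l(3,4)] unfolding gen_pos_family_def by blast
      moreover have "P l \<in> X (l div N)" "P l' \<in> X (l' div N)"
        using PX[OF l(1,2)] PX[OF l(3,4)] X'(1) lab(1)[OF l(1,2)] lab(1)[OF l(3,4)] by blast+
      ultimately show False using l(5) by auto
    qed
    moreover have "l mod N = l' mod N"
    proof -
      have "inj_on (e (l div N)) {0..<card (X' (l div N))}" using e[OF lab(1)[OF l(1,2)]] by (rule bij_betw_imp_inj_on)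
      then show ?thesis using l(5) lab(2)[OF l(1,2)] lab(2)[OF l(3,4)] calculation unfolding P_def inj_on_def by auto
    qed
    ultimately show ?thesis by (metis div_mult_mod_eq)
  qed
  obtain z where z: "\<And>l k. l < T \<Longrightarrow> k < d \<Longrightarrow> \<bar>z l k\<bar> \<le> int (grid_radius T d)"
    "\<And>\<tau>. (\<forall>i\<le>d. \<tau> i < T) \<Longrightarrow> orientation d (\<lambda>i. P (\<tau> i)) \<noteq> 0 \<Longrightarrow>
       orientation d (\<lambda>i k. of_int (z (\<tau> i) k) / grid_den T d) = orientation d (\<lambda>i. P (\<tau> i))"
    using grid_realization[of T d P] unfolding grid_radius_def by blast
  obtain x where x: "x < (2 * grid_radius T d + 1) ^ (T * d)" "\<And>l k. l < T \<Longrightarrow> k < d \<Longrightarrow> code_coord T d x l k = z l k"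
    using ex_point_code[of T d z, OF z(1)] by blast
  \<comment> \<open>The realisation preserves only nonzero orientations; general position supplies
    this condition at each application.\<close>
  have orient: "orientation d (\<lambda>i. P (digit T t i)) = of_int (code_orient T d x t)"
    if "orientation d (\<lambda>i. P (digit T t i)) \<noteq> 0" for t
  proof -
    have lt: "digit T t i < T" for i using digit_less[OF T0] .
    have "orientation d (\<lambda>i. P (digit T t i)) = orientation d (\<lambda>i k. of_int (z (digit T t i) k) / grid_den T d)"
      using z(2)[of "digit T t"] that lt by simp
    also have "\<dots> = of_int (code_orient T d x t)"
      by (rule code_orient_eq[of d T t "digit T t"]) (use x(2) lt in auto)
    finally show ?thesis .
  qed
  have gpc: "code_gen_pos N T d x v"
    unfolding code_gen_pos_def
  proof (intro allI impI notI)
    fix t assume t: "(\<forall>i<Suc d. label_ok N v (digit T t i)) \<and> (\<forall>i<Suc d. \<forall>j<i. digit T t i \<noteq> digit T t j)"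
      and z0: "code_orient T d x t = 0"
    have lt: "digit T t i < T" for i using digit_less[OF T0] .
    have "inj_on (\<lambda>i. P (digit T t i)) {..d}"
    proof (rule inj_onI)
      fix i j assume ij: "i \<in> {..d}" "j \<in> {..d}" "P (digit T t i) = P (digit T t j)"
      then have "digit T t i = digit T t j" using Pinj[of "digit T t i" "digit T t j"] lt t by auto
      then show "i = j" using t ij by (metis atMost_iff less_Suc_eq_le linorder_neqE_nat)
    qed
    moreover have "\<forall>i\<le>d. P (digit T t i) \<in> (\<Union>i<m. X i)"
      using PX[OF lt] lab(1)[OF lt] t X'(1) by (metis UN_iff lessThan_iff less_Suc_eq_le subsetD)
    ultimately have "orientation d (\<lambda>i. P (digit T t i)) \<noteq> 0"
      by (intro gen_pos_orientation[OF gp])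
    then show False using orient[of t] z0 by simp
  qed
  have "\<exists>y<2 ^ T. code_same_type N T d x v y \<and> (\<forall>i<m. p * Suc (digit N v i) \<le> 2 * b * code_card N v y i)"
  proof -
    have "density_bound_for N T m d p (2 * b)" using bound unfolding density_bound_def N_def T_def .
    from this[unfolded density_bound_for_def, rule_format, OF x(1) v(1) gpc] show ?thesis .
  qed
  then obtain y where y: "code_same_type N T d x v y" "\<And>i. i < m \<Longrightarrow> p * Suc (digit N v i) \<le> 2 * b * code_card N v y i"
    by blast
  define Y' where "Y' i = e i ` {j. j < card (X' i) \<and> digit 2 y (i * N + j) = 1}" for i
  have Y'X: "Y' i \<subseteq> X' i" if "i < m" for i
    using bij_betwE[OF e[OF that]] unfolding Y'_def by auto
  have cY: "card (Y' i) = code_card N v y i" if "i < m" for i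
  proof -
    have "inj_on (e i) {j. j < card (X' i) \<and> digit 2 y (i * N + j) = 1}"
      using bij_betw_imp_inj_on[OF e[OF that]] by (rule inj_on_subset) auto
    then show ?thesis unfolding Y'_def code_card_eq sv[OF that] by (rule card_image)
  qed
  have ineq: "p * card (X' i) \<le> 2 * b * card (Y' i)" if "i < m" for i
    using y(2)[OF that] unfolding sv[OF that] cY[OF that] .
  \<comment> \<open>Sampling requires nonempty selections, which is where p >= 1 enters.\<close>
  have Y'ne: "Y' i \<noteq> {}" if "i < m" for i
  proof
    assume "Y' i = {}"
    then have "p * card (X' i) = 0" using ineq[OF that] by simp
    then show False using p c1[OF that] by simp
  qed
  have st: "same_type d m Y'"
    unfolding same_type_def
  proof (intro allI impI)
    fix idx :: "nat \<Rightarrow> nat" assume idx: "strict_mono_on {..d} idx" "idx d < m"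
    have lt: "idx i < m" if "i \<le> d" for i using strict_mono_on_le_last[OF idx(1) that] idx(2) by simp
    \<comment> \<open>Every choice from the selected sets comes from the code t of its labels, so
      that comparing codes compares choices.\<close>
    have code: "\<exists>t<T ^ Suc d. tuple_ok N T d v y t \<and> (\<forall>i\<le>d. digit T t i div N = idx i) \<and>
        orientation d ys = of_int (code_orient T d x t)" if ys: "\<forall>i\<le>d. ys i \<in> Y' (idx i)" for ys
    proof -
      have "\<forall>i. \<exists>j. i \<le> d \<longrightarrow> j < card (X' (idx i)) \<and> digit 2 y (idx i * N + j) = 1 \<and> ys i = e (idx i) j"
        using ys unfolding Y'_def by blast
      then obtain j where j: "\<And>i. i \<le> d \<Longrightarrow> j i < card (X' (idx i)) \<and> digit 2 y (idx i * N + j i) = 1 \<and> ys i = e (idx i) (j i)"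
        by metis
      have jN: "j i < N" if "i \<le> d" for i using j[OF that] X'(1)[OF lt[OF that]] by linarith
      define \<tau> where "\<tau> i = idx i * N + j i" for i
      have \<tau>: "\<tau> i < T" "\<tau> i div N = idx i" "\<tau> i mod N = j i" if "i \<le> d" for i
        using label_div_mod[OF lt[OF that] jN[OF that]] unfolding \<tau>_def T_def by auto
      obtain t where t: "t < T ^ Suc d" "\<And>i. i < Suc d \<Longrightarrow> digit T t i = \<tau> i"
        using ex_digit_code[of "Suc d" \<tau> T] \<tau>(1) by auto
      have ok: "tuple_ok N T d v y t"
        unfolding tuple_ok_def label_ok_def
      proof (intro allI impI)
        fix i assume "i < Suc d"
        then have i: "i \<le> d" by simp
        have "j i \<le> digit N v (idx i)" using j[OF i] sv[OF lt[OF i]] by linarith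
        then show "digit T t i mod N \<le> digit N v (digit T t i div N) \<and> digit 2 y (digit T t i) = 1"
          using t(2)[of i] i \<tau>[OF i] j[OF i] unfolding \<tau>_def by simp
      qed
      have eq: "ys i = P (digit T t i)" if "i \<le> d" for i
        using t(2)[of i] that \<tau>[OF that] j[OF that] unfolding P_def by simp
      have "orientation d ys \<noteq> 0"
        by (rule gen_pos_transversal[OF gp idx]) (use ys Y'X X'(1) lt in blast)
      moreover have "orientation d ys = orientation d (\<lambda>i. P (digit T t i))"
        unfolding orientation_eq by (intro arg_cong[of _ _ sgn] hdet_cong) (simp add: eq)
      ultimately have "orientation d ys = of_int (code_orient T d x t)" using orient[of t] by simp
      then show ?thesis using t ok \<tau>(2) by (intro exI[of _ t]) auto
    qed
    have "orientation d ys = orientation d zs"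
      if ys: "\<forall>i\<le>d. ys i \<in> Y' (idx i)" and zs: "\<forall>i\<le>d. zs i \<in> Y' (idx i)" for ys zs
    proof -
      obtain t where t: "t < T ^ Suc d" "tuple_ok N T d v y t" "\<And>i. i \<le> d \<Longrightarrow> digit T t i div N = idx i"
        "orientation d ys = of_int (code_orient T d x t)" using code[OF ys] by blast
      obtain t' where t': "t' < T ^ Suc d" "tuple_ok N T d v y t'" "\<And>i. i \<le> d \<Longrightarrow> digit T t' i div N = idx i"
        "orientation d zs = of_int (code_orient T d x t')" using code[OF zs] by blast
      have "digit T t i div N < digit T t (Suc i) div N" if "i < d" for i
        using t(3)[of i] t(3)[of "Suc i"] that strict_mono_onD[OF idx(1), of i "Suc i"] by simp
      then have "code_orient T d x t = code_orient T d x t'"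
        by (intro y(1)[unfolded code_same_type_def, rule_format, OF t(1) t'(1)] conjI allI impI t(2) t'(2))
           (simp_all add: t(3) t'(3))
      then show ?thesis using t(4) t'(4) by simp
    qed
    then show "\<exists>s. \<forall>ys. (\<forall>i\<le>d. ys i \<in> Y' (idx i)) \<longrightarrow> orientation d ys = s" by metis
  qed
  obtain Y where Y: "same_type d m Y" "\<And>i. i < m \<Longrightarrow> Y i \<subseteq> X i"
    "\<And>i. i < m \<Longrightarrow> card (Y' i) / card (X' i) \<le> card (Y i) / card (X i) + 1 / (2 * real b)"
    using X'(2)[OF st] Y'X Y'ne by blast
  have "(real p / (2 * real b) - 1 / (2 * real b)) * real (card (X i)) \<le> real (card (Y i))" if i: "i < m" for i
  proof -
    have b0: "real b > 0" using b by simp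
    have x0: "real (card (X' i)) > 0" using c1[OF i] by simp
    have "real (p * card (X' i)) \<le> real (2 * b * card (Y' i))" using ineq[OF i] by (simp only: of_nat_le_iff)
    then have "real p / (2 * real b) \<le> card (Y' i) / card (X' i)" using b0 x0 by (simp add: field_simps)
    then have "real p / (2 * real b) - 1 / (2 * real b) \<le> card (Y i) / card (X i)" using Y(3)[OF i] by linarith
    moreover have "real (card (X i)) > 0" using finX[OF i] by (simp add: card_gt_0_iff)
    ultimately show ?thesis by (simp add: pos_le_divide_eq)
  qed
  then have "real p / (2 * real b) - 1 / (2 * real b) \<in> densities d m X"
    unfolding densities_def using Y(1,2) by blast
  then show ?thesis unfolding c_fam_eq by (rule cSup_upper[OF _ c_fam_bounds(1)[OF m X]])
qed

section \<open>Upper bound: from codes to families\<close>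

lemma strict_mono_on_if_step:
  fixes f :: "nat \<Rightarrow> nat"
  assumes "\<And>i. i < d \<Longrightarrow> f i < f (Suc i)"
  shows "strict_mono_on {..d} f"
proof (rule strict_mono_onI)
  fix i j assume ij: "i \<in> {..d}" "j \<in> {..d}" "i < j"
  from ij(3,2) show "f i < f j"
  proof (induction j)
    case (Suc j)
    then have "f j < f (Suc j)" using assms[of j] by simp
    then show ?case using Suc by (cases "i = j") auto
  qed simp
qed

lemma orientation_eq_0_if_equal_points:
  assumes "i \<le> d" "j \<le> d" "i \<noteq> j" "ys i = ys j"
  shows "orientation d ys = 0"
proof -
  let ?c = "\<lambda>l. if l = i then 1 else if l = j then -1 else (0::real)"
  have "det_n (Suc d) (\<lambda>i. hat (ys i)) = 0"
    unfolding det_n_0_iff_rows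
  proof (intro exI[of _ ?c] conjI allI impI)
    show "\<exists>i<Suc d. ?c i \<noteq> 0" using assms(1) by (intro exI[of _ i]) auto
    fix k
    have "(\<Sum>l<Suc d. ?c l * hat (ys l) k) = (\<Sum>l<Suc d. (if l = i then hat (ys i) k else 0) - (if l = j then hat (ys j) k else 0))"
      by (rule sum.cong) (use assms(3) in auto)
    also have "\<dots> = hat (ys i) k - hat (ys j) k" using assms(1,2) by (simp add: sum_subtractf)
    finally show "(\<Sum>l<Suc d. ?c l * hat (ys l) k) = 0" using assms(4) by simp
  qed
  then show ?thesis unfolding orientation_eq hdet_hat by simp
qed

text \<open>A code at which the test fails describes a genuine family: a same-type selection of
  larger density in it would be a mask y contradicting the failure. The case m <= d is separate, as
  too few labels may then be present for general position of the code to force distinct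
  points.\<close>

lemma density_bound_upper:
  assumes m: "m \<ge> 1" and d: "d \<ge> 1" and b: "b \<ge> 1" and nb: "\<not> density_bound m d b p"
  shows "c_const m d \<le> real p / (2 * real b)"
proof -
  define N where "N = sample_size m d b"
  define T where "T = m * N"
  have N0: "N > 0" unfolding N_def by (rule sample_size_pos)
  have T0: "T > 0" unfolding T_def using N0 m by simp
  have b0: "real b > 0" using b by simp
  obtain x v where gpc: "code_gen_pos N T d x v"
    and no: "\<And>y. y < 2 ^ T \<Longrightarrow> code_same_type N T d x v y \<Longrightarrow> \<exists>i<m. \<not> p * Suc (digit N v i) \<le> 2 * b * code_card N v y i"
    using nb unfolding density_bound_def density_bound_for_def N_def[symmetric] T_def[symmetric] by blast
  define n where "n i = Suc (digit N v i)" for i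
  have nN: "n i \<le> N" for i using digit_less[OF N0] unfolding n_def by (simp add: Suc_le_eq)
  have labT: "l div N < m" "label_ok N v l \<longleftrightarrow> l mod N < n (l div N)" if "l < T" for l
    using that N0 unfolding T_def label_ok_def n_def by (simp_all add: div_less_iff_less_mult less_Suc_eq_le)
  have lab: "i * N + j < T" "(i * N + j) div N = i" "(i * N + j) mod N = j" "label_ok N v (i * N + j)"
    if "i < m" "j < n i" for i j
  proof -
    have "j < N" using that(2) nN[of i] by linarith
    note * = label_div_mod[OF that(1) this]
    show "i * N + j < T" "(i * N + j) div N = i" "(i * N + j) mod N = j" using * unfolding T_def by auto
    then show "label_ok N v (i * N + j)" using labT(2)[of "i * N + j"] that by simp
  qed
  have digT: "digit T t i < T" for t i using digit_less[OF T0] .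
  show ?thesis
  proof (cases "m \<le> d")
    case True
    \<comment> \<open>There are no d + 1 different sets, so selecting every label is of the same
      type with density 1; hence a failing numerator is at least 2b.\<close>
    have "p \<ge> 2 * b"
    proof (rule ccontr)
      assume "\<not> p \<ge> 2 * b"
      then have pb: "p \<le> 2 * b" by simp
      obtain y where y: "y < 2 ^ T" "\<And>l. l < T \<Longrightarrow> digit 2 y l = 1"
        using ex_digit_code[of T "\<lambda>_. 1" 2] by auto
      have "code_same_type N T d x v y"
        unfolding code_same_type_def
      proof (intro allI impI, elim conjE)
        fix t t' assume inc: "\<forall>i<d. digit T t i div N < digit T t (Suc i) div N"
        have "digit T t i div N \<ge> i" if "i \<le> d" for i
          using that inc by (induction i) (auto, metis Suc_le_eq le_less_trans Suc_leI)
        then have "digit T t d div N \<ge> d" by simp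
        moreover have "digit T t d div N < m" using labT(1)[OF digT] .
        ultimately show "code_orient T d x t = code_orient T d x t'" using True by simp
      qed
      from no[OF y(1) this] obtain i where i: "i < m" "\<not> p * n i \<le> 2 * b * code_card N v y i"
        unfolding n_def by blast
      have "{j. j < n i \<and> digit 2 y (i * N + j) = 1} = {..<n i}" using y(2)[OF lab(1)[OF i(1)]] by auto
      then have "code_card N v y i = n i" unfolding code_card_eq n_def[symmetric] by simp
      then show False using i(2) pb by simp
    qed
    then have "real (2 * b) \<le> real p" by (simp only: of_nat_le_iff)
    then have "1 \<le> real p / (2 * real b)" using b0 by (simp add: field_simps)
    moreover obtain X where "X \<in> families d m" using families_nonempty[OF d] by blast
    then have "c_const m d \<le> 1" using c_const_le_c_fam[OF m] c_fam_bounds(3)[OF m] by (metis order_trans)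
    ultimately show ?thesis by simp
  next
    case False
    then have md: "Suc d \<le> m" by simp
    define pt where "pt l = (\<lambda>k. if k < d then of_int (code_coord T d x l k) / real (grid_den T d) else 0)" for l
    have orient: "orientation d (\<lambda>i. pt (\<tau> i)) = of_int (code_orient T d x t)" if "\<And>i. i \<le> d \<Longrightarrow> digit T t i = \<tau> i" for t \<tau>
      by (rule code_orient_eq[OF that]) (auto simp: pt_def)
    have nz: "orientation d (\<lambda>i. pt (\<tau> i)) \<noteq> 0"
      if \<tau>: "\<And>i. i \<le> d \<Longrightarrow> \<tau> i < T \<and> label_ok N v (\<tau> i)" and inj: "inj_on \<tau> {..d}" for \<tau>
    proof -
      obtain t where t: "t < T ^ Suc d" "\<And>i. i < Suc d \<Longrightarrow> digit T t i = \<tau> i"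
        using ex_digit_code[of "Suc d" \<tau> T] \<tau> by auto
      have "code_orient T d x t \<noteq> 0"
      proof (rule gpc[unfolded code_gen_pos_def, rule_format, OF t(1)], intro conjI allI impI)
        show "label_ok N v (digit T t i)" if "i < Suc d" for i using t(2)[OF that] \<tau>[of i] that by simp
        show "digit T t i \<noteq> digit T t j" if "i < Suc d" "j < i" for i j
          using t(2)[of i] t(2)[of j] that inj_onD[OF inj, of i j] by auto
      qed
      then show ?thesis using orient[of t \<tau>] t(2) by simp
    qed
    define VL where "VL = {l. l < T \<and> label_ok N v l}"
    have finVL: "finite VL" unfolding VL_def by simp
    have cVL: "Suc d \<le> card VL"
    proof -
      have "(\<lambda>i. i * N + 0) ` {..<m} \<subseteq> VL" using lab[of _ 0] unfolding VL_def n_def by auto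
      then have "card ((\<lambda>i. i * N + 0) ` {..<m}) \<le> card VL" using finVL by (rule card_mono[rotated])
      moreover have "inj_on (\<lambda>i. i * N + 0) {..<m}" using N0 by (auto simp: inj_on_def)
      ultimately show ?thesis using md by (simp add: card_image)
    qed
    \<comment> \<open>Two labels are completed to d + 1 different ones, which takes d >= 1; if their
      points coincided, the tuple would have orientation 0 against the general position of the
      code.\<close>
    have ptinj: "l = l'" if l: "l \<in> VL" "l' \<in> VL" "pt l = pt l'" for l l'
    proof (rule ccontr)
      assume ne: "l \<noteq> l'"
      have "card {l, l'} \<le> Suc d" using d ne by simp
      moreover have "{l, l'} \<subseteq> VL" using l by simp
      ultimately obtain W where W: "{l, l'} \<subseteq> W" "W \<subseteq> VL" "card W = Suc d"
        using exists_subset_between[OF _ cVL _ finVL, of "{l, l'}"] by blast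
      have "finite W" using W(2) finVL finite_subset by blast
      then obtain \<tau> where \<tau>: "bij_betw \<tau> {0..<card W} W" using ex_bij_betw_nat_finite by blast
      have at: "{0..<card W} = {..d}" unfolding W(3) by auto
      have inj: "inj_on \<tau> {..d}" and im: "\<tau> ` {..d} = W" using \<tau> unfolding at bij_betw_def by auto
      have "orientation d (\<lambda>i. pt (\<tau> i)) \<noteq> 0"
        by (rule nz[OF _ inj]) (use im W(2) VL_def in auto)
      moreover obtain i j where "i \<le> d" "\<tau> i = l" "j \<le> d" "\<tau> j = l'" using im W(1) by (auto simp: image_iff)
      then have "orientation d (\<lambda>i. pt (\<tau> i)) = 0"
        using ne l(3) by (intro orientation_eq_0_if_equal_points[of i d j]) auto
      ultimately show False by simp
    qed
    define X where "X i = (\<lambda>j. pt (i * N + j)) ` {..<n i}" for i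
    have inVL: "i * N + j \<in> VL" if "i < m" "j < n i" for i j using lab[OF that] unfolding VL_def by auto
    have VLX: "pt l \<in> X (l div N)" if "l \<in> VL" for l
    proof -
      have "pt l = pt (l div N * N + l mod N)" by simp
      moreover have "l mod N < n (l div N)" using that labT(2)[of l] unfolding VL_def by auto
      ultimately show ?thesis unfolding X_def by blast
    qed
    have injX: "inj_on (\<lambda>j. pt (i * N + j)) {..<n i}" if "i < m" for i
      using ptinj inVL[OF that] by (intro inj_onI) (metis add_left_cancel lessThan_iff)
    have cX: "card (X i) = n i" if "i < m" for i unfolding X_def using card_image[OF injX[OF that]] by simp
    have "X \<in> families d m"
      unfolding families_def gen_pos_family_def
    proof (intro CollectI conjI allI impI ballI)
      show "in_Rd d p" if "p \<in> X i" for i p using that unfolding X_def in_Rd_def pt_def by auto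
      show "X i \<inter> X j = {}" if "i < m" "j < m" "i \<noteq> j" for i j
      proof (rule ccontr)
        assume "X i \<inter> X j \<noteq> {}"
        then obtain a c where ac: "a < n i" "c < n j" "pt (i * N + a) = pt (j * N + c)" unfolding X_def by auto
        have "i * N + a = j * N + c" using ptinj[OF inVL[OF that(1) ac(1)] inVL[OF that(2) ac(2)] ac(3)] .
        then show False using lab(2)[OF that(1) ac(1)] lab(2)[OF that(2) ac(2)] that(3) by simp
      qed
      show "finite (X i)" for i unfolding X_def by simp
      show "X i \<noteq> {}" for i unfolding X_def n_def by auto
      show "gen_pos_points d (\<Union>i<m. X i)"
        unfolding gen_pos_points_def
      proof (intro allI impI)
        fix ys assume ys: "\<forall>i\<le>d. ys i \<in> (\<Union>i<m. X i)" "inj_on ys {..d}"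
        have "\<exists>l. i \<le> d \<longrightarrow> l \<in> VL \<and> ys i = pt l" for i
          using ys(1) inVL unfolding X_def by blast
        then obtain \<tau> where \<tau>: "\<And>i. i \<le> d \<Longrightarrow> \<tau> i \<in> VL \<and> ys i = pt (\<tau> i)" by metis
        have "inj_on \<tau> {..d}"
        proof (rule inj_onI)
          fix i j assume ij: "i \<in> {..d}" "j \<in> {..d}" "\<tau> i = \<tau> j"
          then have "ys i = ys j" using \<tau>[of i] \<tau>[of j] by simp
          then show "i = j" using ys(2) ij by (auto dest: inj_onD)
        qed
        then have "orientation d (\<lambda>i. pt (\<tau> i)) \<noteq> 0" by (intro nz) (use \<tau> VL_def in auto)
        moreover have "orientation d (\<lambda>i. pt (\<tau> i)) = orientation d ys"
          unfolding orientation_eq by (intro arg_cong[of _ _ sgn] hdet_cong) (simp add: \<tau>)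
        ultimately show "orientation d ys \<noteq> 0" by simp
      qed
    qed
    then have "c_const m d \<le> c_fam d m X" by (rule c_const_le_c_fam[OF m])
    also have "c_fam d m X \<le> real p / (2 * real b)"
      unfolding c_fam_eq
    proof (rule cSup_least)
      show "densities d m X \<noteq> {}" using zero_in_densities[of d m X] by blast
      fix c assume "c \<in> densities d m X"
      then obtain Y where st: "same_type d m Y" and Y: "\<And>i. i < m \<Longrightarrow> Y i \<subseteq> X i"
        and cY: "\<And>i. i < m \<Longrightarrow> c * real (card (X i)) \<le> real (card (Y i))"
        unfolding densities_def by auto
      show "c \<le> real p / (2 * real b)"
      proof (rule ccontr)
        assume "\<not> c \<le> real p / (2 * real b)"
        then have cp: "c > real p / (2 * real b)" by simp
        obtain y where y: "y < 2 ^ T" "\<And>l. l < T \<Longrightarrow> digit 2 y l = of_bool (pt l \<in> Y (l div N))"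
        proof -
          have "of_bool (pt l \<in> Y (l div N)) < (2::nat)" for l by simp
          from ex_digit_code[of T "\<lambda>l. of_bool (pt l \<in> Y (l div N))" 2, OF this] that show ?thesis by blast
        qed
        have "code_same_type N T d x v y"
          unfolding code_same_type_def
        proof (intro allI impI, elim conjE)
          fix t t' assume t: "tuple_ok N T d v y t" and t': "tuple_ok N T d v y t'"
            and eq: "\<forall>i<Suc d. digit T t i div N = digit T t' i div N"
            and inc: "\<forall>i<d. digit T t i div N < digit T t (Suc i) div N"
          define idx where "idx i = digit T t i div N" for i
          have sm: "strict_mono_on {..d} idx" by (rule strict_mono_on_if_step) (use inc idx_def in auto)
          have "idx d < m" unfolding idx_def by (rule labT(1)[OF digT])
          then obtain s where s: "\<And>ys. (\<forall>i\<le>d. ys i \<in> Y (idx i)) \<Longrightarrow> orientation d ys = s"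
            using st sm unfolding same_type_def by blast
          have mem: "pt (digit T u i) \<in> Y (digit T u i div N)" if "tuple_ok N T d v y u" "i \<le> d" for u i
          proof -
            have "digit 2 y (digit T u i) = 1" using that unfolding tuple_ok_def by simp
            then show ?thesis using y(2)[OF digT, of u i] by (cases "pt (digit T u i) \<in> Y (digit T u i div N)") auto
          qed
          have "of_int (code_orient T d x t) = s"
            using s[of "\<lambda>i. pt (digit T t i)"] mem[OF t] orient[of t "digit T t"] unfolding idx_def by simp
          moreover have "of_int (code_orient T d x t') = s"
            using s[of "\<lambda>i. pt (digit T t' i)"] mem[OF t'] orient[of t' "digit T t'"] eq unfolding idx_def by simp
          ultimately show "code_orient T d x t = code_orient T d x t'" by (metis of_int_eq_iff)
        qed
        from no[OF y(1) this] obtain i where i: "i < m" "\<not> p * n i \<le> 2 * b * code_card N v y i"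
          unfolding n_def by blast
        have "code_card N v y i = card (Y i)"
        proof -
          let ?J = "{j. j < n i \<and> digit 2 y (i * N + j) = 1}"
          have "digit 2 y (i * N + j) = 1 \<longleftrightarrow> pt (i * N + j) \<in> Y i" if "j < n i" for j
            using y(2)[OF lab(1)[OF i(1) that]] lab(2)[OF i(1) that] by (cases "pt (i * N + j) \<in> Y i") auto
          then have "(\<lambda>j. pt (i * N + j)) ` ?J = Y i" using Y[OF i(1)] unfolding X_def by auto
          moreover have "inj_on (\<lambda>j. pt (i * N + j)) ?J" by (rule inj_on_subset[OF injX[OF i(1)]]) auto
          ultimately have "card ?J = card (Y i)" using card_image by metis
          then show ?thesis unfolding code_card_eq n_def .
        qed
        moreover have "real p / (2 * real b) * real (n i) \<le> real (card (Y i))"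
        proof -
          have "real p / (2 * real b) * real (n i) \<le> c * real (n i)" using cp by (intro mult_right_mono) auto
          also have "\<dots> \<le> real (card (Y i))" using cY[OF i(1)] cX[OF i(1)] by simp
          finally show ?thesis .
        qed
        then have "real (p * n i) \<le> real (2 * b * card (Y i))" using b0 by (simp add: field_simps)
        ultimately show False using i(2) by (simp only: of_nat_le_iff not_True_eq_False)
      qed
    qed
    finally show ?thesis .
  qed
qed

lemma c_const_lower:
  assumes m: "m \<ge> 1" and d: "d \<ge> 1" and b: "b \<ge> 1" and bound: "p = 0 \<or> density_bound m d b p"
  shows "real p / (2 * real b) - 1 / (2 * real b) \<le> c_const m d"
  unfolding c_const_eq
proof (rule cInf_greatest)
  show "c_fam d m ` families d m \<noteq> {}" using families_nonempty[OF d] by simp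
  fix c assume "c \<in> c_fam d m ` families d m"
  then obtain X where X: "X \<in> families d m" "c = c_fam d m X" by blast
  show "real p / (2 * real b) - 1 / (2 * real b) \<le> c"
  proof (cases "p = 0")
    case True
    then have "real p / (2 * real b) - 1 / (2 * real b) \<le> 0" by simp
    then show ?thesis using c_fam_bounds(2)[OF m X(1)] X(2) by linarith
  next
    case False
    then show ?thesis using density_bound_lower[OF m d b _ _ X(1)] bound X(2) by simp
  qed
qed

theorem theorem2:
  shows "\<exists>fnum fden. \<forall>m d a b. m \<ge> 1 \<longrightarrow> d \<ge> 1 \<longrightarrow> a \<ge> 1 \<longrightarrow> b \<ge> 1 \<longrightarrow>
     (\<exists>p q. recf_eval fnum [m, d, a, b] p \<and> recf_eval fden [m, d, a, b] q \<and> q > 0 \<and>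
        \<bar>real p / real q - c_const m d\<bar> < real a / real b)"
proof -
  define P where "P k xs \<longleftrightarrow> density_bound (entry xs 0) (entry xs (Suc 0)) (entry xs (Suc (Suc (Suc 0)))) (Suc k)" for k xs
  have "pcomputable (Suc (Suc (Suc (Suc (Suc 0))))) (\<lambda>ys. P (entry ys 0) (tl ys))"
    unfolding P_def entry_tl by (rule pcomputable_density_bound)
  from computable_minimization[OF this] obtain fnum where
    fnum: "\<And>xs. length xs = Suc (Suc (Suc (Suc 0))) \<Longrightarrow> \<exists>k. \<not> P k xs \<Longrightarrow> recf_eval fnum xs (LEAST k. \<not> P k xs)"
    by blast
  have "computable (Suc (Suc (Suc (Suc 0)))) (\<lambda>xs. 2 * entry xs (Suc (Suc (Suc 0))))"
    by (intro computable_mult computable_const computable_entry) simp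
  then obtain fden where fden: "\<And>xs. length xs = Suc (Suc (Suc (Suc 0))) \<Longrightarrow> recf_eval fden xs (2 * entry xs (Suc (Suc (Suc 0))))"
    unfolding computable_def by blast
  have "\<exists>p q. recf_eval fnum [m, d, a, b] p \<and> recf_eval fden [m, d, a, b] q \<and> q > 0 \<and>
        \<bar>real p / real q - c_const m d\<bar> < real a / real b"
    if m: "m \<ge> 1" and d: "d \<ge> 1" and a: "a \<ge> 1" and b: "b \<ge> 1" for m d a b
  proof -
    let ?xs = "[m, d, a, b]"
    have Pk: "P k ?xs \<longleftrightarrow> density_bound m d b (Suc k)" for k unfolding P_def by simp
    have b0: "real b \<ge> 1" using b by simp
    obtain X where "X \<in> families d m" using families_nonempty[OF d] by blast
    then have "c_const m d \<le> 1" using c_const_le_c_fam[OF m] c_fam_bounds(3)[OF m] by (metis order_trans)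
    \<comment> \<open>The search ends: success at 2b + 2 would force c(m,d) >= (2b + 1)/(2b) >
      1.\<close>
    have "\<not> density_bound m d b (Suc (2 * b + 1))"
    proof
      assume "density_bound m d b (Suc (2 * b + 1))"
      from c_const_lower[OF m d b disjI2[OF this]]
      have "real (Suc (2 * b + 1)) / (2 * real b) - 1 / (2 * real b) \<le> c_const m d" .
      moreover have "real (Suc (2 * b + 1)) / (2 * real b) - 1 / (2 * real b) = 1 + 1 / (2 * real b)"
        using b0 by (simp add: field_simps)
      moreover have "1 / (2 * real b) > 0" using b0 by simp
      ultimately show False using \<open>c_const m d \<le> 1\<close> by linarith
    qed
    then have ex: "\<exists>k. \<not> P k ?xs" unfolding Pk by blast
    define p where "p = (LEAST k. \<not> P k ?xs)"
    have "\<not> P p ?xs" unfolding p_def using ex by (rule LeastI_ex)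
    then have "c_const m d \<le> real (Suc p) / (2 * real b)" unfolding Pk by (rule density_bound_upper[OF m d b])
    moreover have "p = 0 \<or> density_bound m d b p"
    proof (cases p)
      case (Suc k)
      then have "P k ?xs" using not_less_Least[of k "\<lambda>k. \<not> P k ?xs"] unfolding p_def by auto
      then show ?thesis unfolding Pk Suc by simp
    qed simp
    then have "real p / (2 * real b) - 1 / (2 * real b) \<le> c_const m d" by (rule c_const_lower[OF m d b])
    ultimately have "\<bar>real p / real (2 * b) - c_const m d\<bar> \<le> 1 / (2 * real b)"
      by (simp add: add_divide_distrib abs_le_iff)
    \<comment> \<open>The estimate must be strict, hence steps of 1/(2b) in place of 1/b.\<close>
    also have "\<dots> < real a / real b"
    proof -
      have "1 / (2 * real b) < 1 / real b" using b0 by (intro divide_strict_left_mono) auto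
      also have "\<dots> \<le> real a / real b" using a b0 by (intro divide_right_mono) auto
      finally show ?thesis .
    qed
    finally have "\<bar>real p / real (2 * b) - c_const m d\<bar> < real a / real b" .
    moreover have "recf_eval fnum ?xs p" unfolding p_def using fnum[of ?xs] ex by simp
    moreover have "recf_eval fden ?xs (2 * b)" using fden[of ?xs] by simp
    moreover have "2 * b > 0" using b by simp
    ultimately show ?thesis by blast
  qed
  then show ?thesis by blast
qed

end
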